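(* Let $-A$ be the generator of a bounded analytic semigroup on a Hilbert space $\mathcal{H}$. Then for every $\beta\in(-\infty,1)$ the maximal regularity operator $\mathcal{M}_{+}$, initially defined on $L^2_{c}(0,\infty;dt,\mathsf{D}(A))$ by $$\mathcal{M}_{+}f(t)=\int_{0}^t Ae^{-(t-s)A}f(s)\,ds,\qquad t>0,$$ extends to a bounded operator on $L^2(0,\infty;t^\beta dt,\mathcal{H})$.
   Context: $\mathcal{H}$ is a Hilbert space with norm $\|\cdot\|$. "$-A$ generates a bounded analytic semigroup on $\mathcal{H}$" means that $A$ is a densely defined closed linear operator on $\mathcal{H}$ and $-A$ generates a bounded analytic semigroup $\{e^{-zA}:|\arg z|<\delta\}$ for some $0<\delta<\pi/2$ (equivalently, $A$ is sectorial of type $\omega(A)=\pi/2-\delta$). $\mathsf{D}(A)$ is the domain of $A$ (a Hilbert space for the graph norm). For $\beta\in\mathbf{R}$, $L^2(0,\infty;t^\beta dt,\mathcal{H})$ is the space of (classes of) strongly measurable $f:(0,\infty)\to\mathcal{H}$ with $\int_0^\infty\|f(t)\|^2t^\beta\,dt<\infty$. $L^2_{c}(0,\infty;dt,\mathsf{D}(A))$ is the space of $f\in L^2(0,\infty;dt,\mathsf{D}(A))$ with compact support in $(0,\infty)$; for such $f$ the integral defining $\mathcal{M}_+f(t)$ converges strongly in $\mathcal{H}$ for every $t>0$. *)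

theory Defs
  imports "HOL-Analysis.Analysis"
begin

class complex_hilbert = banach +
  fixes scaleC :: "complex \<Rightarrow> 'a \<Rightarrow> 'a" (infixr \<open>*\<^sub>C\<close> 75)
    and cinner :: "'a \<Rightarrow> 'a \<Rightarrow> complex"
  assumes scaleC_add_right: "c *\<^sub>C (x + y) = c *\<^sub>C x + c *\<^sub>C y"
    and scaleC_add_left: "(c + d) *\<^sub>C x = c *\<^sub>C x + d *\<^sub>C x"
    and scaleC_scaleC: "c *\<^sub>C d *\<^sub>C x = (c * d) *\<^sub>C x"
    and scaleC_of_real: "complex_of_real r *\<^sub>C x = r *\<^sub>R x"
    and cinner_commute: "cinner x y = cnj (cinner y x)"
    and cinner_add_right: "cinner x (y + z) = cinner x y + cinner x z"
    and cinner_scaleC_right: "cinner x (c *\<^sub>C y) = c * cinner x y"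
    and cinner_same: "cinner x x = complex_of_real ((norm x)\<^sup>2)"


section \<open>Strong measurability, Bochner integral, and square integrable functions\<close>

text \<open>The Hilbert space need not be separable, whereas the Bochner integral of HOL-Analysis is
  restricted to second countable spaces, where Borel measurable functions are strongly measurable.
  The definitions below drop that restriction; the integral is otherwise the one of the library,
  built on the same integral of simple functions.\<close>

definition strongly_measurable :: "'a measure \<Rightarrow> ('a \<Rightarrow> 'b::real_normed_vector) \<Rightarrow> bool" where
  "strongly_measurable M f \<longleftrightarrow>
     (\<exists>s. (\<forall>i. simple_function M (s i)) \<and> (AE x in M. (\<lambda>i. s i x) \<longlonglongrightarrow> f x))"

definition has_strong_integral ::
    "'a measure \<Rightarrow> ('a \<Rightarrow> 'b::real_normed_vector) \<Rightarrow> 'b \<Rightarrow> bool" where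
  "has_strong_integral M f y \<longleftrightarrow>
     strongly_measurable M f \<and>
     (\<exists>s. (\<forall>i. Bochner_Integration.simple_bochner_integrable M (s i)) \<and>
          (\<lambda>i. \<integral>\<^sup>+x. ennreal (norm (f x - s i x)) \<partial>M) \<longlonglongrightarrow> 0 \<and>
          (\<lambda>i. Bochner_Integration.simple_bochner_integral M (s i)) \<longlonglongrightarrow> y)"

definition strong_integral :: "'a measure \<Rightarrow> ('a \<Rightarrow> 'b::real_normed_vector) \<Rightarrow> 'b" where
  "strong_integral M f =
     (if \<exists>y. has_strong_integral M f y then THE y. has_strong_integral M f y else 0)"

text \<open>Elements of an \<open>L\<^sup>2\<close> space are represented by functions; equality of classes is
  equality almost everywhere.\<close>

definition L2_fun :: "'a measure \<Rightarrow> ('a \<Rightarrow> 'b::real_normed_vector) set" where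
  "L2_fun M = {f. strongly_measurable M f \<and> (\<integral>\<^sup>+x. ennreal ((norm (f x))\<^sup>2) \<partial>M) < \<infinity>}"

definition L2_norm :: "'a measure \<Rightarrow> ('a \<Rightarrow> 'b::real_normed_vector) \<Rightarrow> real" where
  "L2_norm M f = sqrt (enn2real (\<integral>\<^sup>+x. ennreal ((norm (f x))\<^sup>2) \<partial>M))"

text \<open>The second conjunct says that \<open>T\<close> acts on classes.\<close>

definition bounded_operator_L2 ::
    "'a measure \<Rightarrow> (('a \<Rightarrow> 'h::complex_hilbert) \<Rightarrow> 'a \<Rightarrow> 'h) \<Rightarrow> bool" where
  "bounded_operator_L2 M T \<longleftrightarrow>
     (\<forall>f\<in>L2_fun M. T f \<in> L2_fun M) \<and>
     (\<forall>f\<in>L2_fun M. \<forall>g\<in>L2_fun M. (AE x in M. f x = g x) \<longrightarrow> (AE x in M. T f x = T g x)) \<and>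
     (\<forall>f\<in>L2_fun M. \<forall>g\<in>L2_fun M. AE x in M. T (\<lambda>x. f x + g x) x = T f x + T g x) \<and>
     (\<forall>c. \<forall>f\<in>L2_fun M. AE x in M. T (\<lambda>x. c *\<^sub>C f x) x = c *\<^sub>C T f x) \<and>
     (\<exists>C. \<forall>f\<in>L2_fun M. L2_norm M (T f) \<le> C * L2_norm M f)"

definition half_line :: "real measure" where
  "half_line = lebesgue_on {0<..}"

definition weighted_half_line :: "real \<Rightarrow> real measure" where
  "weighted_half_line \<beta> = density half_line (\<lambda>t. ennreal (t powr \<beta>))"


section \<open>Unbounded operators and bounded analytic semigroups\<close>

text \<open>An unbounded operator is given by its domain \<open>D\<close> and a function \<open>A\<close>, whose values
  outside \<open>D\<close> are irrelevant.\<close>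

definition closed_densely_defined ::
    "'h::complex_hilbert set \<Rightarrow> ('h \<Rightarrow> 'h) \<Rightarrow> bool" where
  "closed_densely_defined D A \<longleftrightarrow>
     0 \<in> D \<and>
     (\<forall>x\<in>D. \<forall>y\<in>D. x + y \<in> D \<and> A (x + y) = A x + A y) \<and>
     (\<forall>c. \<forall>x\<in>D. c *\<^sub>C x \<in> D \<and> A (c *\<^sub>C x) = c *\<^sub>C A x) \<and>
     closure D = UNIV \<and>
     closed {(x, A x) | x. x \<in> D}"

definition bounded_clinear :: "('h::complex_hilbert \<Rightarrow> 'h) \<Rightarrow> bool" where
  "bounded_clinear L \<longleftrightarrow> bounded_linear L \<and> (\<forall>c x. L (c *\<^sub>C x) = c *\<^sub>C L x)"

definition sector :: "real \<Rightarrow> complex set" where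
  "sector \<delta> = {z. z \<noteq> 0 \<and> \<bar>Arg z\<bar> < \<delta>}"

definition operator_holomorphic_on ::
    "(complex \<Rightarrow> 'h \<Rightarrow> 'h::complex_hilbert) \<Rightarrow> complex set \<Rightarrow> bool" where
  "operator_holomorphic_on S U \<longleftrightarrow>
     (\<forall>z\<in>U. \<exists>L. bounded_clinear L \<and>
        ((\<lambda>w. onorm (\<lambda>x. inverse (w - z) *\<^sub>C (S w x - S z x) - L x)) \<longlongrightarrow> 0) (at z within U))"

text \<open>As usual, strong continuity at \<open>0\<close> and boundedness are required on every strictly smaller
  sector.\<close>

definition bounded_analytic_semigroup ::
    "real \<Rightarrow> (complex \<Rightarrow> 'h \<Rightarrow> 'h::complex_hilbert) \<Rightarrow> bool" where
  "bounded_analytic_semigroup \<delta> S \<longleftrightarrow>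
     (\<forall>z\<in>sector \<delta>. bounded_clinear (S z)) \<and>
     (\<forall>x. S 0 x = x) \<and>
     (\<forall>z\<in>sector \<delta>. \<forall>w\<in>sector \<delta>. \<forall>x. S (z + w) x = S z (S w x)) \<and>
     operator_holomorphic_on S (sector \<delta>) \<and>
     (\<forall>\<delta>'. 0 < \<delta>' \<and> \<delta>' < \<delta> \<longrightarrow>
        (\<forall>x. ((\<lambda>z. S z x) \<longlongrightarrow> x) (at 0 within sector \<delta>')) \<and>
        (\<exists>K. \<forall>z\<in>sector \<delta>'. onorm (S z) \<le> K))"

definition is_generator ::
    "(complex \<Rightarrow> 'h \<Rightarrow> 'h::complex_hilbert) \<Rightarrow> 'h set \<Rightarrow> ('h \<Rightarrow> 'h) \<Rightarrow> bool" where
  "is_generator S D B \<longleftrightarrow>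
     D = {x. \<exists>y. ((\<lambda>t. inverse t *\<^sub>R (S (complex_of_real t) x - x)) \<longlongrightarrow> y) (at_right 0)} \<and>
     (\<forall>x\<in>D. ((\<lambda>t. inverse t *\<^sub>R (S (complex_of_real t) x - x)) \<longlongrightarrow> B x) (at_right 0))"

text \<open>\<open>-A\<close> generates the bounded analytic semigroup \<open>S\<close> on the sector of half-angle \<open>\<delta>\<close>; that is,
  \<open>S z\<close> is the operator written \<open>exp (- z A)\<close>.\<close>

definition neg_generates_bounded_analytic_semigroup ::
    "'h::complex_hilbert set \<Rightarrow> ('h \<Rightarrow> 'h) \<Rightarrow> real \<Rightarrow> (complex \<Rightarrow> 'h \<Rightarrow> 'h) \<Rightarrow> bool" where
  "neg_generates_bounded_analytic_semigroup D A \<delta> S \<longleftrightarrow>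
     closed_densely_defined D A \<and>
     0 < \<delta> \<and> \<delta> < pi / 2 \<and>
     bounded_analytic_semigroup \<delta> S \<and>
     is_generator S D (\<lambda>x. - A x)"


section \<open>The maximal regularity operator\<close>

text \<open>The domain \<open>D\<close> with the graph norm is identified isometrically with the graph of \<open>A\<close>,
  a subspace of the product space, whose norm satisfies
  \<open>norm (x, A x) = sqrt ((norm x)\<^sup>2 + (norm (A x))\<^sup>2)\<close>.\<close>

definition L2c_domain :: "'h::complex_hilbert set \<Rightarrow> ('h \<Rightarrow> 'h) \<Rightarrow> (real \<Rightarrow> 'h) set" where
  "L2c_domain D A =
     {f. (AE t in half_line. f t \<in> D) \<and>
         (\<lambda>t. (f t, A (f t))) \<in> L2_fun half_line \<and>
         (\<exists>K. compact K \<and> K \<subseteq> {0<..} \<and> (AE t in half_line. t \<notin> K \<longrightarrow> f t = 0))}"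

definition max_regularity ::
    "('h::complex_hilbert \<Rightarrow> 'h) \<Rightarrow> (complex \<Rightarrow> 'h \<Rightarrow> 'h) \<Rightarrow> (real \<Rightarrow> 'h) \<Rightarrow> real \<Rightarrow> 'h" where
  "max_regularity A S f t =
     strong_integral (lebesgue_on {0<..<t}) (\<lambda>s. A (S (complex_of_real (t - s)) (f s)))"

end

theory Submission
  imports Defs "HOL-Complex_Analysis.Complex_Analysis"
begin

text \<open>Sampling on a grid of mesh \<open>h\<close> turns the operator into the discrete convolution with the kernel
  \<open>k n = exp (- n h A) - exp (- (n + 1) h A)\<close>. Analyticity gives \<open>|k n| \<le> C / (n + 1)\<close> and
  \<open>|k n - k (n + 1)| \<le> C / (n + 1)\<^sup>2\<close> uniformly in \<open>h\<close>, and the partial sums of \<open>k\<close> telescope; summation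
  by parts then bounds the multiplier \<open>\<Sum>n<m. z ^ n k n\<close> uniformly on the unit circle, and the Parseval
  identity on a finite cyclic group, which is where the Hilbert space structure is needed, yields the
  unweighted estimate (de Simon's theorem). Conjugating with the weight \<open>t powr (\<beta> / 2)\<close> perturbs the
  kernel by \<open>((n / j) powr (\<beta> / 2) - 1) k (n - j)\<close>, which is controlled by Schur's test exactly when
  \<open>\<beta> < 1\<close>. Hence the operator is bounded on dyadic step functions, which are dense, and extends.
  For \<open>f\<close> with values in the domain, step functions converging to \<open>f\<close> in the graph norm identify the
  extension with the integral.\<close>

section \<open>Complex Hilbert spaces\<close>

text \<open>The kernel A exp (- (t - s) A) is only bounded by a multiple of 1 / (t - s), which is
  not integrable, so the integral cannot be estimated absolutely. On a step function the integral
  over each cell is a difference of two semigroup values: the singularity never appears and only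
  finite sums remain, which is why everything rests on a grid. All discrete constants are
  independent of the mesh, so the bound survives refinement. The second difference of the kernel
  requires no second derivative, because it factors into two first differences over half the time.
  The restriction on \<beta> is visible in Schur's test: the samples near 0 enter with j powr (-
  \<beta> / 2 - 1 / 2), whose partial sums are of order n powr (1 / 2 - \<beta> / 2) as long as
  \<beta> < 1. Distances in L2 are handled as squared norms in the extended reals, with the triangle
  inequality in the form 2 a + 2 b; this is the source of many factors 2 and 4. Approximations are
  taken at the rate 1 / 4 ^ i, so that convergence almost everywhere follows without passing to
  subsequences.\<close>

lemma scaleC_zero_right [simp]: "c *\<^sub>C (0::'h::complex_hilbert) = 0"
  using scaleC_add_right[of c "0::'h" 0] by simp

lemma scaleC_zero_left [simp]: "0 *\<^sub>C (x::'h::complex_hilbert) = 0"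
  using scaleC_of_real[of 0 x] by simp

lemma scaleC_one [simp]: "1 *\<^sub>C (x::'h::complex_hilbert) = x"
  using scaleC_of_real[of 1 x] by simp

lemma scaleC_minus_one: "(-1) *\<^sub>C (x::'h::complex_hilbert) = - x"
  using scaleC_of_real[of "-1" x] by simp

lemma scaleC_minus_right: "c *\<^sub>C (- x) = - (c *\<^sub>C (x::'h::complex_hilbert))"
  using scaleC_add_right[of c x "- x"] by (simp add: eq_neg_iff_add_eq_0 add.commute)

lemma scaleC_minus_left: "(- c) *\<^sub>C x = - (c *\<^sub>C (x::'h::complex_hilbert))"
  using scaleC_add_left[of c "- c" x] by (simp add: eq_neg_iff_add_eq_0 add.commute)

lemma scaleC_diff_right: "c *\<^sub>C (x - y) = c *\<^sub>C x - c *\<^sub>C (y::'h::complex_hilbert)"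
  using scaleC_add_right[of c x "- y"] by (simp add: scaleC_minus_right)

lemma scaleC_diff_left: "(c - d) *\<^sub>C x = c *\<^sub>C x - d *\<^sub>C (x::'h::complex_hilbert)"
  using scaleC_add_left[of c "- d" x] by (simp add: scaleC_minus_left)

lemma scaleC_sum_right: "c *\<^sub>C (\<Sum>i\<in>I. f i) = (\<Sum>i\<in>I. c *\<^sub>C (f i :: 'h::complex_hilbert))"
  by (induction I rule: infinite_finite_induct) (auto simp: scaleC_add_right)

lemma cinner_zero_right [simp]: "cinner x (0::'h::complex_hilbert) = 0"
  using cinner_add_right[of x "0::'h" 0] by simp

lemma cinner_minus_right: "cinner x (- y) = - cinner x (y::'h::complex_hilbert)"
  using cinner_add_right[of x y "- y"] by (simp add: eq_neg_iff_add_eq_0 add.commute)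

lemma cinner_diff_right: "cinner x (y - z) = cinner x y - cinner x (z::'h::complex_hilbert)"
  using cinner_add_right[of x y "- z"] by (simp add: cinner_minus_right)

lemma cinner_add_left: "cinner (x + y) z = cinner x z + cinner y (z::'h::complex_hilbert)"
  using cinner_commute[of "x + y" z] cinner_commute[of x z] cinner_commute[of y z]
  by (simp add: cinner_add_right)

lemma cinner_zero_left [simp]: "cinner (0::'h::complex_hilbert) x = 0"
  using cinner_commute[of 0 x] by simp

lemma cinner_scaleC_left: "cinner (c *\<^sub>C x) y = cnj c * cinner x (y::'h::complex_hilbert)"
  using cinner_commute[of "c *\<^sub>C x" y] cinner_commute[of x y] by (simp add: cinner_scaleC_right)

lemma cinner_diff_left: "cinner (x - y) z = cinner x z - cinner y (z::'h::complex_hilbert)"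
  using cinner_commute[of "x - y" z] cinner_commute[of x z] cinner_commute[of y z]
  by (simp add: cinner_diff_right)

lemma cinner_sum_right: "cinner x (\<Sum>i\<in>I. f i) = (\<Sum>i\<in>I. cinner x (f i :: 'h::complex_hilbert))"
  by (induction I rule: infinite_finite_induct) (auto simp: cinner_add_right)

lemma cinner_sum_left: "cinner (\<Sum>i\<in>I. f i) x = (\<Sum>i\<in>I. cinner (f i) (x :: 'h::complex_hilbert))"
  by (induction I rule: infinite_finite_induct) (auto simp: cinner_add_left)

lemma norm_scaleC: "norm (c *\<^sub>C x) = cmod c * norm (x::'h::complex_hilbert)"
proof -
  have "complex_of_real ((norm (c *\<^sub>C x))\<^sup>2) = cnj c * c * cinner x x"
    by (simp only: cinner_same[symmetric] cinner_scaleC_right cinner_scaleC_left) (simp add: mult_ac)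
  also have "\<dots> = complex_of_real ((cmod c * norm x)\<^sup>2)"
    using complex_norm_square[of c] by (simp add: cinner_same power_mult_distrib mult.commute)
  finally have "(norm (c *\<^sub>C x))\<^sup>2 = (cmod c * norm x)\<^sup>2"
    using of_real_eq_iff by blast
  thus ?thesis by (simp add: power2_eq_iff_nonneg)
qed

lemma cinner_Cauchy_Schwarz: "cmod (cinner x y) \<le> norm x * norm (y::'h::complex_hilbert)"
proof (cases "x = 0")
  case False
  \<comment> \<open>\<open>c *\<^sub>C x\<close> is the orthogonal projection of y onto the line of
    x; the inequality is the nonnegativity of the squared norm of the remainder.\<close>
  define c where "c = cinner x y / complex_of_real ((norm x)\<^sup>2)"
  have x: "norm x > 0" using False by simp
  have cx: "c * complex_of_real ((norm x)\<^sup>2) = cinner x y"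
    using x by (simp add: c_def)
  have "cinner x (y - c *\<^sub>C x) = 0"
    using cx by (simp add: cinner_diff_right cinner_scaleC_right cinner_same)
  hence "cinner (y - c *\<^sub>C x) (y - c *\<^sub>C x) = cinner (y - c *\<^sub>C x) y"
    using cinner_commute[of "y - c *\<^sub>C x" x]
    by (subst cinner_diff_right) (simp add: cinner_scaleC_right)
  also have "\<dots> = cinner y y - cnj c * cinner x y"
    by (simp add: cinner_diff_left cinner_scaleC_left)
  also have "cnj c * cinner x y = complex_of_real ((cmod (cinner x y))\<^sup>2 / (norm x)\<^sup>2)"
    using x complex_norm_square[of "cinner x y"] by (simp add: c_def mult.commute)
  finally have "complex_of_real ((norm (y - c *\<^sub>C x))\<^sup>2)
      = complex_of_real ((norm y)\<^sup>2 - (cmod (cinner x y))\<^sup>2 / (norm x)\<^sup>2)"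
    by (simp add: cinner_same)
  hence "(norm (y - c *\<^sub>C x))\<^sup>2 = (norm y)\<^sup>2 - (cmod (cinner x y))\<^sup>2 / (norm x)\<^sup>2"
    using of_real_eq_iff by blast
  hence "(cmod (cinner x y))\<^sup>2 / (norm x)\<^sup>2 \<le> (norm y)\<^sup>2"
    using zero_le_power2[of "norm (y - c *\<^sub>C x)"] by linarith
  hence "(cmod (cinner x y))\<^sup>2 \<le> (norm x * norm y)\<^sup>2"
    using x by (simp add: field_simps power_mult_distrib)
  thus ?thesis by (rule power2_le_imp_le) simp
qed simp

text \<open>Turns a scalar bound into a vector bound: in \<open>holomorphic_orbit_step\<close> the
  vector is paired with itself, so scalar complex analysis suffices.\<close>

lemma norm_le_if_cinner_le:
  fixes x :: "'h::complex_hilbert"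
  assumes "cmod (cinner x x) \<le> C * norm x" "0 \<le> C"
  shows "norm x \<le> C"
proof (cases "x = 0")
  case False
  have "norm x * norm x \<le> C * norm x"
    using assms(1) by (simp add: cinner_same power2_eq_square norm_mult)
  thus ?thesis using False by simp
qed (use assms in simp)

subsection \<open>The Parseval identity on a finite cyclic group\<close>

text \<open>Orthogonality of the characters of the cyclic group of order N: the summands are the
  powers of one N-th root of unity z, so the sum is geometric, and z differs from 1 because N cannot
  divide a nonzero n' - n of modulus below N.\<close>

lemma sum_cis_powers:
  fixes n n' N :: nat
  assumes "n < N" "n' < N"
  shows "(\<Sum>k<N. cnj (cis (2 * pi * real k / N) ^ n) * cis (2 * pi * real k / N) ^ n')
           = (if n = n' then of_nat N else 0)"
proof -
  define z where "z = cis (2 * pi * (real n' - real n) / N)"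
  have N: "N > 0" using assms by simp
  have eq: "cnj (cis (2 * pi * k / N) ^ n) * cis (2 * pi * k / N) ^ n' = z ^ k" for k :: nat
  proof -
    have "cnj (cis (2 * pi * k / N) ^ n) = cis (- (real n * (2 * pi * k / N)))"
      by (metis Complex.DeMoivre cis_cnj)
    moreover have "cis (2 * pi * k / N) ^ n' = cis (real n' * (2 * pi * k / N))"
      by (simp only: Complex.DeMoivre)
    moreover have "z ^ k = cis (real k * (2 * pi * (real n' - real n) / N))"
      by (simp only: Complex.DeMoivre z_def)
    moreover have "- (real n * (2 * pi * k / N)) + real n' * (2 * pi * k / N)
        = real k * (2 * pi * (real n' - real n) / N)"
      by (simp add: diff_divide_distrib right_diff_distrib left_diff_distrib mult_ac)
    ultimately show ?thesis by (simp only: cis_mult)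
  qed
  show ?thesis
  proof (cases "n = n'")
    case True
    thus ?thesis by (subst eq) (simp add: z_def)
  next
    case False
    have "z \<noteq> 1"
    proof
      assume "z = 1"
      hence "cos (2 * pi * (real n' - real n) / N) = 1" by (simp add: z_def complex_eq_iff)
      then obtain m :: int where "2 * pi * (real n' - real n) / N = real_of_int m * 2 * pi"
        by (auto simp: cos_one_2pi_int)
      hence "2 * pi * (real n' - real n) = (real_of_int m * 2 * pi) * N" using N by (subst (asm) divide_eq_eq) simp
      hence "(2 * pi) * (real n' - real n) = (2 * pi) * (real N * real_of_int m)" by (simp only: mult_ac)
      hence "real n' - real n = real N * real_of_int m" by (subst (asm) mult_cancel_left) simp
      hence "real_of_int (int n' - int n) = real_of_int (int N * m)" by simp
      hence "int n' - int n = int N * m" using of_int_eq_iff by blast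
      hence "int N dvd int n' - int n" by simp
      moreover have "\<bar>int n' - int n\<bar> < int N" "int n' - int n \<noteq> 0" using assms False by auto
      ultimately show False using dvd_imp_le_int[of "int n' - int n" "int N"] by linarith
    qed
    moreover have "z ^ N = 1"
    proof -
      have "z ^ N = cis (2 * pi * (int n' - int n))" using N by (simp add: z_def Complex.DeMoivre)
      thus ?thesis using cis_multiple_2pi[of "real_of_int (int n' - int n)"] by simp
    qed
    ultimately show ?thesis
      using False by (subst eq) (simp add: sum_gp_strict)
  qed
qed

lemma Parseval_cyclic:
  fixes y :: "nat \<Rightarrow> 'h::complex_hilbert"
  shows "(\<Sum>k<N. (norm (\<Sum>n<N. cis (2 * pi * real k / N) ^ n *\<^sub>C y n))\<^sup>2) = N * (\<Sum>n<N. (norm (y n))\<^sup>2)"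
proof -
  let ?w = "\<lambda>k n. cis (2 * pi * real k / real N) ^ n"
  have "complex_of_real (\<Sum>k<N. (norm (\<Sum>n<N. ?w k n *\<^sub>C y n))\<^sup>2)
      = (\<Sum>k<N. cinner (\<Sum>n<N. ?w k n *\<^sub>C y n) (\<Sum>n<N. ?w k n *\<^sub>C y n))"
    by (simp add: cinner_same)
  also have "\<dots> = (\<Sum>k<N. \<Sum>n'<N. \<Sum>n<N. (cnj (?w k n) * ?w k n') * cinner (y n) (y n'))"
    by (simp add: cinner_sum_right cinner_sum_left cinner_scaleC_left cinner_scaleC_right sum_distrib_left
        mult_ac)
  also have "\<dots> = (\<Sum>n'<N. \<Sum>k<N. \<Sum>n<N. (cnj (?w k n) * ?w k n') * cinner (y n) (y n'))"
    by (rule sum.swap)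
  also have "\<dots> = (\<Sum>n'<N. \<Sum>n<N. \<Sum>k<N. (cnj (?w k n) * ?w k n') * cinner (y n) (y n'))"
    by (intro sum.cong refl sum.swap)
  also have "\<dots> = (\<Sum>n'<N. \<Sum>n<N. (\<Sum>k<N. cnj (?w k n) * ?w k n') * cinner (y n) (y n'))"
    by (simp add: sum_distrib_right)
  also have "\<dots> = (\<Sum>n'<N. \<Sum>n<N. (if n = n' then of_nat N * cinner (y n) (y n) else 0))"
    using sum_cis_powers[where N=N] by (intro sum.cong refl) auto
  also have "\<dots> = complex_of_real (N * (\<Sum>n<N. (norm (y n))\<^sup>2))"
    by (simp add: cinner_same sum_distrib_left)
  finally show ?thesis using of_real_eq_iff by blast
qed

section \<open>Discrete maximal regularity\<close>

lemma norm_power_diff_le: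
  fixes z :: complex
  assumes "cmod z = 1"
  shows "cmod (z ^ n - 1) \<le> n * cmod (z - 1)"
proof (induction n)
  case (Suc n)
  have "z ^ Suc n - 1 = z * (z ^ n - 1) + (z - 1)" by (simp add: algebra_simps)
  hence "cmod (z ^ Suc n - 1) \<le> cmod (z * (z ^ n - 1)) + cmod (z - 1)"
    by (metis norm_triangle_ineq)
  also have "cmod (z * (z ^ n - 1)) = cmod (z ^ n - 1)" using assms by (simp only: norm_mult)
  finally show ?case using Suc by (simp add: ring_distribs)
qed simp

text \<open>The terms are dominated by 1 / n - 1 / (n + 1), which telescope. This bounds the
  remainder left by summation by parts.\<close>

lemma sum_inverse_squares_le:
  assumes "(N::nat) > 0" "N \<le> m"
  shows "(\<Sum>n=N..<m. 1 / (real n + 1)\<^sup>2) \<le> 1 / N - 1 / m"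
  using assms(2)
proof (induction m rule: dec_induct)
  case (step m)
  have "m > 0" using step assms by simp
  have "1 / (real m + 1)\<^sup>2 \<le> 1 / (m * (real m + 1))"
    using \<open>m > 0\<close> by (intro divide_left_mono) (auto simp: power2_eq_square)
  also have "\<dots> = 1 / real m - 1 / real (Suc m)" using \<open>m > 0\<close> by (simp add: field_simps)
  finally show ?case using step by simp
qed simp

text \<open>The terms with \<open>n \<le> 1 / |z - 1|\<close> are compared with the partial sum at \<open>z = 1\<close>; the remaining
  ones are summed by parts.\<close>

lemma norm_trigonometric_sum_le:
  fixes a :: "nat \<Rightarrow> 'h::complex_hilbert"
  assumes a: "\<And>n. norm (a n) \<le> C / (real n + 1)"
    and da: "\<And>n. norm (a n - a (Suc n)) \<le> C / (real n + 1)\<^sup>2"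
    and sa: "\<And>n. norm (\<Sum>i<n. a i) \<le> C"
    and z: "cmod z = 1"
  shows "norm (\<Sum>n<m. z ^ n *\<^sub>C a n) \<le> 7 * C"
proof -
  have C: "C \<ge> 0" using sa[of 0] by simp
  define d where "d = cmod (z - 1)"
  have d2: "d \<le> 2" using norm_triangle_ineq4[of z 1] z by (simp add: d_def)
  \<comment> \<open>Split z ^ n into (z ^ n - 1) + 1: the growth n d of the first part is cancelled
    by the decay 1 / (n + 1) of a n, and the second part leaves the partial sums bounded by
    \<open>sa\<close>.\<close>
  have head: "norm (\<Sum>n<N. z ^ n *\<^sub>C a n) \<le> C * d * N + C" for N
  proof -
    have "(\<Sum>n<N. z ^ n *\<^sub>C a n) = (\<Sum>n<N. (z ^ n - 1) *\<^sub>C a n) + (\<Sum>n<N. a n)"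
      by (simp add: scaleC_diff_left sum.distrib[symmetric])
    also have "norm \<dots> \<le> (\<Sum>n<N. C * d) + C"
    proof (intro order.trans[OF norm_triangle_ineq] add_mono sa order.trans[OF norm_sum] sum_mono)
      fix n
      have "norm ((z ^ n - 1) *\<^sub>C a n) \<le> (n * d) * (C / (real n + 1))"
        unfolding norm_scaleC d_def by (intro mult_mono norm_power_diff_le z a) auto
      also have "\<dots> = (C * d) * (n / (real n + 1))" by simp
      also have "\<dots> \<le> (C * d) * 1" using C by (intro mult_left_mono) (auto simp: d_def)
      finally show "norm ((z ^ n - 1) *\<^sub>C a n) \<le> C * d" by simp
    qed
    finally show ?thesis by (simp add: mult_ac)
  qed
  show ?thesis
  \<comment> \<open>The threshold is 3 because N = ceiling (1 / d) satisfies N d \<le> 1 + d \<le>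
    3; in the second case N is therefore at most m. The head costs 4 C and the tail 3 C, hence the
    constant 7.\<close>
  proof (cases "real m * d \<le> 3")
    case True
    have "norm (\<Sum>n<m. z ^ n *\<^sub>C a n) \<le> C * (d * m) + C" using head[of m] by (simp add: mult_ac)
    also have "\<dots> \<le> C * 3 + C" using True C by (intro add_mono mult_left_mono) (auto simp: mult_ac)
    finally show ?thesis using C by simp
  next
    case False
    hence d: "d > 0" by (cases "d = 0") (auto simp: d_def)
    define N where "N = nat \<lceil>1 / d\<rceil>"
    have N: "real N \<ge> 1 / d" "real N \<le> 1 / d + 1" using d by (auto simp: N_def)
    have N0: "N > 0" using N(1) d by (metis less_divide_eq_1_pos not_le of_nat_0 of_nat_0_less_iff zero_less_divide_1_iff order_less_le_trans)
    have Nd: "real N * d \<ge> 1" "real N * d \<le> 3"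
      using N d d2 by (auto simp: field_simps)
    have "N \<le> m" using Nd False d by (metis linorder_not_le mult_le_cancel_right_pos of_nat_le_iff order.trans order_less_imp_le)
    \<comment> \<open>Multiplication by 1 - z, of modulus d, makes the sum telescope up to
      differences of a n. The right side is at most 3 C / N, and dividing by d is harmless because N
      d \<ge> 1.\<close>
    have parts: "(1 - z) *\<^sub>C (\<Sum>n=N..<m. z ^ n *\<^sub>C a n)
      = z ^ N *\<^sub>C a N - z ^ m *\<^sub>C a m - (\<Sum>n=N..<m. z ^ Suc n *\<^sub>C (a n - a (Suc n)))"
      using \<open>N \<le> m\<close>
    proof (induction m rule: dec_induct)
      case (step m)
      thus ?case
        by (simp add: scaleC_add_right scaleC_diff_right scaleC_diff_left scaleC_scaleC algebra_simps)
    qed simp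
    have aN: "norm (a n) \<le> C / N" if "n \<ge> N" for n
    proof -
      have "C / (real n + 1) \<le> C / N" using that N0 C by (intro divide_left_mono) auto
      thus ?thesis using a[of n] by linarith
    qed
    have "d * norm (\<Sum>n=N..<m. z ^ n *\<^sub>C a n) = norm ((1 - z) *\<^sub>C (\<Sum>n=N..<m. z ^ n *\<^sub>C a n))"
      by (simp add: norm_scaleC d_def norm_minus_commute)
    also have "\<dots> \<le> norm (a N) + norm (a m) + (\<Sum>n=N..<m. norm (a n - a (Suc n)))"
      unfolding parts
      by (intro order.trans[OF norm_triangle_ineq4] add_mono order.trans[OF norm_sum] sum_mono)
         (auto simp: norm_scaleC norm_power norm_mult z)
    also have "\<dots> \<le> C / N + C / N + (\<Sum>n=N..<m. C * (1 / (real n + 1)\<^sup>2))"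
      using da \<open>N \<le> m\<close> by (intro add_mono aN sum_mono) auto
    also have "(\<Sum>n=N..<m. C * (1 / (real n + 1)\<^sup>2)) \<le> C * (1 / N - 1 / m)"
      unfolding sum_distrib_left[symmetric]
      by (intro mult_left_mono sum_inverse_squares_le N0 \<open>N \<le> m\<close> C)
    also have "\<dots> \<le> C / N" using C by (simp add: algebra_simps)
    finally have "d * norm (\<Sum>n=N..<m. z ^ n *\<^sub>C a n) \<le> 3 * C / N" by simp
    hence "(N * d) * norm (\<Sum>n=N..<m. z ^ n *\<^sub>C a n) \<le> 3 * C" using N0 by (simp add: field_simps)
    moreover have "1 * norm (\<Sum>n=N..<m. z ^ n *\<^sub>C a n) \<le> (N * d) * norm (\<Sum>n=N..<m. z ^ n *\<^sub>C a n)"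
      using Nd by (intro mult_right_mono) auto
    ultimately have tail: "norm (\<Sum>n=N..<m. z ^ n *\<^sub>C a n) \<le> 3 * C" by simp
    have "norm (\<Sum>n<N. z ^ n *\<^sub>C a n) \<le> C * (N * d) + C" using head[of N] by (simp add: mult_ac)
    also have "\<dots> \<le> C * 3 + C" using Nd C by (intro add_mono mult_left_mono) auto
    finally have "norm (\<Sum>n<N. z ^ n *\<^sub>C a n) \<le> 4 * C" by simp
    moreover have "(\<Sum>n<m. z ^ n *\<^sub>C a n) = (\<Sum>n<N. z ^ n *\<^sub>C a n) + (\<Sum>n=N..<m. z ^ n *\<^sub>C a n)"
      using \<open>N \<le> m\<close> by (simp add: lessThan_atLeast0 sum.atLeastLessThan_concat)
    ultimately show ?thesis
      using tail norm_triangle_ineq[of "\<Sum>n<N. z ^ n *\<^sub>C a n" "\<Sum>n=N..<m. z ^ n *\<^sub>C a n"] by simp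
  qed
qed

text \<open>Sequences of length \<open>m\<close> are padded to the cyclic group of order \<open>2 m\<close>, where no wrap-around
  occurs and the Parseval identity applies.\<close>

lemma discrete_maximal_regularity:
  fixes k :: "nat \<Rightarrow> 'h \<Rightarrow> 'h::complex_hilbert"
  assumes add: "\<And>n x y. k n (x + y) = k n x + k n y"
    and scale: "\<And>n c x. k n (c *\<^sub>C x) = c *\<^sub>C k n x"
    and k: "\<And>n x. norm (k n x) \<le> C / (real n + 1) * norm x"
    and dk: "\<And>n x. norm (k n x - k (Suc n) x) \<le> C / (real n + 1)\<^sup>2 * norm x"
    and sk: "\<And>n x. norm (\<Sum>i<n. k i x) \<le> C * norm x"
  shows "(\<Sum>n<m. (norm (\<Sum>j\<le>n. k (n - j) (x j)))\<^sup>2) \<le> (7 * C)\<^sup>2 * (\<Sum>j<m. (norm (x j))\<^sup>2)"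
proof (cases "m = 0")
  case False
  have k0: "k n 0 = 0" for n using add[of n 0 0] by simp
  have ksum: "k n (\<Sum>i\<in>I. f i) = (\<Sum>i\<in>I. k n (f i))" for n f and I :: "nat set"
    by (induction I rule: infinite_finite_induct) (auto simp: k0 add)
  \<comment> \<open>y is the full convolution, supported below 2 m; its entries with n < m are the
    sums to be estimated.\<close>
  define y where "y n = (\<Sum>(i,j)\<in>{(i,j). i < m \<and> j < m \<and> i + j = n}. k i (x j))" for n
  define x' where "x' j = (if j < m then x j else 0)" for j
  define w where "w l = cis (2 * pi * real l / real (2 * m))" for l
  have w: "cmod (w l) = 1" for l by (simp add: w_def)
  have fin: "finite {(i,j). i < m \<and> j < m \<and> i + j = n}" for n
    by (rule finite_subset[of _ "{..<m} \<times> {..<m}"]) auto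
  have conv: "(\<Sum>n<2*m. z ^ n *\<^sub>C y n) = (\<Sum>i<m. z ^ i *\<^sub>C k i (\<Sum>j<m. z ^ j *\<^sub>C x j))" for z
  proof -
    have "(\<Sum>n<2*m. z ^ n *\<^sub>C y n)
      = (\<Sum>n<2*m. \<Sum>(i,j)\<in>{(i,j). i < m \<and> j < m \<and> i + j = n}. z ^ i *\<^sub>C z ^ j *\<^sub>C k i (x j))"
      unfolding y_def scaleC_sum_right
      by (intro sum.cong refl) (auto simp: scaleC_scaleC power_add)
    also have "\<dots> = (\<Sum>(i,j)\<in>{..<m} \<times> {..<m}. z ^ i *\<^sub>C z ^ j *\<^sub>C k i (x j))"
    proof -
      have "(\<Sum>n<2*m. \<Sum>p\<in>{p \<in> {..<m} \<times> {..<m}. fst p + snd p = n}. z ^ fst p *\<^sub>C z ^ snd p *\<^sub>C k (fst p) (x (snd p)))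
         = (\<Sum>p\<in>{..<m} \<times> {..<m}. z ^ fst p *\<^sub>C z ^ snd p *\<^sub>C k (fst p) (x (snd p)))"
        by (rule sum.group) auto
      moreover have "{(i,j). i < m \<and> j < m \<and> i + j = n} = {p \<in> {..<m} \<times> {..<m}. fst p + snd p = n}" for n
        by auto
      ultimately show ?thesis by (simp add: case_prod_beta)
    qed
    also have "\<dots> = (\<Sum>i<m. z ^ i *\<^sub>C k i (\<Sum>j<m. z ^ j *\<^sub>C x j))"
      by (simp add: sum.cartesian_product[symmetric] ksum scale scaleC_sum_right)
    finally show ?thesis .
  qed
  have mult: "(norm (\<Sum>n<2*m. w l ^ n *\<^sub>C y n))\<^sup>2 \<le> (7 * C)\<^sup>2 * (norm (\<Sum>n<2*m. w l ^ n *\<^sub>C x' n))\<^sup>2" for l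
  proof -
    have eq: "(\<Sum>n<2*m. w l ^ n *\<^sub>C x' n) = (\<Sum>n<m. w l ^ n *\<^sub>C x n)"
      by (intro sum.mono_neutral_cong_right) (auto simp: x'_def)
    \<comment> \<open>By \<open>conv\<close> the transform of y at w l is the trigonometric sum of a
      i = k i v, where v is the transform of x at w l. The kernel bounds give the hypotheses of
      \<open>norm_trigonometric_sum_le\<close> with C * norm v in place of C.\<close>
    have "norm (\<Sum>n<2*m. w l ^ n *\<^sub>C y n) \<le> 7 * (C * norm (\<Sum>n<m. w l ^ n *\<^sub>C x n))"
      unfolding conv using k dk sk w by (intro norm_trigonometric_sum_le) auto
    thus ?thesis unfolding eq power_mult_distrib[symmetric] by (intro power_mono) auto
  qed
  have "(\<Sum>n<m. (norm (\<Sum>j\<le>n. k (n - j) (x j)))\<^sup>2) = (\<Sum>n<m. (norm (y n))\<^sup>2)"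
  proof (intro sum.cong refl)
    fix n assume "n \<in> {..<m}"
    have "y n = (\<Sum>j\<le>n. k (n - j) (x j))"
      unfolding y_def using \<open>n \<in> {..<m}\<close>
      by (intro sum.reindex_bij_witness[of _ "\<lambda>j. (n - j, j)" snd]) auto
    thus "(norm (\<Sum>j\<le>n. k (n - j) (x j)))\<^sup>2 = (norm (y n))\<^sup>2" by simp
  qed
  also have "\<dots> \<le> (\<Sum>n<2*m. (norm (y n))\<^sup>2)" by (intro sum_mono2) auto
  also have "real (2 * m) * \<dots> = (\<Sum>l<2*m. (norm (\<Sum>n<2*m. w l ^ n *\<^sub>C y n))\<^sup>2)"
    unfolding w_def by (rule Parseval_cyclic[symmetric])
  also have "\<dots> \<le> (\<Sum>l<2*m. (7 * C)\<^sup>2 * (norm (\<Sum>n<2*m. w l ^ n *\<^sub>C x' n))\<^sup>2)"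
    by (intro sum_mono mult)
  also have "\<dots> = (7 * C)\<^sup>2 * (real (2 * m) * (\<Sum>n<2*m. (norm (x' n))\<^sup>2))"
    unfolding w_def sum_distrib_left[symmetric] Parseval_cyclic ..
  also have "(\<Sum>n<2*m. (norm (x' n))\<^sup>2) = (\<Sum>n<m. (norm (x n))\<^sup>2)"
    by (intro sum.mono_neutral_cong_right) (auto simp: x'_def)
  finally show ?thesis using False by (simp add: mult.left_commute)
qed simp

subsection \<open>Power weights\<close>

text \<open>Applied with u = j / n: the factor 1 - u, which Bernoulli's inequality provides, cancels
  the singularity 1 / (n - j) of the kernel. For positive b a factor u powr (- b) remains.\<close>

lemma abs_powr_minus_one_le:
  fixes u b :: real
  assumes u: "0 < u" "u \<le> 1" and N: "\<bar>b\<bar> \<le> real N"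
  shows "\<bar>u powr (- b) - 1\<bar> \<le> N * (1 - u) * u powr (- max b 0)"
proof -
  have *: "1 - u powr \<bar>b\<bar> \<le> N * (1 - u)"
  proof -
    have "1 + real N * (u - 1) \<le> u ^ N" using Bernoulli_inequality[of "u - 1" N] u by simp
    also have "u ^ N = u powr real N" using u by (simp add: powr_realpow)
    also have "\<dots> \<le> u powr \<bar>b\<bar>" using u N by (intro powr_mono') auto
    finally show ?thesis by (simp add: algebra_simps)
  qed
  have le1: "u powr \<bar>b\<bar> \<le> 1" using u by (simp add: powr_le1)
  show ?thesis
  proof (cases "b \<le> 0")
    case True
    hence "\<bar>b\<bar> = - b" "max b 0 = 0" by auto
    thus ?thesis using * le1 u by simp
  next
    case False
    have "u powr (- b) - 1 = u powr (- b) * (1 - u powr b)"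
      using u by (simp add: right_diff_distrib powr_add[symmetric])
    also have "\<bar>\<dots>\<bar> = u powr (- b) * (1 - u powr \<bar>b\<bar>)"
      using False le1 by (simp add: abs_mult)
    also have "\<dots> \<le> u powr (- b) * (N * (1 - u))" by (intro mult_left_mono *) auto
    finally show ?thesis using False by (simp add: mult_ac)
  qed
qed

text \<open>Since x powr (\<theta> - 1) is nonincreasing, the mean value theorem compares each term
  with an increment of x powr \<theta> / \<theta>, and the increments telescope.\<close>

lemma sum_powr_le:
  fixes \<theta> :: real
  assumes \<theta>: "0 < \<theta>" "\<theta> \<le> 1"
  shows "(\<Sum>j=1..n. real j powr (\<theta> - 1)) \<le> real n powr \<theta> / \<theta>"
proof (induction n)
  case (Suc n)
  have "\<theta> * real (Suc n) powr (\<theta> - 1) \<le> real (Suc n) powr \<theta> - real n powr \<theta>"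
  \<comment> \<open>At n = 0 the mean value theorem would need a derivative up to 0; there the claim
    is just \<theta> \<le> 1, because \<open>0 powr \<theta> = 0\<close>.\<close>
  proof (cases "n = 0")
    case False
    have "\<exists>z::real. n < z \<and> z < real (Suc n) \<and>
        real (Suc n) powr \<theta> - real n powr \<theta> = (real (Suc n) - real n) * (\<theta> * z powr (\<theta> - 1))"
      
      by (rule MVT2[where f = "\<lambda>x. x powr \<theta>" and f' = "\<lambda>x. \<theta> * x powr (\<theta> - 1)"])
         (use False in \<open>auto intro!: has_real_derivative_powr\<close>)
    then obtain z :: real where z: "n < z" "z < real (Suc n)"
      "real (Suc n) powr \<theta> - real n powr \<theta> = (real (Suc n) - real n) * (\<theta> * z powr (\<theta> - 1))" by blast
    have "real (Suc n) powr (\<theta> - 1) \<le> z powr (\<theta> - 1)"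
      using z(1,2) \<theta> False by (intro powr_mono2') auto
    hence "\<theta> * real (Suc n) powr (\<theta> - 1) \<le> \<theta> * z powr (\<theta> - 1)"
      using \<theta> by (intro mult_left_mono) auto
    moreover have "real (Suc n) - real n = 1" by simp
    ultimately show ?thesis unfolding z(3) by (simp only: mult_1)
  qed (use \<theta> in simp)
  hence "real (Suc n) powr (\<theta> - 1) \<le> (real (Suc n) powr \<theta> - real n powr \<theta>) / \<theta>"
    using \<theta> by (simp only: pos_le_divide_eq mult.commute)
  moreover have "(\<Sum>j=1..Suc n. real j powr (\<theta> - 1))
      = (\<Sum>j=1..n. real j powr (\<theta> - 1)) + real (Suc n) powr (\<theta> - 1)" by simp
  ultimately show ?case using Suc by (simp only: diff_divide_distrib)
qed simp

text \<open>The same comparison with the increments of - x powr (- \<theta>) / \<theta>, whose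
  telescoping sum is controlled by its value at j.\<close>

lemma sum_powr_tail_le:
  fixes \<theta> :: real
  assumes \<theta>: "0 < \<theta>" and j: "j > 0"
  shows "(\<Sum>n=Suc j..N. real n powr (- \<theta> - 1)) \<le> real j powr (- \<theta>) / \<theta>"
proof (cases "j \<le> N")
  case True
  hence "(\<Sum>n=Suc j..N. real n powr (- \<theta> - 1)) \<le> (real j powr (- \<theta>) - real N powr (- \<theta>)) / \<theta>"
  proof (induction N rule: dec_induct)
    case (step n)
    have n: "n > 0" using step j by simp
    have "\<exists>z::real. n < z \<and> z < real (Suc n) \<and>
        real (Suc n) powr (- \<theta>) - real n powr (- \<theta>) = (real (Suc n) - real n) * (- \<theta> * z powr (- \<theta> - 1))"
      
      by (rule MVT2[where f = "\<lambda>x. x powr (- \<theta>)" and f' = "\<lambda>x. - \<theta> * x powr (- \<theta> - 1)"])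
         (use n has_real_derivative_powr[of _ "- \<theta>"] in auto)
    then obtain z :: real where z: "n < z" "z < real (Suc n)"
      "real (Suc n) powr (- \<theta>) - real n powr (- \<theta>) = (real (Suc n) - real n) * (- \<theta> * z powr (- \<theta> - 1))" by blast
    have "real (Suc n) powr (- \<theta> - 1) \<le> z powr (- \<theta> - 1)"
      using z(1,2) \<theta> n by (intro powr_mono2') auto
    hence "\<theta> * real (Suc n) powr (- \<theta> - 1) \<le> real n powr (- \<theta>) - real (Suc n) powr (- \<theta>)"
    proof -
      have "\<theta> * real (Suc n) powr (- \<theta> - 1) \<le> \<theta> * z powr (- \<theta> - 1)"
        using \<theta> \<open>real (Suc n) powr (- \<theta> - 1) \<le> z powr (- \<theta> - 1)\<close> by (intro mult_left_mono) auto
      moreover have "real (Suc n) - real n = 1" by simp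
      ultimately show ?thesis using z(3) by (simp only: mult_1 minus_mult_left[symmetric])
    qed
    hence "real (Suc n) powr (- \<theta> - 1) \<le> (real n powr (- \<theta>) - real (Suc n) powr (- \<theta>)) / \<theta>"
      using \<theta> by (simp only: pos_le_divide_eq mult.commute)
    moreover have "(\<Sum>m=Suc j..Suc n. real m powr (- \<theta> - 1))
        = (\<Sum>m=Suc j..n. real m powr (- \<theta> - 1)) + real (Suc n) powr (- \<theta> - 1)" using step by simp
    ultimately show ?case using step.IH by (simp only: diff_divide_distrib)
  qed simp
  also have "\<dots> \<le> real j powr (- \<theta>) / \<theta>" using \<theta> by (intro divide_right_mono) auto
  finally show ?thesis .
qed (use \<theta> in simp)

text \<open>Schur's test with the weights \<open>j powr (- 1 / 2)\<close>.\<close>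

lemma discrete_Hardy_inequality:
  fixes a :: "nat \<Rightarrow> real" and c :: real
  assumes c: "0 \<le> c" "c < 1 / 2"
  shows "(\<Sum>n=1..N. (\<Sum>j=1..<n. (n / j) powr c / n * a j)\<^sup>2) \<le> (\<Sum>j=1..N. (a j)\<^sup>2) / (1 / 2 - c)\<^sup>2"
proof -
  define \<theta> where "\<theta> = 1 / 2 - c"
  have \<theta>: "0 < \<theta>" "\<theta> \<le> 1" using c by (auto simp: \<theta>_def)
  have row: "(\<Sum>j=1..<n. (n / j) powr c / n * a j)\<^sup>2
      \<le> (\<Sum>j=1..<n. real n powr (- \<theta> - 1) * (real j powr \<theta> * (a j)\<^sup>2 / \<theta>))" if n: "n \<in> {1..N}" for n
  proof -
    \<comment> \<open>The kernel is n powr (c - 1) * j powr (- c). In Cauchy-Schwarz the square of u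
      carries it with the Schur weight j powr (- 1 / 2), the square of v with the inverse weight;
      note - c - 1 / 2 = \<theta> - 1 and - c + 1 / 2 = \<theta>.\<close>
    define u where "u j = real n powr ((c - 1) / 2) * real j powr ((\<theta> - 1) / 2)" for j :: nat
    define v where "v j = real n powr ((c - 1) / 2) * real j powr (\<theta> / 2) * a j" for j :: nat
    have sq: "(x powr (y / 2))\<^sup>2 = x powr y" for x y :: real
      by (simp add: power2_eq_square powr_add[symmetric])
    have uv: "(n / j) powr c / n * a j = u j * v j" if "j \<in> {1..<n}" for j
    proof -
      have "(n / j) powr c / n = real n powr (c - 1) * real j powr (- c)"
        using n that by (simp add: powr_divide powr_diff powr_minus field_simps)
      also have "real n powr (c - 1) = real n powr ((c - 1) / 2) * real n powr ((c - 1) / 2)"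
        by (simp add: powr_add[symmetric])
      also have "real j powr (- c) = real j powr ((\<theta> - 1) / 2) * real j powr (\<theta> / 2)"
        by (simp add: powr_add[symmetric] \<theta>_def field_simps)
      finally show ?thesis by (simp add: u_def v_def)
    qed
    have "(\<Sum>j=1..<n. (n / j) powr c / n * a j)\<^sup>2 = (\<Sum>j=1..<n. u j * v j)\<^sup>2"
      using uv by (intro arg_cong[where f = "\<lambda>x. x\<^sup>2"] sum.cong) auto
    also have "\<dots> \<le> (\<Sum>j=1..<n. (u j)\<^sup>2) * (\<Sum>j=1..<n. (v j)\<^sup>2)"
      by (rule Cauchy_Schwarz_ineq_sum)
    also have "\<dots> \<le> (real n powr (c - 1) * (real n powr \<theta> / \<theta>)) * (\<Sum>j=1..<n. (v j)\<^sup>2)"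
    proof (intro mult_right_mono sum_nonneg)
      have "(\<Sum>j=1..<n. (u j)\<^sup>2) = real n powr (c - 1) * (\<Sum>j=1..<n. real j powr (\<theta> - 1))"
        unfolding u_def power_mult_distrib sq sum_distrib_left ..
      also have "(\<Sum>j=1..<n. real j powr (\<theta> - 1)) \<le> (\<Sum>j=1..n. real j powr (\<theta> - 1))"
        by (intro sum_mono2) auto
      also have "\<dots> \<le> real n powr \<theta> / \<theta>" by (rule sum_powr_le[OF \<theta>])
      finally show "(\<Sum>j=1..<n. (u j)\<^sup>2) \<le> real n powr (c - 1) * (real n powr \<theta> / \<theta>)"
        by (simp add: mult_left_mono)
    qed auto
    also have "(\<Sum>j=1..<n. (v j)\<^sup>2) = real n powr (c - 1) * (\<Sum>j=1..<n. real j powr \<theta> * (a j)\<^sup>2)"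
      unfolding v_def power_mult_distrib sq sum_distrib_left by (simp add: mult.assoc)
    also have "(real n powr (c - 1) * (real n powr \<theta> / \<theta>)) * \<dots>
        = real n powr (- \<theta> - 1) * (\<Sum>j=1..<n. real j powr \<theta> * (a j)\<^sup>2 / \<theta>)"
    proof -
      have "real n powr (c - 1) * real n powr \<theta> * real n powr (c - 1) = real n powr (- \<theta> - 1)"
        by (simp add: powr_add[symmetric] \<theta>_def)
      thus ?thesis by (simp add: sum_divide_distrib[symmetric])
    qed
    finally show ?thesis by (simp add: sum_distrib_left sum_divide_distrib)
  qed
  have "(\<Sum>n=1..N. (\<Sum>j=1..<n. (n / j) powr c / n * a j)\<^sup>2)
      \<le> (\<Sum>n=1..N. \<Sum>j=1..<n. real n powr (- \<theta> - 1) * (real j powr \<theta> * (a j)\<^sup>2 / \<theta>))"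
    by (intro sum_mono row)
  \<comment> \<open>Summing over n first leaves for each j a tail of n powr (- \<theta> - 1), whose
    size j powr (- \<theta>) / \<theta> cancels the factor j powr \<theta>.\<close>
  also have "\<dots> = (\<Sum>j=1..N. \<Sum>n=Suc j..N. real n powr (- \<theta> - 1) * (real j powr \<theta> * (a j)\<^sup>2 / \<theta>))"
    unfolding sum.Sigma[OF finite_atLeastAtMost ballI[OF finite_atLeastAtMost]]
      sum.Sigma[OF finite_atLeastAtMost ballI[OF finite_atLeastLessThan]]
    by (intro sum.reindex_bij_witness[of _ prod.swap prod.swap]) auto
  also have "\<dots> \<le> (\<Sum>j=1..N. (a j)\<^sup>2 / \<theta>\<^sup>2)"
  proof (intro sum_mono)
    fix j assume j: "j \<in> {1..N}"
    have "(\<Sum>n=Suc j..N. real n powr (- \<theta> - 1) * (real j powr \<theta> * (a j)\<^sup>2 / \<theta>))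
       = (\<Sum>n=Suc j..N. real n powr (- \<theta> - 1)) * (real j powr \<theta> * (a j)\<^sup>2 / \<theta>)"
      by (simp only: sum_distrib_right)
    also have "\<dots> \<le> (real j powr (- \<theta>) / \<theta>) * (real j powr \<theta> * (a j)\<^sup>2 / \<theta>)"
      using \<theta> j by (intro mult_right_mono sum_powr_tail_le) auto
    also have "\<dots> = (a j)\<^sup>2 / \<theta>\<^sup>2"
      using j by (simp add: powr_minus power2_eq_square field_simps)
    finally show "(\<Sum>n=Suc j..N. real n powr (- \<theta> - 1) * (real j powr \<theta> * (a j)\<^sup>2 / \<theta>)) \<le> (a j)\<^sup>2 / \<theta>\<^sup>2" .
  qed
  finally show ?thesis by (simp add: \<theta>_def sum_divide_distrib)
qed

text \<open>The first summand comes from the unweighted estimate, the second from the Hardy kernel;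
  the ceiling of |b| is the Bernoulli exponent, and the factors 2 come from squaring a sum of two
  terms. The parameter b will be \<beta> / 2.\<close>

definition weighted_regularity_const :: "real \<Rightarrow> real \<Rightarrow> real" where
  "weighted_regularity_const b C =
     2 * (7 * C)\<^sup>2 + 2 * (C * (nat \<lceil>\<bar>b\<bar>\<rceil>))\<^sup>2 / (1 / 2 - max b 0)\<^sup>2"

text \<open>Conjugation by the weight changes the kernel by \<open>((n / j) powr b - 1) k (n - 1 - j)\<close>, whose norm
  is dominated by a Hardy kernel.\<close>

lemma weighted_discrete_maximal_regularity:
  fixes k :: "nat \<Rightarrow> 'h \<Rightarrow> 'h::complex_hilbert"
  assumes add: "\<And>n x y. k n (x + y) = k n x + k n y"
    and scale: "\<And>n c x. k n (c *\<^sub>C x) = c *\<^sub>C k n x"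
    and k: "\<And>n x. norm (k n x) \<le> C / (real n + 1) * norm x"
    and dk: "\<And>n x. norm (k n x - k (Suc n) x) \<le> C / (real n + 1)\<^sup>2 * norm x"
    and sk: "\<And>n x. norm (\<Sum>i<n. k i x) \<le> C * norm x"
    and C: "0 \<le> C" and b: "b < 1 / 2" and x0: "x 0 = 0"
  shows "(\<Sum>n=1..m. (real n powr b * norm (\<Sum>j<n. k (n - 1 - j) (x j)))\<^sup>2)
    \<le> weighted_regularity_const b C * (\<Sum>j=1..m. (real j powr b * norm (x j))\<^sup>2)"
proof -
  define N where "N = nat \<lceil>\<bar>b\<bar>\<rceil>"
  have N: "\<bar>b\<bar> \<le> real N" by (simp add: N_def real_nat_ceiling_ge)
  define c where "c = max b 0"
  have c: "0 \<le> c" "c < 1 / 2" using b by (auto simp: c_def)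
  have scaleR: "k n (r *\<^sub>R y) = r *\<^sub>R k n y" for n r y
    using scale[of n "complex_of_real r" y] by (simp add: scaleC_of_real)
  have k0: "k n 0 = 0" for n using scaleR[of n 0 0] by simp
  define a where "a j = real j powr b * norm (x j)" for j
  define z where "z j = real j powr b *\<^sub>R x j" for j
  have nz: "norm (z j) = a j" for j by (simp add: z_def a_def)
  let ?main = "\<lambda>n. \<Sum>j\<le>n. k (n - j) (z j)"
  let ?err = "\<lambda>n. \<Sum>j=1..<n. (n / j) powr c / n * a j"
  have row: "(real n powr b * norm (\<Sum>j<n. k (n - 1 - j) (x j)))\<^sup>2
      \<le> 2 * (norm (?main (n - 1)))\<^sup>2 + 2 * (C * N)\<^sup>2 * (?err n)\<^sup>2" if n: "n \<in> {1..m}" for n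
  proof -
    have lt: "{..<n} = {..n - 1}" using n by auto
    \<comment> \<open>Writing n powr b as j powr b plus a difference splits off the unweighted
      convolution of the weighted sequence z.\<close>
    have "real n powr b *\<^sub>R (\<Sum>j<n. k (n - 1 - j) (x j))
       = (\<Sum>j<n. k (n - 1 - j) (z j)) + (\<Sum>j<n. (real n powr b - real j powr b) *\<^sub>R k (n - 1 - j) (x j))"
      by (simp add: scaleR_sum_right sum.distrib[symmetric] z_def scaleR scaleR_diff_left)
    \<comment> \<open>The term j = 0 vanishes with x 0 and has to be removed, because the Hardy
      kernel contains (n / j) powr c.\<close>
    also have "(\<Sum>j<n. (real n powr b - real j powr b) *\<^sub>R k (n - 1 - j) (x j))
        = (\<Sum>j=1..<n. (real n powr b - real j powr b) *\<^sub>R k (n - 1 - j) (x j))"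
      by (intro sum.mono_neutral_right) (auto simp: x0 k0 Suc_le_eq)
    finally have "norm (real n powr b *\<^sub>R (\<Sum>j<n. k (n - 1 - j) (x j)))
       = norm (?main (n - 1) + (\<Sum>j=1..<n. (real n powr b - real j powr b) *\<^sub>R k (n - 1 - j) (x j)))"
      unfolding lt by (rule arg_cong)
    hence "real n powr b * norm (\<Sum>j<n. k (n - 1 - j) (x j))
       = norm (?main (n - 1) + (\<Sum>j=1..<n. (real n powr b - real j powr b) *\<^sub>R k (n - 1 - j) (x j)))"
      by simp
    also have "\<dots> \<le> norm (?main (n - 1)) + (\<Sum>j=1..<n. (C * N) * ((n / j) powr c / n * a j))"
    proof (intro order.trans[OF norm_triangle_ineq] add_left_mono sum_norm_le)
      fix j assume j: "j \<in> {1..<n}"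
      have pos: "real j > 0" "real n > 0" "real n > real j" using j by auto
      have "\<bar>real n powr b - real j powr b\<bar> = real j powr b * \<bar>(j / n) powr (- b) - 1\<bar>"
      proof -
        have "real n powr b - real j powr b = real j powr b * ((j / n) powr (- b) - 1)"
          using pos by (simp add: powr_divide powr_minus field_simps)
        thus ?thesis by (simp add: abs_mult)
      qed
      also have "\<dots> \<le> real j powr b * (N * (1 - j / n) * (j / n) powr (- c))"
        unfolding c_def using pos N by (intro mult_left_mono abs_powr_minus_one_le) auto
      finally have 1: "\<bar>real n powr b - real j powr b\<bar> \<le> real j powr b * (N * (1 - j / n) * (j / n) powr (- c))" .
      \<comment> \<open>The index n - 1 - j turns the kernel bound into C / (n - j), exactly the
        factor that 1 - j / n = (n - j) / n cancels.\<close>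
      have 2: "norm (k (n - 1 - j) (x j)) \<le> C / (real n - real j) * norm (x j)"
        using k[of "n - 1 - j" "x j"] j by (simp add: of_nat_diff)
      have "norm ((real n powr b - real j powr b) *\<^sub>R k (n - 1 - j) (x j))
          \<le> (real j powr b * (N * (1 - j / n) * (j / n) powr (- c))) * (C / (real n - real j) * norm (x j))"
        unfolding norm_scaleR using 1 2 by (intro mult_mono) auto
      also have "(j / n) powr (- c) = (n / j) powr c"
        using pos by (simp add: powr_divide powr_minus field_simps)
      also have "1 - j / n = (real n - real j) / n" using pos by (simp add: field_simps)
      also have "(real j powr b * (N * ((real n - real j) / n) * (n / j) powr c)) * (C / (real n - real j) * norm (x j))
         = (C * N) * ((n / j) powr c / n * a j)"
        using pos by (simp add: a_def)
      finally show "norm ((real n powr b - real j powr b) *\<^sub>R k (n - 1 - j) (x j))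
          \<le> (C * N) * ((n / j) powr c / n * a j)" .
    qed
    also have "\<dots> = norm (?main (n - 1)) + (C * N) * ?err n" by (simp add: sum_distrib_left)
    finally have "(real n powr b * norm (\<Sum>j<n. k (n - 1 - j) (x j)))\<^sup>2
        \<le> (norm (?main (n - 1)) + (C * N) * ?err n)\<^sup>2" by (intro power_mono) auto
    also have "\<dots> \<le> 2 * (norm (?main (n - 1)))\<^sup>2 + 2 * ((C * N) * ?err n)\<^sup>2"
      using sum_squares_bound[of "norm (?main (n - 1))" "(C * N) * ?err n"] by (simp add: power2_sum)
    finally show ?thesis by (simp add: power_mult_distrib mult.assoc)
  qed
  have "(\<Sum>n=1..m. (real n powr b * norm (\<Sum>j<n. k (n - 1 - j) (x j)))\<^sup>2)
     \<le> (\<Sum>n=1..m. 2 * (norm (?main (n - 1)))\<^sup>2 + 2 * (C * N)\<^sup>2 * (?err n)\<^sup>2)"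
    by (intro sum_mono row)
  also have "\<dots> = 2 * (\<Sum>n<m. (norm (?main n))\<^sup>2) + 2 * (C * N)\<^sup>2 * (\<Sum>n=1..m. (?err n)\<^sup>2)"
  proof -
    have "(\<Sum>n=1..m. (norm (?main (n - 1)))\<^sup>2) = (\<Sum>n<m. (norm (?main n))\<^sup>2)"
      by (intro sum.reindex_bij_witness[of _ Suc "\<lambda>n. n - 1"]) auto
    thus ?thesis by (simp only: sum.distrib sum_distrib_left[symmetric])
  qed
  also have "\<dots> \<le> 2 * ((7 * C)\<^sup>2 * (\<Sum>j=1..m. (a j)\<^sup>2))
      + 2 * (C * N)\<^sup>2 * ((\<Sum>j=1..m. (a j)\<^sup>2) / (1 / 2 - c)\<^sup>2)"
  proof (intro add_mono mult_left_mono discrete_Hardy_inequality[OF c])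
    have "(\<Sum>j<m. (norm (z j))\<^sup>2) = (\<Sum>j=1..<m. (a j)\<^sup>2)"
      unfolding nz by (intro sum.mono_neutral_right) (auto simp: a_def x0 Suc_le_eq)
    also have "\<dots> \<le> (\<Sum>j=1..m. (a j)\<^sup>2)" by (intro sum_mono2) auto
    finally have "(7 * C)\<^sup>2 * (\<Sum>j<m. (norm (z j))\<^sup>2) \<le> (7 * C)\<^sup>2 * (\<Sum>j=1..m. (a j)\<^sup>2)"
      by (intro mult_left_mono) auto
    thus "(\<Sum>n<m. (norm (?main n))\<^sup>2) \<le> (7 * C)\<^sup>2 * (\<Sum>j=1..m. (a j)\<^sup>2)"
      using discrete_maximal_regularity[OF add scale k dk sk, where m = m and x = z] by linarith
  qed auto
  also have "2 * ((7 * C)\<^sup>2 * (\<Sum>j=1..m. (a j)\<^sup>2)) + 2 * (C * N)\<^sup>2 * ((\<Sum>j=1..m. (a j)\<^sup>2) / (1 / 2 - c)\<^sup>2)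
      = weighted_regularity_const b C * (\<Sum>j=1..m. (a j)\<^sup>2)"
    by (simp add: weighted_regularity_const_def N_def c_def algebra_simps)
  finally show ?thesis by (simp add: a_def)
qed

section \<open>Analytic semigroups on the half-line\<close>

lemma bounded_linear_scaleC: "bounded_linear (\<lambda>x::'h::complex_hilbert. c *\<^sub>C x)"
proof (rule bounded_linear_intro)
  fix r and x :: 'h
  show "c *\<^sub>C r *\<^sub>R x = r *\<^sub>R c *\<^sub>C x"
    by (metis mult.commute scaleC_of_real scaleC_scaleC)
  show "norm (c *\<^sub>C x) \<le> norm x * cmod c" by (simp add: norm_scaleC)
qed (rule scaleC_add_right)

text \<open>Since |arctan x| is at most |x|, the slope c of a cone also bounds its angle.\<close>

lemma mem_sectorI:
  assumes "Re z > 0" "\<bar>Im z\<bar> \<le> c * Re z" "c < \<delta>"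
  shows "z \<in> sector \<delta>"
proof -
  have "\<bar>Arg z\<bar> = \<bar>arctan (Im z / Re z)\<bar>" using assms by (simp add: arg_conv_arctan)
  also have "\<dots> \<le> \<bar>Im z / Re z\<bar>" by (rule abs_arctan_le)
  also have "\<dots> \<le> c" using assms by (simp add: divide_le_eq)
  finally show ?thesis using assms by (auto simp: sector_def)
qed

text \<open>\<open>T t\<close> is the operator written \<open>exp (- t A)\<close>; analyticity only enters through the bound \<open>step\<close>.\<close>

locale regular_semigroup =
  fixes T :: "real \<Rightarrow> 'h \<Rightarrow> 'h::complex_hilbert" and D :: "'h set" and A :: "'h \<Rightarrow> 'h" and K C :: real
  assumes zero [simp]: "T 0 x = x"
    and add_time: "0 \<le> s \<Longrightarrow> 0 \<le> t \<Longrightarrow> T (s + t) x = T s (T t x)"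
    and add: "0 \<le> t \<Longrightarrow> T t (x + y) = T t x + T t y"
    and scale: "0 \<le> t \<Longrightarrow> T t (c *\<^sub>C x) = c *\<^sub>C T t x"
    and bound: "0 \<le> t \<Longrightarrow> norm (T t x) \<le> K * norm x"
    and K_ge_1: "1 \<le> K"
    and step: "0 < t \<Longrightarrow> 0 \<le> h \<Longrightarrow> norm (T t x - T (t + h) x) \<le> C * h / t * norm x"
    and C_nonneg: "0 \<le> C"
    and tendsto_zero: "((\<lambda>t. T t x) \<longlongrightarrow> x) (at_right 0)"
    and generator: "x \<in> D \<Longrightarrow> ((\<lambda>t. inverse t *\<^sub>R (T t x - x)) \<longlongrightarrow> - A x) (at_right 0)"
    and domain: "x \<in> D \<Longrightarrow> 0 \<le> t \<Longrightarrow> T t x \<in> D \<and> A (T t x) = T t (A x)"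

text \<open>The semigroup is bounded on a disc about s of radius proportional to s, so Cauchy's
  estimate bounds its derivative by a multiple of 1 / s, hence of 1 / t, along the segment from t to
  t + h; the mean value inequality adds the factor h.\<close>

lemma holomorphic_orbit_step:
  fixes S :: "complex \<Rightarrow> 'h \<Rightarrow> 'h::complex_hilbert"
  assumes lin: "\<And>z. z \<in> sector \<delta> \<Longrightarrow> bounded_clinear (S z)"
    and hol: "operator_holomorphic_on S (sector \<delta>)"
    and K: "\<And>z x. z \<in> sector (\<delta> / 2) \<Longrightarrow> norm (S z x) \<le> K * norm x" and "0 \<le> K"
    and \<delta>: "0 < \<delta>" and t: "0 < t" and h: "0 \<le> h"
  shows "norm (S (complex_of_real t) x - S (complex_of_real (t + h)) x)
           \<le> K * (1 + 4 / \<delta>) * h / t * norm x"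
proof -
  \<comment> \<open>c < \<delta> / 2 is the slope of a cone inside the sector of half-angle \<delta>
    / 2, and \<rho> solves \<rho> = c (1 - \<rho>), which places the disc of radius \<rho> s about s
    inside that cone. The final constant is 1 / \<rho> = 1 + 4 / \<delta>.\<close>
  define c where "c = \<delta> / 4"
  define \<rho> where "\<rho> = c / (1 + c)"
  have c: "c > 0" using \<delta> by (simp add: c_def)
  have \<rho>: "\<rho> > 0" "\<rho> < 1" "\<rho> = c * (1 - \<rho>)" using c by (auto simp: \<rho>_def field_simps)
  have sub: "cball (complex_of_real s) (\<rho> * s) \<subseteq> sector (\<delta> / 2)" if "s > 0" for s
  proof
    fix z assume "z \<in> cball (complex_of_real s) (\<rho> * s)"
    hence d: "cmod (z - s) \<le> \<rho> * s" by (simp add: dist_norm norm_minus_commute)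
    have re: "Re z \<ge> s - \<rho> * s" using abs_Re_le_cmod[of "z - s"] d by simp
    have im: "\<bar>Im z\<bar> \<le> \<rho> * s" using abs_Im_le_cmod[of "z - s"] d by simp
    have "\<rho> * s = c * (s - \<rho> * s)" using \<rho>(3) by (metis left_diff_distrib mult.assoc mult_1)
    also have "\<dots> \<le> c * Re z" using re c by (intro mult_left_mono) auto
    finally show "z \<in> sector (\<delta> / 2)"
    proof (intro mem_sectorI[of _ c])
      have "\<rho> * s < 1 * s" using \<rho> that by (intro mult_strict_right_mono)
      thus "Re z > 0" using re by simp
    qed (use im \<delta> in \<open>auto simp: c_def\<close>)
  qed
  have sec: "sector (\<delta> / 2) \<subseteq> sector \<delta>" using \<delta> by (auto simp: sector_def)
  \<comment> \<open>Pairing with the very difference to be estimated makes the increment of the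
    scalar function f equal to \<open>cinner v v\<close>.\<close>
  define v where "v = S (complex_of_real t) x - S (complex_of_real (t + h)) x"
  define f where "f z = cinner v (S z x)" for z
  have df: "\<exists>f'. (f has_field_derivative f') (at z within sector \<delta>)" if z: "z \<in> sector \<delta>" for z
  proof -
    obtain L where L: "bounded_clinear L"
      "((\<lambda>w. onorm (\<lambda>x. inverse (w - z) *\<^sub>C (S w x - S z x) - L x)) \<longlongrightarrow> 0) (at z within sector \<delta>)"
      using hol z by (auto simp: operator_holomorphic_on_def)
    have "((\<lambda>w. (f w - f z) / (w - z) - cinner v (L x)) \<longlongrightarrow> 0) (at z within sector \<delta>)"
    proof (rule Lim_null_comparison)
      show "((\<lambda>w. norm v * (onorm (\<lambda>x. inverse (w - z) *\<^sub>C (S w x - S z x) - L x) * norm x)) \<longlongrightarrow> 0)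
          (at z within sector \<delta>)"
        using L(2) by (intro tendsto_eq_intros) auto
      show "\<forall>\<^sub>F w in at z within sector \<delta>. cmod ((f w - f z) / (w - z) - cinner v (L x))
          \<le> norm v * (onorm (\<lambda>x. inverse (w - z) *\<^sub>C (S w x - S z x) - L x) * norm x)"
        unfolding eventually_at_filter
      proof (intro always_eventually allI impI)
        fix w assume w: "w \<in> sector \<delta>"
        have "bounded_linear (\<lambda>x. inverse (w - z) *\<^sub>C (S w x - S z x) - L x)"
          using lin[OF w] lin[OF z] L(1) unfolding bounded_clinear_def
          by (intro bounded_linear_sub bounded_linear_compose[OF bounded_linear_scaleC]) auto
        note on = onorm[OF this, of x]
        have "(f w - f z) / (w - z) - cinner v (L x)
            = cinner v (inverse (w - z) *\<^sub>C (S w x - S z x) - L x)"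
          by (simp add: f_def cinner_diff_right cinner_scaleC_right divide_inverse mult.commute)
        also have "cmod \<dots> \<le> norm v * norm (inverse (w - z) *\<^sub>C (S w x - S z x) - L x)"
          by (rule cinner_Cauchy_Schwarz)
        also have "\<dots> \<le> norm v * (onorm (\<lambda>x. inverse (w - z) *\<^sub>C (S w x - S z x) - L x) * norm x)"
          by (intro mult_left_mono on) auto
        finally show "cmod ((f w - f z) / (w - z) - cinner v (L x))
          \<le> norm v * (onorm (\<lambda>x. inverse (w - z) *\<^sub>C (S w x - S z x) - L x) * norm x)" .
      qed
    qed
    thus ?thesis by (auto simp: has_field_derivative_iff LIM_zero_iff)
  qed
  have hol_cball: "f holomorphic_on cball (complex_of_real s) (\<rho> * s)" if "s > 0" for s
    unfolding holomorphic_on_def field_differentiable_def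
    using df sub[OF that] sec by (meson has_field_derivative_subset subsetD subset_trans)
  have bd: "cmod (deriv f (complex_of_real s)) \<le> K * norm x * norm v / (\<rho> * t)" if "s \<ge> t" for s
  proof -
    have s: "s > 0" using that t by simp
    have "cmod ((deriv ^^ 1) f (complex_of_real s)) \<le> fact 1 * (K * norm x * norm v) / (\<rho> * s) ^ 1"
    proof (rule Cauchy_inequality)
      show "f holomorphic_on ball (complex_of_real s) (\<rho> * s)"
        using hol_cball[OF s] ball_subset_cball by (rule holomorphic_on_subset)
      show "continuous_on (cball (complex_of_real s) (\<rho> * s)) f"
        using hol_cball[OF s] by (rule holomorphic_on_imp_continuous_on)
      show "0 < \<rho> * s" using s \<rho> by simp
      fix z assume "cmod (complex_of_real s - z) = \<rho> * s"
      hence z: "z \<in> sector (\<delta> / 2)" using sub[OF s] by (auto simp: dist_norm)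
      have "cmod (f z) \<le> norm v * norm (S z x)" unfolding f_def by (rule cinner_Cauchy_Schwarz)
      also have "\<dots> \<le> norm v * (K * norm x)" by (intro mult_left_mono K z) auto
      finally show "cmod (f z) \<le> K * norm x * norm v" by (simp add: mult_ac)
    qed
    also have "\<dots> \<le> K * norm x * norm v / (\<rho> * t)"
      using that t \<rho> \<open>0 \<le> K\<close> by (simp add: divide_left_mono mult_left_mono)
    finally show ?thesis by simp
  qed
  have "cmod (f (complex_of_real t) - f (complex_of_real (t + h)))
      \<le> K * norm x * norm v / (\<rho> * t) * cmod (complex_of_real t - complex_of_real (t + h))"
  proof (rule field_differentiable_bound)
    let ?I = "closed_segment (complex_of_real t) (complex_of_real (t + h))"
    show "convex ?I" "complex_of_real t \<in> ?I" "complex_of_real (t + h) \<in> ?I" by auto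
    fix z assume "z \<in> ?I"
    then obtain s where s: "z = complex_of_real s" "s \<ge> t"
      using h unfolding closed_segment_of_real closed_segment_eq_real_ivl by auto
    show "cmod (deriv f z) \<le> K * norm x * norm v / (\<rho> * t)" using bd s by simp
    have "f holomorphic_on ball (complex_of_real s) (\<rho> * s)"
      using hol_cball[of s] s t ball_subset_cball by (auto intro: holomorphic_on_subset)
    hence "(f has_field_derivative deriv f z) (at z)"
      using s t \<rho> by (intro holomorphic_derivI[where S = "ball (complex_of_real s) (\<rho> * s)"]) auto
    thus "(f has_field_derivative deriv f z) (at z within ?I)" by (rule has_field_derivative_at_within)
  qed
  also have "f (complex_of_real t) - f (complex_of_real (t + h)) = cinner v v"
    by (simp add: f_def v_def cinner_diff_right)
  also have "complex_of_real t - complex_of_real (t + h) = complex_of_real (- h)" by simp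
  also have "K * norm x * norm v / (\<rho> * t) * cmod (complex_of_real (- h))
      = (K * (1 / \<rho>) * h / t * norm x) * norm v"
    using h by (simp add: mult_ac)
  also have "1 / \<rho> = 1 + 4 / \<delta>" using c \<delta> by (simp add: \<rho>_def c_def field_simps)
  finally have "norm v \<le> K * (1 + 4 / \<delta>) * h / t * norm x"
    by (rule norm_le_if_cinner_le) (use \<open>0 \<le> K\<close> \<delta> t h in auto)
  thus ?thesis by (simp add: v_def)
qed

lemma regular_semigroup_exists:
  assumes "neg_generates_bounded_analytic_semigroup D A \<delta> S"
  shows "\<exists>K C. regular_semigroup (\<lambda>t. S (complex_of_real t)) D A K C"
proof -
  have \<delta>: "0 < \<delta>" and an: "bounded_analytic_semigroup \<delta> S" and gen: "is_generator S D (\<lambda>x. - A x)"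
    using assms by (auto simp: neg_generates_bounded_analytic_semigroup_def)
  have lin: "bounded_clinear (S z)" if "z \<in> sector \<delta>" for z
    using an that by (auto simp: bounded_analytic_semigroup_def)
  have S0: "S 0 x = x" for x using an by (auto simp: bounded_analytic_semigroup_def)
  have hol: "operator_holomorphic_on S (sector \<delta>)"
    using an by (auto simp: bounded_analytic_semigroup_def)
  \<comment> \<open>Boundedness and continuity at 0 hold on strictly smaller sectors; half the angle
    is such a choice.\<close>
  obtain K0 where K0: "\<And>z. z \<in> sector (\<delta> / 2) \<Longrightarrow> onorm (S z) \<le> K0"
    using an \<delta> unfolding bounded_analytic_semigroup_def by (metis half_gt_zero field_sum_of_halves less_add_same_cancel1)
  have cont0: "((\<lambda>z. S z x) \<longlongrightarrow> x) (at 0 within sector (\<delta> / 2))" for x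
    using an \<delta> unfolding bounded_analytic_semigroup_def by (metis half_gt_zero field_sum_of_halves less_add_same_cancel1)
  \<comment> \<open>The maximum with 1 makes the bound hold at time 0 as well, where the operator is
    the identity.\<close>
  define K where "K = max K0 1"
  have sec: "sector (\<delta> / 2) \<subseteq> sector \<delta>" using \<delta> by (auto simp: sector_def)
  have K: "norm (S z x) \<le> K * norm x" if "z \<in> sector (\<delta> / 2)" for z x
  proof -
    have "norm (S z x) \<le> onorm (S z) * norm x"
      using lin[of z] sec that by (intro onorm) (auto simp: bounded_clinear_def)
    also have "\<dots> \<le> K * norm x"
      using K0[OF that] by (intro mult_right_mono) (auto simp: K_def)
    finally show ?thesis .
  qed
  have real_sec: "complex_of_real t \<in> sector (\<delta> / 2)" "complex_of_real t \<in> sector \<delta>" if "0 < t" for t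
    using that \<delta> by (auto simp: sector_def)
  have lin0: "bounded_clinear (S (complex_of_real t))" if "0 \<le> t" for t
  proof (cases "t = 0")
    case True
    have "S 0 = (\<lambda>x. x)" by (intro ext S0)
    thus ?thesis using True by (simp add: bounded_clinear_def bounded_linear_ident)
  qed (use lin real_sec that in auto)
  have gen1: "((\<lambda>t. inverse t *\<^sub>R (S (complex_of_real t) x - x)) \<longlongrightarrow> - A x) (at_right 0)" if "x \<in> D" for x
    using gen that by (auto simp: is_generator_def)
  have genI: "x \<in> D" if "((\<lambda>t. inverse t *\<^sub>R (S (complex_of_real t) x - x)) \<longlongrightarrow> y) (at_right 0)" for x y
    using gen that by (auto simp: is_generator_def)
  have sg: "S (complex_of_real (s + t)) x = S (complex_of_real s) (S (complex_of_real t) x)"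
    if "0 \<le> s" "0 \<le> t" for s t x
  proof (cases "s = 0 \<or> t = 0")
    case False
    thus ?thesis using an that real_sec unfolding bounded_analytic_semigroup_def by auto
  qed (auto simp: S0)
  have "regular_semigroup (\<lambda>t. S (complex_of_real t)) D A K (K * (1 + 4 / \<delta>))"
  proof
    show "S (complex_of_real 0) x = x" for x by (simp add: S0)
    show "S (complex_of_real (s + t)) x = S (complex_of_real s) (S (complex_of_real t) x)"
      if "0 \<le> s" "0 \<le> t" for s t x by (rule sg[OF that])
    show "S (complex_of_real t) (x + y) = S (complex_of_real t) x + S (complex_of_real t) y"
      if "0 \<le> t" for t x y
      using lin0[OF that] by (auto simp: bounded_clinear_def linear_simps)
    show "S (complex_of_real t) (c *\<^sub>C x) = c *\<^sub>C S (complex_of_real t) x" if "0 \<le> t" for t c x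
      using lin0[OF that] by (auto simp: bounded_clinear_def)
    show K1: "1 \<le> K" by (simp add: K_def)
    show "norm (S (complex_of_real t) x) \<le> K * norm x" if "0 \<le> t" for t x
    proof (cases "t = 0")
      case True
      thus ?thesis using mult_right_mono[OF K1, of "norm x"] by (simp add: S0)
    qed (use K real_sec that in auto)
    show "norm (S (complex_of_real t) x - S (complex_of_real (t + h)) x) \<le> K * (1 + 4 / \<delta>) * h / t * norm x"
      if "0 < t" "0 \<le> h" for t h x
      using that K1 by (intro holomorphic_orbit_step lin hol K \<delta>) auto
    show "0 \<le> K * (1 + 4 / \<delta>)" using K1 \<delta> by auto
    show "((\<lambda>t. S (complex_of_real t) x) \<longlongrightarrow> x) (at_right 0)" for x
    proof (rule filterlim_compose[OF cont0])
      show "filterlim complex_of_real (at 0 within sector (\<delta> / 2)) (at_right 0)"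
        unfolding filterlim_at
        using real_sec by (auto intro!: tendsto_eq_intros eventually_at_right_less[THEN eventually_mono])
    qed
    show "((\<lambda>t. inverse t *\<^sub>R (S (complex_of_real t) x - x)) \<longlongrightarrow> - A x) (at_right 0)" if "x \<in> D" for x
      by (rule gen1[OF that])
    show "S (complex_of_real t) x \<in> D \<and> A (S (complex_of_real t) x) = S (complex_of_real t) (A x)"
      if "x \<in> D" "0 \<le> t" for x t
    proof -
      have bl: "bounded_linear (S (complex_of_real t))"
        using lin0[OF that(2)] by (auto simp: bounded_clinear_def)
      \<comment> \<open>Applying S t to the difference quotient of x and commuting it with S s gives
        the quotient of S t x; its convergence yields membership in D, and uniqueness of limits the
        value of A.\<close>
      have "((\<lambda>s. S (complex_of_real t) (inverse s *\<^sub>R (S (complex_of_real s) x - x)))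
          \<longlongrightarrow> S (complex_of_real t) (- A x)) (at_right 0)"
        by (rule bounded_linear.tendsto[OF bl gen1[OF that(1)]])
      also have "?this \<longleftrightarrow> ((\<lambda>s. inverse s *\<^sub>R (S (complex_of_real s) (S (complex_of_real t) x) - S (complex_of_real t) x))
          \<longlongrightarrow> S (complex_of_real t) (- A x)) (at_right 0)"
      proof (intro filterlim_cong refl eventually_mono[OF eventually_at_right_less])
        fix s :: real assume "0 < s"
        hence "S (complex_of_real t) (S (complex_of_real s) x) = S (complex_of_real s) (S (complex_of_real t) x)"
          using sg[of s t x] sg[of t s x] that by (simp add: add.commute)
        thus "S (complex_of_real t) (inverse s *\<^sub>R (S (complex_of_real s) x - x))
          = inverse s *\<^sub>R (S (complex_of_real s) (S (complex_of_real t) x) - S (complex_of_real t) x)"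
          using bl by (simp add: linear_simps)
      qed
      finally have lim: "((\<lambda>s. inverse s *\<^sub>R (S (complex_of_real s) (S (complex_of_real t) x) - S (complex_of_real t) x))
          \<longlongrightarrow> S (complex_of_real t) (- A x)) (at_right 0)" .
      have mem: "S (complex_of_real t) x \<in> D" by (rule genI[OF lim])
      have "S (complex_of_real t) (- A x) = - A (S (complex_of_real t) x)"
        by (rule tendsto_unique[OF _ lim gen1[OF mem]]) simp
      thus ?thesis using mem bl by (simp add: linear_simps)
    qed
  qed
  thus ?thesis by blast
qed

section \<open>Bounds for the sampled kernel, uniform in the mesh\<close>

context regular_semigroup
begin

lemma zero_right [simp]: "0 \<le> t \<Longrightarrow> T t 0 = 0"
  using scale[of t 0 0] by simp

lemma minus: "0 \<le> t \<Longrightarrow> T t (- x) = - T t x"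
  using scale[of t "-1" x] by (simp add: scaleC_minus_one)

lemma diff: "0 \<le> t \<Longrightarrow> T t (x - y) = T t x - T t y"
  using add[of t x "- y"] by (simp add: minus)

lemma scaleR: "0 \<le> t \<Longrightarrow> T t (r *\<^sub>R x) = r *\<^sub>R T t x"
  using scale[of t "complex_of_real r" x] by (simp add: scaleC_of_real)

text \<open>4 * K covers n = 0 and the partial sums. 2 * C and \<open>16 * C\<^sup>2\<close> cover n
  \<ge> 1, where 1 / n is replaced by 2 / (n + 1); the remaining factor 4 in 16 comes from halving
  the time in the second difference.\<close>

definition regularity_const :: real where
  "regularity_const = 4 * K + 2 * C + 16 * C\<^sup>2"

lemma regularity_const_nonneg: "0 \<le> regularity_const"
  using K_ge_1 C_nonneg by (simp add: regularity_const_def)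

text \<open>The mesh cancels in C h / (n h), so the constants do not depend on it. At n = 0 the
  estimate \<open>step\<close> says nothing, and boundedness of the semigroup is used
  instead.\<close>

lemma discrete_kernel_bounds:
  assumes h: "0 < h"
  defines "k \<equiv> \<lambda>n x. T (real n * h) x - T (real (Suc n) * h) x"
  shows "norm (k n x) \<le> regularity_const / (real n + 1) * norm x" (is ?A)
    and "norm (k n x - k (Suc n) x) \<le> regularity_const / (real n + 1)\<^sup>2 * norm x" (is ?B)
    and "norm (\<Sum>i<n. k i x) \<le> regularity_const * norm x" (is ?C)
proof -
  have K2: "norm (T s x - T t x) \<le> 2 * K * norm x" if "0 \<le> s" "0 \<le> t" for s t x
    using norm_triangle_ineq4[of "T s x" "T t x"] bound[OF that(1), of x] bound[OF that(2), of x] by simp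
  have K0: "0 \<le> K" and C2: "0 \<le> C\<^sup>2" using K_ge_1 by auto
  have Kc: "2 * K \<le> regularity_const" "4 * K \<le> regularity_const" "2 * C \<le> regularity_const" "16 * C\<^sup>2 \<le> regularity_const"
    using K0 C2 C_nonneg by (auto simp: regularity_const_def)
  have k0: "norm (k m x) \<le> 2 * K * norm x" for m x
    unfolding k_def using h by (intro K2) auto
  show ?A
  proof (cases "n = 0")
    case True
    thus ?thesis using k0[of n x] mult_right_mono[OF Kc(1), of "norm x"] by simp
  next
    case False
    have "norm (k n x) \<le> C * h / (real n * h) * norm x"
      using step[of "real n * h" h x] h False by (simp add: k_def algebra_simps)
    also have "\<dots> = (C / real n) * norm x" using h by simp
    also have "C / real n \<le> regularity_const / (real n + 1)"
    proof -
      have "C * (real n + 1) \<le> C * (2 * real n)" using C_nonneg False by (intro mult_left_mono) auto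
      also have "\<dots> \<le> regularity_const * real n" using mult_right_mono[OF Kc(3), of "real n"] by (simp add: mult_ac)
      finally show ?thesis using False by (simp add: field_simps)
    qed
    finally show ?thesis by (simp add: mult_right_mono)
  qed
  show ?B
  proof (cases "n = 0")
    case True
    have "norm (k n x - k (Suc n) x) \<le> 4 * K * norm x"
      using norm_triangle_ineq4[of "k n x" "k (Suc n) x"] k0[of n x] k0[of "Suc n" x] by simp
    thus ?thesis using True mult_right_mono[OF Kc(2), of "norm x"] by simp
  next
    case False
    \<comment> \<open>The three times n h, (n + 1) h, (n + 2) h are s + s, s + (s + h), (s + h) + (s
      + h), so the second difference of the semigroup is the square of the operator T s - T (s + h),
      and \<open>step\<close> applies twice.\<close>
    define s where "s = real n * h / 2"
    have s: "s > 0" using False h by (simp add: s_def)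
    have half: "norm (T s y - T (s + h) y) \<le> (2 * C / real n) * norm y" for y
      using step[of s h y] s h False by (simp add: s_def field_simps)
    have e: "real n * h = s + s" "real (Suc n) * h = s + (s + h)" "real (Suc (Suc n)) * h = (s + h) + (s + h)"
      by (auto simp: s_def algebra_simps)
    have e': "T (s + s) x = T s (T s x)" "T (s + (s + h)) x = T s (T (s + h) x)"
      "T ((s + h) + (s + h)) x = T (s + h) (T (s + h) x)" "T s (T (s + h) x) = T (s + h) (T s x)"
      using s h by (simp_all only: add_time[symmetric] add.commute add.left_commute)
    have "k n x - k (Suc n) x = T s (T s x - T (s + h) x) - T (s + h) (T s x - T (s + h) x)"
      using s h e'(4) unfolding k_def e e'(1-3) by (simp add: diff)
    also have "norm \<dots> \<le> (2 * C / real n) * norm (T s x - T (s + h) x)" by (rule half)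
    also have "\<dots> \<le> (2 * C / real n) * ((2 * C / real n) * norm x)"
      using C_nonneg by (intro mult_left_mono half) auto
    also have "\<dots> = (4 * C\<^sup>2 / (real n)\<^sup>2) * norm x" by (simp add: power2_eq_square)
    also have "4 * C\<^sup>2 / (real n)\<^sup>2 = 16 * C\<^sup>2 / (2 * real n)\<^sup>2" by (simp add: power_mult_distrib)
    also have "\<dots> \<le> 16 * C\<^sup>2 / (real n + 1)\<^sup>2"
      using False by (intro divide_left_mono power_mono) auto
    also have "\<dots> \<le> regularity_const / (real n + 1)\<^sup>2" using Kc(4) by (intro divide_right_mono) auto
    finally show ?thesis by (simp add: mult_right_mono)
  qed
  have "(\<Sum>i<n. k i x) = x - T (real n * h) x"
    unfolding k_def by (induction n) auto
  thus ?C using K2[of 0 "real n * h" x] h mult_right_mono[OF Kc(1), of "norm x"] by simp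
qed

end

section \<open>Square integrable functions\<close>

text \<open>Valued in \<open>ennreal\<close>, so that estimates can be chained before finiteness is
  known.\<close>

definition sq_norm :: "'a measure \<Rightarrow> ('a \<Rightarrow> 'b::real_normed_vector) \<Rightarrow> ennreal" where
  "sq_norm M f = (\<integral>\<^sup>+x. ennreal ((norm (f x))\<^sup>2) \<partial>M)"

lemma L2_fun_iff: "f \<in> L2_fun M \<longleftrightarrow> strongly_measurable M f \<and> sq_norm M f < \<infinity>"
  by (simp add: L2_fun_def sq_norm_def)

lemma sq_norm_zero [simp]: "sq_norm M (\<lambda>x. 0) = 0"
  by (simp add: sq_norm_def)

lemma sq_norm_cong_AE: "AE x in M. f x = g x \<Longrightarrow> sq_norm M f = sq_norm M g"
  unfolding sq_norm_def by (rule nn_integral_cong_AE) auto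

lemma sq_norm_minus_commute: "sq_norm M (\<lambda>x. f x - g x) = sq_norm M (\<lambda>x. g x - f x)"
  unfolding sq_norm_def by (simp add: norm_minus_commute)

lemma two_ennreal_add:
  "0 \<le> a \<Longrightarrow> 0 \<le> b \<Longrightarrow> 2 * ennreal a + 2 * ennreal b = ennreal (2 * a + 2 * b)"
  by (simp add: ennreal_plus ennreal_mult)

section \<open>Strong measurability and convergence almost everywhere\<close>

lemma strongly_measurable_simple: "simple_function M s \<Longrightarrow> strongly_measurable M s"
  unfolding strongly_measurable_def by (intro exI[of _ "\<lambda>_. s"]) auto

lemma strongly_measurable_const [simp]: "strongly_measurable M (\<lambda>_. c)"
  by (intro strongly_measurable_simple simple_function_const)

lemma strongly_measurable_compose2:
  assumes "strongly_measurable M f" "strongly_measurable M g"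
    and p: "\<And>a b u v. a \<longlonglongrightarrow> u \<Longrightarrow> b \<longlonglongrightarrow> v \<Longrightarrow> (\<lambda>i. p (a i) (b i)) \<longlonglongrightarrow> p u v"
  shows "strongly_measurable M (\<lambda>x. p (f x) (g x))"
proof -
  obtain s t where s: "\<And>i. simple_function M (s i)" "AE x in M. (\<lambda>i. s i x) \<longlonglongrightarrow> f x"
    and t: "\<And>i. simple_function M (t i)" "AE x in M. (\<lambda>i. t i x) \<longlonglongrightarrow> g x"
    using assms(1,2) unfolding strongly_measurable_def by blast
  show ?thesis unfolding strongly_measurable_def
  proof (intro exI[of _ "\<lambda>i x. p (s i x) (t i x)"] conjI allI)
    show "simple_function M (\<lambda>x. p (s i x) (t i x))" for i
      using s(1) t(1) by (rule simple_function_compose2)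
    show "AE x in M. (\<lambda>i. p (s i x) (t i x)) \<longlonglongrightarrow> p (f x) (g x)"
      using s(2) t(2) by eventually_elim (rule p)
  qed
qed

lemma strongly_measurable_add:
  "strongly_measurable M f \<Longrightarrow> strongly_measurable M g \<Longrightarrow> strongly_measurable M (\<lambda>x. f x + g x)"
  by (erule (1) strongly_measurable_compose2) (rule tendsto_add)

lemma strongly_measurable_diff:
  "strongly_measurable M f \<Longrightarrow> strongly_measurable M g \<Longrightarrow> strongly_measurable M (\<lambda>x. f x - g x)"
  by (erule (1) strongly_measurable_compose2) (rule tendsto_diff)

lemma strongly_measurable_scaleC:
  fixes f :: "'a \<Rightarrow> 'h::complex_hilbert"
  assumes "strongly_measurable M f"
  shows "strongly_measurable M (\<lambda>x. c *\<^sub>C f x)"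
  using strongly_measurable_compose2[OF assms assms, of "\<lambda>x y. c *\<^sub>C x"]
  by (simp add: bounded_linear.tendsto[OF bounded_linear_scaleC])

lemma strongly_measurable_fst:
  assumes "strongly_measurable M f"
  shows "strongly_measurable M (\<lambda>x. fst (f x))"
  using strongly_measurable_compose2[OF assms assms, of "\<lambda>x y. fst x"] by (simp add: tendsto_fst)

text \<open>Weighting the squares by 2 ^ i keeps the sum of their integrals finite, as 4 ^ i beats 2
  ^ i; the pointwise inequality d \<le> 1 / 2 ^ i + 2 ^ i d ^ 2 then removes the squares. This
  explains the rate 1 / 4 ^ i used throughout.\<close>

lemma AE_summable_if_sq_integrals_le:
  fixes d :: "nat \<Rightarrow> 'a \<Rightarrow> real"
  assumes [measurable]: "\<And>i. d i \<in> borel_measurable M"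
    and d: "\<And>i x. 0 \<le> d i x"
    and le: "\<And>i. (\<integral>\<^sup>+x. ennreal ((d i x)\<^sup>2) \<partial>M) \<le> ennreal (c / 4 ^ i)"
  shows "AE x in M. summable (\<lambda>i. d i x)"
proof -
  define c' where "c' = max c 0"
  have le: "(\<integral>\<^sup>+x. ennreal ((d i x)\<^sup>2) \<partial>M) \<le> ennreal (c' / 4 ^ i)" for i
    using le[of i] by (rule order.trans) (auto intro!: ennreal_leI divide_right_mono simp: c'_def)
  have "(\<integral>\<^sup>+x. (\<Sum>i. ennreal (2 ^ i * (d i x)\<^sup>2)) \<partial>M) = (\<Sum>i. \<integral>\<^sup>+x. ennreal (2 ^ i * (d i x)\<^sup>2) \<partial>M)"
    by (rule nn_integral_suminf) measurable
  also have "\<dots> \<le> (\<Sum>i. ennreal (c' * (1 / 2) ^ i))"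
  proof (intro suminf_le allI summableI)
    fix i
    have "(\<integral>\<^sup>+x. ennreal (2 ^ i * (d i x)\<^sup>2) \<partial>M) = ennreal (2 ^ i) * (\<integral>\<^sup>+x. ennreal ((d i x)\<^sup>2) \<partial>M)"
      by (subst nn_integral_cmult[symmetric]) (auto simp: ennreal_mult)
    also have "\<dots> \<le> ennreal (2 ^ i) * ennreal (c' / 4 ^ i)" by (intro mult_left_mono le) auto
    also have "\<dots> = ennreal (2 ^ i * (c' / 4 ^ i))" by (subst ennreal_mult) (auto simp: c'_def)
    also have "2 ^ i * (c' / 4 ^ i) = c' * (1 / 2) ^ i"
      by (simp add: power_divide field_simps power_mult_distrib[symmetric])
    finally show "(\<integral>\<^sup>+x. ennreal (2 ^ i * (d i x)\<^sup>2) \<partial>M) \<le> ennreal (c' * (1 / 2) ^ i)" .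
  qed
  also have "\<dots> = ennreal (\<Sum>i. c' * (1 / 2) ^ i)"
    by (intro suminf_ennreal2 summable_mult summable_geometric) (auto simp: c'_def)
  finally have "(\<integral>\<^sup>+x. (\<Sum>i. ennreal (2 ^ i * (d i x)\<^sup>2)) \<partial>M) \<noteq> \<infinity>"
    using ennreal_less_top le_less_trans by (metis infinity_ennreal_def less_irrefl)
  hence "AE x in M. (\<Sum>i. ennreal (2 ^ i * (d i x)\<^sup>2)) \<noteq> \<infinity>"
    by (intro nn_integral_PInf_AE) measurable
  thus ?thesis
  proof eventually_elim
    case (elim x)
    have "summable (\<lambda>i. 2 ^ i * (d i x)\<^sup>2)"
      using elim by (intro summable_suminf_not_top) auto
    hence "summable (\<lambda>i. (1 / 2) ^ i + 2 ^ i * (d i x)\<^sup>2)"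
      by (intro summable_add summable_geometric) auto
    thus ?case
    proof (rule summable_comparison_test')
      fix i :: nat
      define r where "r = (2::real) ^ i"
      have r: "r > 0" by (simp add: r_def)
      have "0 \<le> (r * d i x - 1 / 2)\<^sup>2" by simp
      hence "r * d i x \<le> 1 + r * (r * (d i x)\<^sup>2)" by (simp add: power2_eq_square algebra_simps)
      hence "d i x \<le> 1 / r + r * (d i x)\<^sup>2" using r by (simp add: field_simps)
      thus "norm (d i x) \<le> (1 / 2) ^ i + 2 ^ i * (d i x)\<^sup>2"
        using d[of i x] by (simp add: r_def power_divide)
    qed
  qed
qed

subsection \<open>Weights on the half-line\<close>

lemma space_half_line [simp]: "space half_line = {0<..}"
  by (simp add: half_line_def)

lemma sets_half_line: "E \<in> sets half_line \<longleftrightarrow> E \<subseteq> {0<..} \<and> E \<in> sets lebesgue"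
  unfolding half_line_def by (subst sets_restrict_space_iff) auto

lemma lebesgue_on_Ioo: "lebesgue_on {0<..<t::real} = restrict_space half_line {0<..<t}"
proof -
  have "{0<..} \<inter> {0<..<t} = {0<..<t}" by auto
  thus ?thesis unfolding half_line_def by (subst restrict_restrict_space) auto
qed

lemma AE_half_line: "(AE t in half_line. P t) \<longleftrightarrow> (AE t in lebesgue. 0 < t \<longrightarrow> P t)"
  unfolding half_line_def by (subst AE_restrict_space_iff) auto

text \<open>Completeness of Lebesgue measure absorbs changes on null sets, after extension by zero
  from S to the line. It is needed because strong measurability speaks of limits almost
  everywhere.\<close>

lemma borel_measurable_lebesgue_on_AE:
  fixes f g :: "real \<Rightarrow> real"
  assumes S: "S \<in> sets lebesgue"
    and "f \<in> borel_measurable (lebesgue_on S)" "AE t in lebesgue_on S. f t = g t"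
  shows "g \<in> borel_measurable (lebesgue_on S)"
proof -
  have "(\<lambda>t. indicat_real S t *\<^sub>R f t) \<in> borel_measurable lebesgue"
    using assms by (subst (asm) borel_measurable_restrict_space_iff) auto
  moreover have "AE t in lebesgue. t \<in> S \<longrightarrow> f t = g t"
    using assms by (subst (asm) AE_restrict_space_iff) auto
  hence "AE t in lebesgue. indicat_real S t *\<^sub>R f t = indicat_real S t *\<^sub>R g t"
    by eventually_elim (auto simp: indicator_def)
  ultimately have "(\<lambda>t. indicat_real S t *\<^sub>R g t) \<in> borel_measurable lebesgue"
    by (rule borel_measurable_AE)
  thus ?thesis using S by (subst borel_measurable_restrict_space_iff) auto
qed

lemma borel_measurable_norm_lebesgue_on:
  fixes S :: "real set"
  assumes S: "S \<in> sets lebesgue" and "strongly_measurable (lebesgue_on S) f"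
  shows "(\<lambda>t. norm (f t)) \<in> borel_measurable (lebesgue_on S)"
proof -
  let ?M = "lebesgue_on S"
  obtain s where s: "\<And>i. simple_function ?M (s i)" "AE x in ?M. (\<lambda>i. s i x) \<longlonglongrightarrow> f x"
    using assms unfolding strongly_measurable_def by blast
  have [measurable]: "(\<lambda>t. norm (s i t)) \<in> borel_measurable ?M" for i
    using simple_function_compose1[OF s(1), of norm i] by (rule borel_measurable_simple_function)
  have "(\<lambda>t. lim (\<lambda>i. norm (s i t))) \<in> borel_measurable ?M" by measurable
  moreover have "AE t in ?M. lim (\<lambda>i. norm (s i t)) = norm (f t)"
    using s(2) by eventually_elim (intro limI tendsto_norm)
  ultimately show ?thesis by (rule borel_measurable_lebesgue_on_AE[OF S])
qed

lemma borel_measurable_norm_strongly_measurable: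
  assumes "strongly_measurable half_line f"
  shows "(\<lambda>t. norm (f t)) \<in> borel_measurable half_line"
  using assms unfolding half_line_def by (intro borel_measurable_norm_lebesgue_on) auto

text \<open>Two weights are used: t powr \<beta> for the operator and 1 + t powr \<beta> for
  approximation in the graph norm. The bounds on dyadic intervals transfer the regularity of
  Lebesgue measure to the weighted measure.\<close>

locale weight =
  fixes \<omega> :: "real \<Rightarrow> real"
  assumes measurable_weight [measurable]: "\<omega> \<in> borel_measurable borel"
    and weight_pos: "0 < t \<Longrightarrow> 0 < \<omega> t"
    and weight_bounded: "\<exists>B. \<forall>t. 1 / 2 ^ k \<le> t \<and> t \<le> 2 ^ k \<longrightarrow> \<omega> t \<le> B"
begin

definition M :: "real measure" where
  "M = density half_line (\<lambda>t. ennreal (\<omega> t))"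

lemma space_M [simp]: "space M = {0<..}" and sets_M [simp, measurable_cong]: "sets M = sets half_line"
  by (simp_all add: M_def)

lemma measurable_weight_half_line [measurable]: "\<omega> \<in> borel_measurable half_line"
proof -
  have "\<omega> \<in> borel_measurable lebesgue" using measurable_weight by (simp add: measurable_completion)
  thus ?thesis unfolding half_line_def by (rule measurable_restrict_space1)
qed

lemma simple_function_M: "simple_function M f \<longleftrightarrow> simple_function half_line f"
  by (intro simple_function_cong_algebra) auto

lemma AE_M: "(AE t in M. P t) \<longleftrightarrow> (AE t in half_line. P t)"
proof -
  have "(AE t in M. P t) \<longleftrightarrow> (AE t in half_line. 0 < ennreal (\<omega> t) \<longrightarrow> P t)"
    unfolding M_def by (subst AE_density) auto
  also have "\<dots> \<longleftrightarrow> (AE t in half_line. P t)"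
    by (rule AE_cong) (simp add: weight_pos)
  finally show ?thesis .
qed

lemma strongly_measurable_M: "strongly_measurable M f \<longleftrightarrow> strongly_measurable half_line f"
  by (simp add: strongly_measurable_def simple_function_M AE_M)

lemma borel_measurable_norm:
  assumes "strongly_measurable M f"
  shows "(\<lambda>t. norm (f t)) \<in> borel_measurable M"
  using borel_measurable_norm_strongly_measurable[of f] assms unfolding strongly_measurable_M
  by (simp cong: measurable_cong_sets)

lemma nn_integral_M:
  assumes "f \<in> borel_measurable half_line"
  shows "(\<integral>\<^sup>+t. f t \<partial>M) = (\<integral>\<^sup>+t. ennreal (\<omega> t) * f t \<partial>half_line)"
  unfolding M_def using assms by (intro nn_integral_density) auto

lemma sq_norm_add_le:
  assumes "strongly_measurable M f" "strongly_measurable M g"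
  shows "sq_norm M (\<lambda>t. f t + g t) \<le> 2 * sq_norm M f + 2 * sq_norm M g"
proof -
  note [measurable] = borel_measurable_norm[OF assms(1)] borel_measurable_norm[OF assms(2)]
  have "sq_norm M (\<lambda>t. f t + g t)
      \<le> (\<integral>\<^sup>+t. 2 * ennreal ((norm (f t))\<^sup>2) + 2 * ennreal ((norm (g t))\<^sup>2) \<partial>M)"
    unfolding sq_norm_def
  proof (intro nn_integral_mono)
    fix t
    have "(norm (f t + g t))\<^sup>2 \<le> (norm (f t) + norm (g t))\<^sup>2"
      by (intro power_mono norm_triangle_ineq) auto
    also have "\<dots> \<le> 2 * (norm (f t))\<^sup>2 + 2 * (norm (g t))\<^sup>2"
      using sum_squares_bound[of "norm (f t)" "norm (g t)"] by (simp add: power2_sum)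
    finally have "ennreal ((norm (f t + g t))\<^sup>2) \<le> ennreal (2 * (norm (f t))\<^sup>2 + 2 * (norm (g t))\<^sup>2)"
      by (rule ennreal_leI)
    thus "ennreal ((norm (f t + g t))\<^sup>2) \<le> 2 * ennreal ((norm (f t))\<^sup>2) + 2 * ennreal ((norm (g t))\<^sup>2)"
      by (simp add: ennreal_plus ennreal_mult)
  qed
  also have "\<dots> = 2 * sq_norm M f + 2 * sq_norm M g"
    unfolding sq_norm_def by (subst nn_integral_add) (auto simp: nn_integral_cmult)
  finally show ?thesis .
qed

lemma sq_norm_triangle:
  assumes "strongly_measurable M f" "strongly_measurable M g" "strongly_measurable M h"
  shows "sq_norm M (\<lambda>t. f t - h t) \<le> 2 * sq_norm M (\<lambda>t. f t - g t) + 2 * sq_norm M (\<lambda>t. g t - h t)"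
  using sq_norm_add_le[OF strongly_measurable_diff[OF assms(1,2)] strongly_measurable_diff[OF assms(2,3)]]
  by simp

lemma AE_tendsto_if_sq_norm_le:
  assumes "\<And>i. strongly_measurable M (f i)" "strongly_measurable M g"
    and "\<And>i. sq_norm M (\<lambda>t. f i t - g t) \<le> ennreal (c / 4 ^ i)"
  shows "AE t in half_line. (\<lambda>i. f i t) \<longlonglongrightarrow> g t"
proof -
  have "AE t in M. summable (\<lambda>i. norm (f i t - g t))"
    using assms(3) unfolding sq_norm_def
    by (intro AE_summable_if_sq_integrals_le borel_measurable_norm strongly_measurable_diff assms) auto
  thus ?thesis unfolding AE_M
    by eventually_elim (metis LIM_zero_cancel summable_LIMSEQ_zero tendsto_norm_zero_iff)
qed

text \<open>Riesz-Fischer: summable increments give the pointwise limit and Fatou's lemma the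
  estimate. For simple functions the limit is strongly measurable by definition.\<close>

lemma L2_complete:
  fixes s :: "nat \<Rightarrow> real \<Rightarrow> 'b::banach"
  assumes s: "\<And>i. simple_function M (s i)"
    and cauchy: "\<And>i n. i \<le> n \<Longrightarrow> sq_norm M (\<lambda>t. s n t - s i t) \<le> ennreal (c / 4 ^ i)"
  shows "\<exists>g. strongly_measurable M g \<and> (\<forall>i. sq_norm M (\<lambda>t. g t - s i t) \<le> ennreal (c / 4 ^ i))"
proof -
  have sm: "strongly_measurable M (s i)" for i by (rule strongly_measurable_simple[OF s])
  note [measurable] = borel_measurable_norm[OF strongly_measurable_diff[OF sm sm]]
  have "AE t in M. summable (\<lambda>i. norm (s (Suc i) t - s i t))"
    using cauchy[OF le_SucI[OF order_refl]] unfolding sq_norm_def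
    by (intro AE_summable_if_sq_integrals_le[where c = c]) auto
  hence lim: "AE t in M. (\<lambda>i. s i t) \<longlonglongrightarrow> lim (\<lambda>i. s i t)"
  proof eventually_elim
    case (elim t)
    have "summable (\<lambda>i. s (Suc i) t - s i t)" using elim by (rule summable_norm_cancel)
    hence "convergent (\<lambda>n. \<Sum>i<n. s (Suc i) t - s i t)" by (simp add: summable_iff_convergent)
    hence "convergent (\<lambda>n. s n t - s 0 t)" using sum_lessThan_telescope[of "\<lambda>i. s i t"] by simp
    hence "convergent (\<lambda>n. s n t)" using convergent_diff_const_right_iff[of "\<lambda>n. s n t" "s 0 t"] by simp
    thus ?case by (simp add: convergent_LIMSEQ_iff)
  qed
  define g where "g t = lim (\<lambda>i. s i t)" for t
  have g: "strongly_measurable M g" unfolding strongly_measurable_def g_def using s lim by blast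
  moreover have "sq_norm M (\<lambda>t. g t - s i t) \<le> ennreal (c / 4 ^ i)" for i
  proof -
    have "sq_norm M (\<lambda>t. g t - s i t) = (\<integral>\<^sup>+t. liminf (\<lambda>n. ennreal ((norm (s n t - s i t))\<^sup>2)) \<partial>M)"
      unfolding sq_norm_def
    proof (intro nn_integral_cong_AE)
      show "AE t in M. ennreal ((norm (g t - s i t))\<^sup>2) = liminf (\<lambda>n. ennreal ((norm (s n t - s i t))\<^sup>2))"
        using lim
      proof eventually_elim
        case (elim t)
        have "(\<lambda>n. ennreal ((norm (s n t - s i t))\<^sup>2)) \<longlonglongrightarrow> ennreal ((norm (g t - s i t))\<^sup>2)"
          unfolding g_def by (intro tendsto_intros elim)
        thus ?case by (intro lim_imp_Liminf[symmetric]) auto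
      qed
    qed
    also have "\<dots> \<le> liminf (\<lambda>n. sq_norm M (\<lambda>t. s n t - s i t))"
      unfolding sq_norm_def by (rule nn_integral_liminf) measurable
    also have "\<dots> \<le> ennreal (c / 4 ^ i)"
      by (intro Liminf_le eventually_mono[OF eventually_ge_at_top[of i]] cauchy) auto
    finally show ?thesis .
  qed
  ultimately show ?thesis by blast
qed

end

subsection \<open>Dyadic step functions\<close>

definition idx :: "nat \<Rightarrow> real \<Rightarrow> nat" where
  "idx k t = nat \<lfloor>2 ^ k * t\<rfloor>"

lemma idx_zero [simp]: "idx k 0 = 0"
  by (simp add: idx_def)

lemma idx_le_iff: "0 \<le> t \<Longrightarrow> n \<le> idx k t \<longleftrightarrow> real n / 2 ^ k \<le> t"
  by (simp add: idx_def le_nat_iff le_floor_iff divide_le_eq mult.commute)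

lemma idx_grid [simp]: "idx k (real n / 2 ^ k) = n"
  by (simp add: idx_def)

lemma idx_bounds:
  assumes "0 \<le> t"
  shows "real (idx k t) / 2 ^ k \<le> t" "t < (real (idx k t) + 1) / 2 ^ k"
  using idx_le_iff[OF assms, of "idx k t" k] idx_le_iff[OF assms, of "Suc (idx k t)" k]
  by (auto simp: add.commute)

text \<open>The dyadic grids are nested; this is what makes a step of level k a step of every finer
  level.\<close>

lemma idx_eq_div:
  assumes "k \<le> l"
  shows "idx k t = idx l t div 2 ^ (l - k)"
proof -
  obtain j where j: "l = k + j" using assms le_Suc_ex by blast
  have "2 ^ k * t = (2 ^ l * t) / real_of_int (2 ^ j)" by (simp add: j power_add)
  hence "\<lfloor>2 ^ k * t\<rfloor> = \<lfloor>2 ^ l * t\<rfloor> div 2 ^ j"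
    by (metis floor_divide_real_eq_div zero_le_numeral zero_le_power)
  thus ?thesis by (simp add: j idx_def nat_div_distrib' nat_power_eq)
qed

lemma idx_nonpos: "t \<le> 0 \<Longrightarrow> idx k t = 0"
proof -
  assume "t \<le> 0"
  hence "2 ^ k * t \<le> 0" by (simp add: mult_nonneg_nonpos)
  hence "\<lfloor>2 ^ k * t\<rfloor> \<le> 0" by (metis floor_mono floor_zero)
  thus ?thesis by (simp add: idx_def)
qed

text \<open>An interval of length 2 ^ k holds 2 ^ k * 2 ^ k cells of length 1 / 2 ^ k; hence the
  number 4 ^ k in all sums over cells.\<close>

lemma idx_less: "t < 2 ^ k \<Longrightarrow> idx k t < 4 ^ k"
proof (cases "0 \<le> t")
  case True
  assume "t < 2 ^ k"
  moreover have "real (4 ^ k) / 2 ^ k = 2 ^ k" by (simp add: power_divide[symmetric])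
  ultimately show ?thesis using idx_le_iff[OF True, of "4 ^ k" k] by linarith
next
  case False
  thus ?thesis by (simp add: idx_nonpos)
qed

text \<open>Since \<open>idx k t = 0\<close> for \<open>t < 1 / 2 ^ k\<close>, such a function vanishes there; its weighted norm is
  therefore finite for every \<open>\<beta>\<close>.\<close>

definition dyadic_step :: "nat \<Rightarrow> (real \<Rightarrow> 'b::real_vector) \<Rightarrow> bool" where
  "dyadic_step k \<phi> \<longleftrightarrow>
     \<phi> 0 = 0 \<and> (\<forall>t. \<phi> t = \<phi> (real (idx k t) / 2 ^ k)) \<and> (\<forall>t\<ge>2 ^ k. \<phi> t = 0)"

lemma dyadic_step_zero: "dyadic_step k (\<lambda>_. 0)"
  by (simp add: dyadic_step_def)

lemma dyadic_step_zero_right: "dyadic_step k \<phi> \<Longrightarrow> 2 ^ k \<le> t \<Longrightarrow> \<phi> t = 0"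
  by (simp add: dyadic_step_def)

lemma dyadic_step_at_zero: "dyadic_step k \<phi> \<Longrightarrow> \<phi> 0 = 0"
  by (simp add: dyadic_step_def)

lemma dyadic_step_eq: "dyadic_step k \<phi> \<Longrightarrow> \<phi> t = \<phi> (real (idx k t) / 2 ^ k)"
  unfolding dyadic_step_def by blast

lemma dyadic_step_grid_eq_0:
  assumes "dyadic_step k \<phi>" "4 ^ k \<le> n"
  shows "\<phi> (real n / 2 ^ k) = 0"
proof (rule dyadic_step_zero_right[OF assms(1)])
  have "(2::real) ^ k * 2 ^ k = 4 ^ k" by (simp add: power_mult_distrib[symmetric])
  also have "\<dots> \<le> real n" using assms(2) by (metis of_nat_le_iff of_nat_numeral of_nat_power)
  finally show "2 ^ k \<le> real n / 2 ^ k" by (simp add: le_divide_eq)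
qed

lemma dyadic_step_compose2:
  assumes "dyadic_step k \<phi>" "dyadic_step k \<psi>" "p 0 0 = 0"
  shows "dyadic_step k (\<lambda>t. p (\<phi> t) (\<psi> t))"
  using assms unfolding dyadic_step_def by metis

lemma dyadic_step_compose: "dyadic_step k \<phi> \<Longrightarrow> p 0 = 0 \<Longrightarrow> dyadic_step k (\<lambda>t. p (\<phi> t))"
  by (rule dyadic_step_compose2[of k \<phi> \<phi> "\<lambda>x y. p x"])

lemma dyadic_step_mono:
  assumes \<phi>: "dyadic_step k \<phi>" and "k \<le> l"
  shows "dyadic_step l \<phi>"
  unfolding dyadic_step_def
proof (intro conjI allI impI)
  show "\<phi> 0 = 0" by (rule dyadic_step_at_zero[OF \<phi>])
  fix t :: real
  show "\<phi> t = \<phi> (real (idx l t) / 2 ^ l)"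
    using dyadic_step_eq[OF \<phi>, of t] dyadic_step_eq[OF \<phi>, of "real (idx l t) / 2 ^ l"]
    by (simp add: idx_eq_div[OF \<open>k \<le> l\<close>])
  assume "2 ^ l \<le> t"
  moreover have "(2::real) ^ k \<le> 2 ^ l" using \<open>k \<le> l\<close> by (simp add: power_increasing)
  ultimately show "\<phi> t = 0" by (intro dyadic_step_zero_right[OF \<phi>]) linarith
qed

lemma idx_measurable [measurable]: "idx k \<in> half_line \<rightarrow>\<^sub>M count_space UNIV"
proof -
  have "(\<lambda>t::real. nat \<lfloor>2 ^ k * t\<rfloor>) \<in> borel \<rightarrow>\<^sub>M count_space UNIV" by measurable
  hence "(\<lambda>t::real. nat \<lfloor>2 ^ k * t\<rfloor>) \<in> lebesgue \<rightarrow>\<^sub>M count_space UNIV" by (simp add: measurable_completion)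
  thus ?thesis unfolding half_line_def idx_def[abs_def] by (rule measurable_restrict_space1)
qed

lemma simple_function_idx:
  assumes "idx k \<in> N \<rightarrow>\<^sub>M count_space UNIV" "finite (w ` idx k ` space N)"
  shows "simple_function N (\<lambda>t. w (idx k t))"
  unfolding simple_function_def
proof (intro conjI ballI)
  show "finite ((\<lambda>t. w (idx k t)) ` space N)" using assms(2) by (simp add: image_image)
  fix y
  have "idx k -` {n. w n = y} \<inter> space N \<in> sets N" using assms(1) by (rule measurable_sets) simp
  also have "idx k -` {n. w n = y} \<inter> space N = (\<lambda>t. w (idx k t)) -` {y} \<inter> space N" by auto
  finally show "(\<lambda>t. w (idx k t)) -` {y} \<inter> space N \<in> sets N" .
qed

lemma finite_range_dyadic_step:
  assumes "dyadic_step k \<phi>"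
  shows "finite (range \<phi>)"
proof -
  have "\<phi> t \<in> insert 0 ((\<lambda>n. \<phi> (real n / 2 ^ k)) ` {..<4 ^ k})" for t
    using dyadic_step_eq[OF assms, of t] dyadic_step_zero_right[OF assms, of t] idx_less[of t k]
    by (cases "t < 2 ^ k") auto
  hence "range \<phi> \<subseteq> insert 0 ((\<lambda>n. \<phi> (real n / 2 ^ k)) ` {..<4 ^ k})" by blast
  thus ?thesis by (rule finite_subset) auto
qed

lemma simple_function_dyadic_step:
  assumes "dyadic_step k \<phi>"
  shows "simple_function half_line \<phi>"
proof -
  have "(\<lambda>n. \<phi> (real n / 2 ^ k)) ` idx k ` space half_line \<subseteq> range \<phi>" by auto
  hence "simple_function half_line (\<lambda>t. \<phi> (real (idx k t) / 2 ^ k))"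
    by (intro simple_function_idx idx_measurable finite_subset[OF _ finite_range_dyadic_step[OF assms]])
  thus ?thesis unfolding dyadic_step_eq[OF assms, symmetric] .
qed

section \<open>Density of dyadic step functions\<close>

context weight
begin

text \<open>G constrains the values of the approximating steps: with G the graph of A the
  approximation takes place in the graph norm, with \<open>UNIV\<close> it is plain density.\<close>

definition approximable :: "'b::real_normed_vector set \<Rightarrow> (real \<Rightarrow> 'b) \<Rightarrow> bool" where
  "approximable G f \<longleftrightarrow> strongly_measurable M f \<and>
     (\<forall>\<epsilon>>0. \<exists>k \<phi>. dyadic_step k \<phi> \<and> range \<phi> \<subseteq> G \<and> sq_norm M (\<lambda>t. f t - \<phi> t) \<le> ennreal \<epsilon>)"

lemma approximableD:
  assumes "approximable G f" "0 < \<epsilon>"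
  shows "\<exists>k \<phi>. dyadic_step k \<phi> \<and> range \<phi> \<subseteq> G \<and> sq_norm M (\<lambda>t. f t - \<phi> t) \<le> ennreal \<epsilon>"
  using assms by (simp add: approximable_def)

lemma strongly_measurable_dyadic_step: "dyadic_step k \<phi> \<Longrightarrow> strongly_measurable M \<phi>"
  by (intro strongly_measurable_simple) (simp add: simple_function_M simple_function_dyadic_step)

lemma approximable_zero: "0 \<in> G \<Longrightarrow> approximable G (\<lambda>_. 0)"
  unfolding approximable_def
  by (auto intro!: exI[of _ "\<lambda>_. 0"] exI[of _ "0::nat"] dyadic_step_zero)

lemma approximable_add:
  assumes f: "approximable G f" and g: "approximable G g" and G: "\<And>x y. x \<in> G \<Longrightarrow> y \<in> G \<Longrightarrow> x + y \<in> G"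
  shows "approximable G (\<lambda>t. f t + g t)"
  unfolding approximable_def
proof (intro conjI allI impI)
  have sm: "strongly_measurable M f" "strongly_measurable M g" using f g by (auto simp: approximable_def)
  thus "strongly_measurable M (\<lambda>t. f t + g t)" by (rule strongly_measurable_add)
  fix \<epsilon> :: real assume "0 < \<epsilon>"
  hence \<epsilon>4: "0 < \<epsilon> / 4" by simp
  obtain k \<phi> where
    \<phi>: "dyadic_step k \<phi>" "range \<phi> \<subseteq> G" "sq_norm M (\<lambda>t. f t - \<phi> t) \<le> ennreal (\<epsilon> / 4)"
    using approximableD[OF f \<epsilon>4] by blast
  obtain l \<psi> where
    \<psi>: "dyadic_step l \<psi>" "range \<psi> \<subseteq> G" "sq_norm M (\<lambda>t. g t - \<psi> t) \<le> ennreal (\<epsilon> / 4)"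
    using approximableD[OF g \<epsilon>4] by blast
  let ?m = "max k l"
  have "dyadic_step ?m (\<lambda>t. \<phi> t + \<psi> t)"
    using dyadic_step_mono[OF \<phi>(1), of ?m] dyadic_step_mono[OF \<psi>(1), of ?m]
    by (intro dyadic_step_compose2[where p = "(+)"]) auto
  moreover have "range (\<lambda>t. \<phi> t + \<psi> t) \<subseteq> G" using \<phi>(2) \<psi>(2) G by blast
  moreover have "sq_norm M (\<lambda>t. f t + g t - (\<phi> t + \<psi> t)) \<le> ennreal \<epsilon>"
  proof -
    have "sq_norm M (\<lambda>t. f t + g t - (\<phi> t + \<psi> t)) = sq_norm M (\<lambda>t. (f t - \<phi> t) + (g t - \<psi> t))"
      by (simp add: algebra_simps)
    also have "\<dots> \<le> 2 * sq_norm M (\<lambda>t. f t - \<phi> t) + 2 * sq_norm M (\<lambda>t. g t - \<psi> t)"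
      using \<phi>(1) \<psi>(1) by (intro sq_norm_add_le strongly_measurable_diff sm strongly_measurable_dyadic_step)
    also have "\<dots> \<le> 2 * ennreal (\<epsilon> / 4) + 2 * ennreal (\<epsilon> / 4)"
      by (intro add_mono mult_left_mono \<phi>(3) \<psi>(3)) auto
    also have "\<dots> = ennreal \<epsilon>" using \<open>0 < \<epsilon>\<close> by (subst two_ennreal_add) auto
    finally show ?thesis .
  qed
  ultimately show "\<exists>k \<phi>. dyadic_step k \<phi> \<and> range \<phi> \<subseteq> G \<and> sq_norm M (\<lambda>t. f t + g t - \<phi> t) \<le> ennreal \<epsilon>"
    by blast
qed

lemma approximable_limit:
  assumes f: "strongly_measurable M f"
    and lim: "\<And>\<epsilon>::real. 0 < \<epsilon> \<Longrightarrow> \<exists>g. approximable G g \<and> sq_norm M (\<lambda>t. f t - g t) \<le> ennreal \<epsilon>"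
  shows "approximable G f"
  unfolding approximable_def
proof (intro conjI allI impI f)
  fix \<epsilon> :: real assume "0 < \<epsilon>"
  then obtain g where g: "approximable G g" "sq_norm M (\<lambda>t. f t - g t) \<le> ennreal (\<epsilon> / 4)"
    using lim[of "\<epsilon> / 4"] by auto
  obtain k \<phi> where \<phi>: "dyadic_step k \<phi>" "range \<phi> \<subseteq> G" "sq_norm M (\<lambda>t. g t - \<phi> t) \<le> ennreal (\<epsilon> / 4)"
    using approximableD[OF g(1), of "\<epsilon> / 4"] \<open>0 < \<epsilon>\<close> by auto
  have "sq_norm M (\<lambda>t. f t - \<phi> t) \<le> 2 * sq_norm M (\<lambda>t. f t - g t) + 2 * sq_norm M (\<lambda>t. g t - \<phi> t)"
    using g(1) strongly_measurable_dyadic_step[OF \<phi>(1)]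
    by (intro sq_norm_triangle f) (auto simp: approximable_def)
  also have "\<dots> \<le> 2 * ennreal (\<epsilon> / 4) + 2 * ennreal (\<epsilon> / 4)"
    by (intro add_mono mult_left_mono \<phi>(3) g(2)) auto
  also have "\<dots> = ennreal \<epsilon>" using \<open>0 < \<epsilon>\<close> by (subst two_ennreal_add) auto
  finally show "\<exists>k \<phi>. dyadic_step k \<phi> \<and> range \<phi> \<subseteq> G \<and> sq_norm M (\<lambda>t. f t - \<phi> t) \<le> ennreal \<epsilon>"
    using \<phi> by blast
qed

lemma sq_norm_indicator_diff_le:
  assumes "P \<in> sets M" "Q \<in> sets M" and "\<And>t. 0 < t \<Longrightarrow> t \<notin> P \<union> Q \<Longrightarrow> t \<in> E \<longleftrightarrow> t \<in> F"
  shows "sq_norm M (\<lambda>t. indicat_real E t - indicat_real F t) \<le> emeasure M P + emeasure M Q"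
proof -
  have "sq_norm M (\<lambda>t. indicat_real E t - indicat_real F t) \<le> (\<integral>\<^sup>+t. indicator P t + indicator Q t \<partial>M)"
    unfolding sq_norm_def using assms(3)
    by (intro nn_integral_mono) (auto simp: indicator_def)
  also have "\<dots> = emeasure M P + emeasure M Q"
    using assms(1,2) by (subst nn_integral_add) auto
  finally show ?thesis .
qed

text \<open>F is the union of the cells meeting K. A mesh below d, where all balls of radius d about
  points of K lie in U, prevents these cells from leaving U.\<close>

lemma dyadic_set_between:
  assumes K: "compact K" "K \<subseteq> {1 / 2 ^ m..2 ^ m}" and U: "open U" "K \<subseteq> U"
  shows "\<exists>k F. dyadic_step k (indicat_real F) \<and> K \<subseteq> F \<and> F \<subseteq> U"
proof -
  obtain d where d: "d > 0" "(\<Union>x\<in>K. ball x d) \<subseteq> U"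
    using compact_subset_open_imp_ball_epsilon_subset[OF K(1) U] by blast
  obtain l where l: "(1 / 2) ^ l < d" using real_arch_pow_inv[OF d(1), of "1/2"] by auto
  \<comment> \<open>Level Suc m or finer keeps K off cell 0 and strictly below 2 ^ k, as
    \<open>dyadic_step\<close> requires.\<close>
  define k where "k = max l (Suc m)"
  have mesh: "1 / 2 ^ k < d"
  proof -
    have "(1 / 2 ^ k :: real) \<le> 1 / 2 ^ l" by (intro divide_left_mono power_increasing) (auto simp: k_def)
    thus ?thesis using l by (simp add: power_divide)
  qed
  have pow: "(2::real) ^ m < 2 ^ k" by (intro power_strict_increasing) (auto simp: k_def)
  have K_pos: "0 < s" "s < 2 ^ k" "1 \<le> idx k s" if "s \<in> K" for s
  proof -
    have s: "1 / 2 ^ m \<le> s" "s \<le> 2 ^ m" using that K(2) by auto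
    show "0 < s" using s(1) by (rule less_le_trans[rotated]) simp
    show "s < 2 ^ k" using s(2) pow by linarith
    have "1 / 2 ^ k \<le> (1 / 2 ^ m :: real)" using pow by (intro divide_left_mono) auto
    thus "1 \<le> idx k s" using idx_le_iff[of s 1 k] s(1) \<open>0 < s\<close> by simp
  qed
  define F where "F = {t. \<exists>s\<in>K. idx k s = idx k t}"
  have F_pos: "0 < t" if "t \<in> F" for t
  proof (rule ccontr)
    assume "\<not> 0 < t"
    hence "idx k t = 0" by (simp add: idx_nonpos)
    thus False using that K_pos(3) by (force simp: F_def)
  qed
  have "dyadic_step k (indicat_real F)"
    unfolding dyadic_step_def
  proof (intro conjI allI impI)
    show "indicat_real F 0 = 0" using F_pos[of 0] by (auto simp: indicator_def)
    show "indicat_real F t = indicat_real F (real (idx k t) / 2 ^ k)" for t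
      by (simp add: indicator_def F_def)
    fix t :: real assume t: "2 ^ k \<le> t"
    have "t \<notin> F"
    proof
      assume "t \<in> F"
      then obtain s where s: "s \<in> K" "idx k s = idx k t" by (auto simp: F_def)
      have "0 < t" by (rule F_pos[OF \<open>t \<in> F\<close>])
      have "idx k t < 4 ^ k" using idx_less[OF K_pos(2)[OF s(1)]] s(2) by simp
      moreover have "4 ^ k \<le> idx k t"
        using idx_le_iff[of t "4 ^ k" k] t \<open>0 < t\<close> by (simp add: power_divide[symmetric])
      ultimately show False by simp
    qed
    thus "indicat_real F t = 0" by simp
  qed
  moreover have "K \<subseteq> F" by (auto simp: F_def)
  moreover have "F \<subseteq> U"
  proof
    fix t assume "t \<in> F"
    then obtain s where s: "s \<in> K" "idx k s = idx k t" by (auto simp: F_def)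
    have "0 < s" "0 < t" using K_pos(1)[OF s(1)] F_pos[OF \<open>t \<in> F\<close>] .
    hence "\<bar>s - t\<bar> < 1 / 2 ^ k"
      using idx_bounds[of s k] idx_bounds[of t k] s(2) by (simp add: add_divide_distrib)
    hence "t \<in> ball s d" using mesh by (simp add: dist_real_def)
    thus "t \<in> U" using d(2) s(1) by blast
  qed
  ultimately show ?thesis by blast
qed

lemma sets_M_compact_exhaustion:
  assumes E: "E \<in> sets M" "emeasure M E < \<infinity>" and "0 < \<epsilon>"
  shows "\<exists>m. emeasure M (E - {1 / 2 ^ m..2 ^ m}) < \<epsilon>"
proof -
  let ?R = "\<lambda>m. E - {1 / 2 ^ m..2 ^ m :: real}"
  have "?R m \<in> sets M" for m
    using E(1) by (auto simp: sets_half_line)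
  moreover have "decseq ?R"
  proof (rule decseq_SucI)
    fix m
    have "(1 / 2 ^ Suc m :: real) \<le> 1 / 2 ^ m" "(2::real) ^ m \<le> 2 ^ Suc m"
      by (auto intro!: divide_left_mono)
    thus "?R (Suc m) \<subseteq> ?R m" by auto
  qed
  moreover have "emeasure M (?R m) \<noteq> \<infinity>" for m
    using E(2) emeasure_mono[of "?R m" E M] E(1) by (auto simp: top_unique)
  ultimately have "(\<lambda>m. emeasure M (?R m)) \<longlonglongrightarrow> emeasure M (\<Inter>m. ?R m)"
    by (intro Lim_emeasure_decseq) auto
  moreover have "(\<Inter>m. ?R m) = {}"
  proof -
    have "\<exists>m. 1 / 2 ^ m \<le> t \<and> t \<le> 2 ^ m" if t: "0 < t" for t :: real
    proof -
      obtain a where a: "(1 / 2) ^ a < t" using real_arch_pow_inv[OF t, of "1/2"] by auto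
      obtain b where b: "t < 2 ^ b" using real_arch_pow[of 2 t] by auto
      have "1 / 2 ^ max a b \<le> (1 / 2 ^ a :: real)" "(2::real) ^ b \<le> 2 ^ max a b"
        by (auto intro!: divide_left_mono power_increasing)
      moreover have "(1 / 2 ^ a :: real) < t" using a by (simp add: power_divide)
      ultimately have "1 / 2 ^ max a b \<le> t \<and> t \<le> 2 ^ max a b" using b by linarith
      thus ?thesis by blast
    qed
    moreover have "E \<subseteq> {0<..}" using E(1) by (simp add: sets_half_line)
    ultimately show ?thesis by (fastforce simp: subset_eq)
  qed
  ultimately have "(\<lambda>m. emeasure M (?R m)) \<longlonglongrightarrow> 0" by (simp only: emeasure_empty)
  hence "\<forall>\<^sub>F m in sequentially. emeasure M (?R m) < \<epsilon>" using \<open>0 < \<epsilon>\<close> by (rule order_tendstoD)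
  thus ?thesis by (auto simp: eventually_sequentially)
qed

text \<open>After cutting E to an interval on which the weight is bounded, inner and outer
  regularity of Lebesgue measure sandwich it between a compact and an open set, and a dyadic set
  fits between these.\<close>

lemma sets_approximable:
  fixes \<epsilon> :: real
  assumes E: "E \<in> sets M" "emeasure M E < \<infinity>" and \<epsilon>: "0 < \<epsilon>"
  shows "\<exists>k F. dyadic_step k (indicat_real F) \<and>
           sq_norm M (\<lambda>t. indicat_real E t - indicat_real F t) \<le> ennreal \<epsilon>"
proof -
  obtain m where m: "emeasure M (E - {1 / 2 ^ m..2 ^ m}) < ennreal (\<epsilon> / 2)"
    using sets_M_compact_exhaustion[OF E, of "ennreal (\<epsilon> / 2)"] \<epsilon> by auto
  define E' where "E' = E \<inter> {1 / 2 ^ m..2 ^ m}"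
  have E'_leb: "E' \<in> sets lebesgue" using E(1) by (auto simp: E'_def sets_half_line)
  \<comment> \<open>One dyadic level of room, from m to Suc m, lets the open set V contain E' and
    stay where the weight is bounded.\<close>
  obtain B0 where B0: "\<And>t. 1 / 2 ^ Suc m \<le> t \<and> t \<le> 2 ^ Suc m \<longrightarrow> \<omega> t \<le> B0"
    using weight_bounded by blast
  define B where "B = max B0 1"
  have B: "B > 0" "\<And>t. 1 / 2 ^ Suc m \<le> t \<Longrightarrow> t \<le> 2 ^ Suc m \<Longrightarrow> \<omega> t \<le> B"
    using B0 by (auto simp: B_def le_max_iff_disj)
  \<comment> \<open>The gap between K and V has Lebesgue measure at most 2 e and weight at most B,
    hence weighted measure at most 2 B e = \<epsilon> / 2.\<close>
  define e where "e = \<epsilon> / (4 * B)"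
  have e: "e > 0" using \<epsilon> B by (simp add: e_def)
  obtain K where K: "closed K" "K \<subseteq> E'" "E' - K \<in> lmeasurable" "emeasure lebesgue (E' - K) < ennreal e"
    using sets_lebesgue_inner_closed[OF E'_leb e] by blast
  obtain U where U: "open U" "E' \<subseteq> U" "U - E' \<in> lmeasurable" "emeasure lebesgue (U - E') < ennreal e"
    using sets_lebesgue_outer_open[OF E'_leb e] by blast
  define V where "V = U \<inter> {1 / 2 ^ Suc m<..<2 ^ Suc m}"
  have pow: "(1 / 2 ^ Suc m :: real) < 1 / 2 ^ m" "(2::real) ^ m < 2 ^ Suc m" by (auto simp: field_simps)
  have E'V: "E' \<subseteq> V" using U(2) pow by (force simp: V_def E'_def)
  have K_sub: "K \<subseteq> {1 / 2 ^ m..2 ^ m}" using K(2) by (auto simp: E'_def)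
  have "compact K" using K(1) K_sub by (meson bounded_closed_interval bounded_subset compact_eq_bounded_closed)
  moreover have "open V" using U(1) by (auto simp: V_def)
  ultimately obtain k F where F: "dyadic_step k (indicat_real F)" "K \<subseteq> F" "F \<subseteq> V"
    using dyadic_set_between[OF _ K_sub, of V] K(2) E'V by blast
  define N where "N = V - K"
  have N_leb: "N \<in> sets lebesgue"
    using \<open>open V\<close> K(1) by (simp add: N_def borel_open borel_closed sets.Diff)
  have V_pos: "V \<subseteq> {0<..}" unfolding V_def by (auto intro: less_trans[rotated])
  have N: "N \<in> sets M" using N_leb V_pos by (auto simp: sets_half_line N_def)
  have "emeasure M N = (\<integral>\<^sup>+t. indicator N t \<partial>M)" using N by simp
  also have "\<dots> = (\<integral>\<^sup>+t. ennreal (\<omega> t) * indicator N t \<partial>half_line)"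
    using N by (intro nn_integral_M) simp
  also have "\<dots> \<le> (\<integral>\<^sup>+t. ennreal B * indicator N t \<partial>half_line)"
    by (intro nn_integral_mono) (auto simp: indicator_def N_def V_def intro!: ennreal_leI B(2))
  also have "\<dots> = ennreal B * emeasure half_line N"
    using N by (simp add: nn_integral_cmult_indicator)
  also have "emeasure half_line N = emeasure lebesgue N"
    unfolding half_line_def using N V_pos by (intro emeasure_restrict_space) (auto simp: N_def)
  also have "emeasure lebesgue N \<le> emeasure lebesgue ((U - E') \<union> (E' - K))"
    using U(3) K(3) by (intro emeasure_mono) (auto simp: N_def V_def)
  also have "\<dots> \<le> emeasure lebesgue (U - E') + emeasure lebesgue (E' - K)"
    using U(3) K(3) by (intro emeasure_subadditive) auto
  also have "\<dots> \<le> ennreal e + ennreal e" using U(4) K(4) by (intro add_mono) auto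
  also have "ennreal B * (ennreal e + ennreal e) = ennreal (\<epsilon> / 2)"
    using B e by (simp add: ennreal_plus[symmetric] ennreal_mult[symmetric] e_def del: ennreal_plus)
  finally have N_le: "emeasure M N \<le> ennreal (\<epsilon> / 2)" by (simp add: mult_left_mono)
  have "sq_norm M (\<lambda>t. indicat_real E t - indicat_real F t) \<le> emeasure M (E - {1 / 2 ^ m..2 ^ m}) + emeasure M N"
  proof (rule sq_norm_indicator_diff_le)
    show "E - {1 / 2 ^ m..2 ^ m} \<in> sets M" using E(1) by (auto simp: sets_half_line)
    show "t \<in> E \<longleftrightarrow> t \<in> F" if "0 < t" "t \<notin> E - {1 / 2 ^ m..2 ^ m} \<union> N" for t
      using that F(2,3) E'V K(2) by (auto simp: N_def E'_def)
  qed (rule N)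
  also have "\<dots> \<le> ennreal (\<epsilon> / 2) + ennreal (\<epsilon> / 2)" using m N_le by (intro add_mono) auto
  also have "\<dots> = ennreal \<epsilon>" using \<epsilon> by (simp add: ennreal_plus[symmetric] del: ennreal_plus)
  finally show ?thesis using F(1) by blast
qed

lemma approximable_indicator:
  assumes E: "E \<in> sets M" "emeasure M E < \<infinity>" and G: "v \<in> G" "0 \<in> G"
  shows "approximable G (\<lambda>t. indicat_real E t *\<^sub>R v)"
  unfolding approximable_def
proof (intro conjI allI impI)
  have "simple_function M (\<lambda>t. indicat_real E t *\<^sub>R v)"
    using E(1) by (intro simple_function_compose1[of _ _ "\<lambda>r. r *\<^sub>R v"] simple_function_indicator)
  thus "strongly_measurable M (\<lambda>t. indicat_real E t *\<^sub>R v)" by (rule strongly_measurable_simple)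
  fix \<epsilon> :: real assume "0 < \<epsilon>"
  \<comment> \<open>Adding 1 keeps the divisor positive when v = 0.\<close>
  define c where "c = (norm v)\<^sup>2 + 1"
  have c: "c > 0" "(norm v)\<^sup>2 \<le> c" by (auto simp: c_def add_nonneg_pos)
  obtain k F where F: "dyadic_step k (indicat_real F)"
    "sq_norm M (\<lambda>t. indicat_real E t - indicat_real F t) \<le> ennreal (\<epsilon> / c)"
    using sets_approximable[OF E, of "\<epsilon> / c"] \<open>0 < \<epsilon>\<close> c by auto
  have FM: "(\<lambda>t. norm (indicat_real E t - indicat_real F t)) \<in> borel_measurable M"
    using E(1) strongly_measurable_dyadic_step[OF F(1)]
    by (intro borel_measurable_norm strongly_measurable_diff)
       (auto intro!: strongly_measurable_simple simple_function_indicator)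
  have "sq_norm M (\<lambda>t. indicat_real E t *\<^sub>R v - indicat_real F t *\<^sub>R v)
      = (\<integral>\<^sup>+t. ennreal ((norm v)\<^sup>2) * ennreal ((norm (indicat_real E t - indicat_real F t))\<^sup>2) \<partial>M)"
    unfolding sq_norm_def scaleR_diff_left[symmetric] norm_scaleR real_norm_def
    by (simp add: power_mult_distrib ennreal_mult mult.commute)
  also have "\<dots> = ennreal ((norm v)\<^sup>2) * sq_norm M (\<lambda>t. indicat_real E t - indicat_real F t)"
    unfolding sq_norm_def by (rule nn_integral_cmult) (use FM in measurable)
  also have "\<dots> \<le> ennreal c * ennreal (\<epsilon> / c)" using F(2) c by (intro mult_mono ennreal_leI) auto
  also have "\<dots> = ennreal \<epsilon>" using c \<open>0 < \<epsilon>\<close> by (simp add: ennreal_mult[symmetric])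
  finally show "\<exists>k \<phi>. dyadic_step k \<phi> \<and> range \<phi> \<subseteq> G \<and> sq_norm M (\<lambda>t. indicat_real E t *\<^sub>R v - \<phi> t) \<le> ennreal \<epsilon>"
    using dyadic_step_compose[OF F(1), of "\<lambda>r. r *\<^sub>R v"] G
    by (intro exI[of _ k] exI[of _ "\<lambda>t. indicat_real F t *\<^sub>R v"]) (auto simp: indicator_def)
qed

lemma approximable_simple:
  assumes s: "simple_function M s" "sq_norm M s < \<infinity>" "s ` space M \<subseteq> G"
    and G: "0 \<in> G" "\<And>x y. x \<in> G \<Longrightarrow> y \<in> G \<Longrightarrow> x + y \<in> G"
  shows "approximable G s"
proof -
  let ?E = "\<lambda>v. s -` {v} \<inter> space M"
  have E: "?E v \<in> sets M" for v using s(1) by (rule simple_functionD)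
  \<comment> \<open>Chebyshev's inequality. The level set of 0 may have infinite measure and is
    therefore left out of the sum below.\<close>
  have fin: "emeasure M (?E v) < \<infinity>" if "v \<noteq> 0" for v
  proof -
    have "ennreal ((norm v)\<^sup>2) * emeasure M (?E v) = (\<integral>\<^sup>+t. ennreal ((norm v)\<^sup>2) * indicator (?E v) t \<partial>M)"
      using E by (simp add: nn_integral_cmult_indicator)
    also have "\<dots> \<le> sq_norm M s" unfolding sq_norm_def
      by (intro nn_integral_mono) (auto simp: indicator_def)
    finally have "ennreal ((norm v)\<^sup>2) * emeasure M (?E v) < top"
      using s(2) by (simp add: le_less_trans)
    thus ?thesis using that by (auto simp: ennreal_mult_less_top)
  qed
  have sum_approximable: "approximable G (\<lambda>t. \<Sum>v\<in>V. indicat_real (?E v) t *\<^sub>R v)" if "finite V" "V \<subseteq> s ` space M - {0}" for V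
    using that
  proof (induction V)
    case empty
    thus ?case using approximable_zero[OF G(1)] by simp
  next
    case (insert v V)
    hence v: "v \<noteq> 0" "v \<in> G" using s(3) by auto
    have "approximable G (\<lambda>t. indicat_real (?E v) t *\<^sub>R v + (\<Sum>v\<in>V. indicat_real (?E v) t *\<^sub>R v))"
      using insert by (intro approximable_add approximable_indicator E fin v G) auto
    thus ?case unfolding sum.insert[OF insert(1,2)] .
  qed
  have *: "approximable G (\<lambda>t. \<Sum>v\<in>s ` space M - {0}. indicat_real (?E v) t *\<^sub>R v)"
  proof (rule sum_approximable)
    show "finite (s ` space M - {0})" using simple_functionD(1)[OF s(1)] by (rule finite_Diff)
  qed (rule order_refl)
  have eq: "s t = (\<Sum>v\<in>s ` space M - {0}. indicat_real (?E v) t *\<^sub>R v)" if t: "t \<in> space M" for t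
  proof -
    have "(\<Sum>v\<in>s ` space M - {0}. indicat_real (?E v) t *\<^sub>R v)
        = (\<Sum>v\<in>s ` space M - {0}. if s t = v then v else 0)"
      using t by (intro sum.cong) (auto simp: indicator_def)
    also have "\<dots> = s t" using s(1) t by (auto simp: sum.delta simple_function_def)
    finally show ?thesis by simp
  qed
  show ?thesis
  proof (rule approximable_limit)
    show "strongly_measurable M s" using s(1) by (rule strongly_measurable_simple)
    show "\<exists>g. approximable G g \<and> sq_norm M (\<lambda>t. s t - g t) \<le> ennreal \<epsilon>" for \<epsilon>
    proof (intro exI conjI)
      have "sq_norm M (\<lambda>t. s t - (\<Sum>v\<in>s ` space M - {0}. indicat_real (?E v) t *\<^sub>R v)) = (\<integral>\<^sup>+t. 0 \<partial>M)"
        unfolding sq_norm_def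
      proof (rule nn_integral_cong)
        fix t assume "t \<in> space M"
        thus "ennreal ((norm (s t - (\<Sum>v\<in>s ` space M - {0}. indicat_real (?E v) t *\<^sub>R v)))\<^sup>2) = 0"
          by (subst eq[symmetric]) auto
      qed
      also have "\<dots> \<le> ennreal \<epsilon>" by simp
      finally show "sq_norm M (\<lambda>t. s t - (\<Sum>v\<in>s ` space M - {0}. indicat_real (?E v) t *\<^sub>R v)) \<le> ennreal \<epsilon>" .
    qed (rule *)
  qed
qed

text \<open>A nearest point of a closed set need not exist in a normed space; a point within twice
  the distance does, and serves as a substitute for a projection onto G.\<close>

lemma near_point_exists:
  fixes v :: "'b::real_normed_vector"
  assumes "closed G" "G \<noteq> {}"
  shows "\<exists>w\<in>G. \<forall>x\<in>G. norm (v - w) \<le> 2 * norm (v - x)"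
proof (cases "v \<in> G")
  case False
  hence pos: "infdist v G > 0"
    using assms in_closed_iff_infdist_zero[of G v] infdist_nonneg[of v G] by linarith
  have "(INF x\<in>G. dist v x) < 2 * infdist v G" using pos assms by (simp add: infdist_def)
  then obtain w where w: "w \<in> G" "dist v w < 2 * infdist v G"
    using assms by (auto dest!: cInf_lessD[rotated])
  have "norm (v - w) \<le> 2 * norm (v - x)" if "x \<in> G" for x
    using w(2) infdist_le[OF that, of v] by (simp add: dist_norm)
  thus ?thesis using w(1) by blast
qed force

text \<open>Simple functions tending to f are pushed into G by the near-point map r. They stay
  simple because r acts on finitely many values, and they keep their limit because r moves s i t by
  at most 2 * norm (s i t - f t) when f t lies in G.\<close>

theorem approximable_if_square_integrable:
  fixes f :: "real \<Rightarrow> 'b::real_normed_vector"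
  assumes f: "strongly_measurable M f" "sq_norm M f < \<infinity>" "AE t in M. f t \<in> G"
    and G: "closed G" "0 \<in> G" "\<And>x y. x \<in> G \<Longrightarrow> y \<in> G \<Longrightarrow> x + y \<in> G"
  shows "approximable G f"
proof (rule approximable_limit[OF f(1)])
  obtain r where r: "\<And>v. r v \<in> G" "\<And>v x. x \<in> G \<Longrightarrow> norm (v - r v) \<le> 2 * norm (v - x)"
    using near_point_exists[OF G(1)] G(2) by (metis empty_iff)
  obtain s where s: "\<And>i. simple_function M (s i)" "AE t in M. (\<lambda>i. s i t) \<longlonglongrightarrow> f t"
    using f(1) unfolding strongly_measurable_def by blast
  note [measurable] = borel_measurable_norm[OF f(1)]
  have rs: "simple_function M (\<lambda>t. r (s i t))" for i by (rule simple_function_compose1[OF s(1)])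
  have [measurable]: "(\<lambda>t. norm (r (s i t))) \<in> borel_measurable M" for i
    by (rule borel_measurable_simple_function[OF simple_function_compose1[OF rs]])
  \<comment> \<open>Cutting to 0 where the norm exceeds twice that of f provides a dominating
    function. Where f t is nonzero the cut is eventually inactive, since the limit lies strictly
    below the threshold.\<close>
  define u where "u i t = (if norm (r (s i t)) \<le> 2 * norm (f t) then r (s i t) else 0)" for i t
  have u: "simple_function M (u i)" for i
    unfolding u_def by (intro simple_function_If rs simple_function_const) measurable
  have u_le: "norm (u i t) \<le> 2 * norm (f t)" for i t by (simp add: u_def)
  have sm: "strongly_measurable M (u i)" for i by (rule strongly_measurable_simple[OF u])
  note [measurable] = borel_measurable_norm[OF strongly_measurable_diff[OF f(1) sm]]
  have u_fin: "sq_norm M (u i) < \<infinity>" for i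
  proof -
    have "sq_norm M (u i) \<le> (\<integral>\<^sup>+t. ennreal 4 * ennreal ((norm (f t))\<^sup>2) \<partial>M)"
      unfolding sq_norm_def
    proof (intro nn_integral_mono)
      fix t
      have "(norm (u i t))\<^sup>2 \<le> (2 * norm (f t))\<^sup>2" by (intro power_mono u_le) simp
      thus "ennreal ((norm (u i t))\<^sup>2) \<le> ennreal 4 * ennreal ((norm (f t))\<^sup>2)"
        by (subst ennreal_mult[symmetric]) (auto intro!: ennreal_leI simp: power_mult_distrib)
    qed
    also have "\<dots> = ennreal 4 * sq_norm M f" unfolding sq_norm_def by (intro nn_integral_cmult) measurable
    also have "\<dots> < \<infinity>" using f(2) by (simp add: ennreal_mult_less_top)
    finally show ?thesis .
  qed
  have "(\<lambda>i. sq_norm M (\<lambda>t. f t - u i t)) \<longlonglongrightarrow> (\<integral>\<^sup>+t. 0 \<partial>M)"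
    unfolding sq_norm_def
  proof (rule nn_integral_dominated_convergence[where w = "\<lambda>t. ennreal 9 * ennreal ((norm (f t))\<^sup>2)"])
    have "(\<integral>\<^sup>+t. ennreal 9 * ennreal ((norm (f t))\<^sup>2) \<partial>M) = ennreal 9 * sq_norm M f"
      unfolding sq_norm_def by (intro nn_integral_cmult) measurable
    thus "(\<integral>\<^sup>+t. ennreal 9 * ennreal ((norm (f t))\<^sup>2) \<partial>M) < \<infinity>"
      using f(2) by (simp add: ennreal_mult_less_top)
    show "AE t in M. ennreal ((norm (f t - u i t))\<^sup>2) \<le> ennreal 9 * ennreal ((norm (f t))\<^sup>2)" for i
    proof (intro always_eventually allI)
      fix t
      have "norm (f t - u i t) \<le> 3 * norm (f t)"
        using norm_triangle_ineq4[of "f t" "u i t"] u_le[of i t] by simp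
      hence "(norm (f t - u i t))\<^sup>2 \<le> (3 * norm (f t))\<^sup>2" by (intro power_mono) auto
      thus "ennreal ((norm (f t - u i t))\<^sup>2) \<le> ennreal 9 * ennreal ((norm (f t))\<^sup>2)"
        by (subst ennreal_mult[symmetric]) (auto intro!: ennreal_leI simp: power_mult_distrib)
    qed
    show "AE t in M. (\<lambda>i. ennreal ((norm (f t - u i t))\<^sup>2)) \<longlonglongrightarrow> 0"
      using s(2) f(3)
    proof eventually_elim
      case (elim t)
      have rlim: "(\<lambda>i. r (s i t)) \<longlonglongrightarrow> f t"
      proof (rule Lim_transform[OF elim(1)])
        have lim2: "(\<lambda>i. 2 * norm (s i t - f t)) \<longlonglongrightarrow> 0"
          using elim(1) by (intro tendsto_mult_right_zero tendsto_norm_zero LIM_zero)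
        have "norm (r (s i t) - s i t) \<le> 2 * norm (s i t - f t)" for i
          using r(2)[OF elim(2), of "s i t"] by (simp add: norm_minus_commute)
        thus "(\<lambda>i. r (s i t) - s i t) \<longlonglongrightarrow> 0"
          by (intro Lim_null_comparison[OF _ lim2] always_eventually allI)
      qed
      have "(\<lambda>i. u i t) \<longlonglongrightarrow> f t"
      proof (cases "f t = 0")
        case True
        hence "u i t = 0" for i by (auto simp: u_def)
        thus ?thesis using True by simp
      next
        case False
        have "\<forall>\<^sub>F i in sequentially. norm (r (s i t)) < 2 * norm (f t)"
          using False by (intro order_tendstoD(2)[OF tendsto_norm[OF rlim]]) simp
        hence "\<forall>\<^sub>F i in sequentially. r (s i t) = u i t"
          by eventually_elim (simp add: u_def)
        thus ?thesis by (rule Lim_transform_eventually[OF rlim])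
      qed
      hence "(\<lambda>i. ennreal ((norm (f t - u i t))\<^sup>2)) \<longlonglongrightarrow> ennreal ((norm (f t - f t))\<^sup>2)"
        by (intro tendsto_intros)
      thus ?case by simp
    qed
  qed auto
  hence lim0: "(\<lambda>i. sq_norm M (\<lambda>t. f t - u i t)) \<longlonglongrightarrow> 0" by simp
  fix \<epsilon> :: real assume "0 < \<epsilon>"
  hence "\<forall>\<^sub>F i in sequentially. sq_norm M (\<lambda>t. f t - u i t) < ennreal \<epsilon>"
    by (intro order_tendstoD(2)[OF lim0]) simp
  then obtain i where "sq_norm M (\<lambda>t. f t - u i t) < ennreal \<epsilon>"
    by (auto simp: eventually_sequentially)
  moreover have "approximable G (u i)"
    using r(1) G by (intro approximable_simple u u_fin) (auto simp: u_def)
  ultimately show "\<exists>g. approximable G g \<and> sq_norm M (\<lambda>t. f t - g t) \<le> ennreal \<epsilon>"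
    by (intro exI[of _ "u i"]) simp
qed

end

section \<open>Functions constant on dyadic cells; right-continuous functions\<close>

lemma nn_integral_idx:
  fixes g :: "nat \<Rightarrow> ennreal"
  shows "(\<integral>\<^sup>+t. g (idx k t) \<partial>half_line) = (\<Sum>n. g n * ennreal (1 / 2 ^ k))"
proof -
  define C where "C n = {t::real. 0 < t \<and> idx k t = n}" for n
  have C_eq: "C n = {0<..} \<inter> {real n / 2 ^ k..<(real n + 1) / 2 ^ k}" for n
  proof -
    have "idx k t = n \<longleftrightarrow> real n / 2 ^ k \<le> t \<and> t < (real n + 1) / 2 ^ k" if "0 < t" for t
      using that idx_le_iff[of t n k] idx_le_iff[of t "Suc n" k] by (auto simp: add.commute not_le[symmetric])
    thus ?thesis by (intro set_eqI) (simp only: C_def mem_Collect_eq Int_iff greaterThan_iff atLeastLessThan_iff cong: conj_cong)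
  qed
  have C_sets: "C n \<in> sets half_line" for n
    by (auto simp: sets_half_line C_eq)
  have C_emeasure: "emeasure half_line (C n) = ennreal (1 / 2 ^ k)" for n
  proof -
    have len: "(real n + 1) / 2 ^ k - real n / 2 ^ k = 1 / 2 ^ k" by (simp add: add_divide_distrib)
    have "emeasure half_line (C n) = emeasure lebesgue (C n)"
      unfolding half_line_def by (intro emeasure_restrict_space) (auto simp: C_eq)
    also have "\<dots> = emeasure lborel (C n)" by (simp add: C_eq)
    also have "\<dots> = ennreal (1 / 2 ^ k)"
    \<comment> \<open>The half-line is open at 0, so cell 0 lacks its left endpoint.\<close>
    proof (cases "n = 0")
      case True
      hence "C n = {0<..<1 / 2 ^ k}" by (auto simp: C_eq)
      thus ?thesis by simp
    next
      case False
      have "C n = {real n / 2 ^ k..<(real n + 1) / 2 ^ k}"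
      proof -
        have "0 < real n / 2 ^ k" using False by simp
        thus ?thesis by (auto simp: C_eq)
      qed
      moreover have "real n / 2 ^ k \<le> (real n + 1) / 2 ^ k" by (simp add: divide_right_mono)
      ultimately show ?thesis using len by simp
    qed
    finally show ?thesis .
  qed
  have "(\<integral>\<^sup>+t. g (idx k t) \<partial>half_line) = (\<integral>\<^sup>+t. (\<Sum>n. g n * indicator (C n) t) \<partial>half_line)"
  proof (intro nn_integral_cong)
    fix t assume "t \<in> space half_line"
    hence mem: "t \<in> C n \<longleftrightarrow> n = idx k t" for n by (auto simp: C_def)
    have "(\<Sum>n. g n * indicator (C n) t) = (\<Sum>n\<in>{idx k t}. g n * indicator (C n) t)"
      by (intro suminf_finite) (auto simp: mem)
    also have "\<dots> = g (idx k t)" by (simp add: mem)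
    finally show "g (idx k t) = (\<Sum>n. g n * indicator (C n) t)" by (rule sym)
  qed
  also have "\<dots> = (\<Sum>n. \<integral>\<^sup>+t. g n * indicator (C n) t \<partial>half_line)"
    using C_sets by (intro nn_integral_suminf borel_measurable_times_ennreal borel_measurable_indicator) auto
  also have "\<dots> = (\<Sum>n. g n * ennreal (1 / 2 ^ k))"
    using C_sets by (simp add: nn_integral_cmult_indicator C_emeasure)
  finally show ?thesis .
qed

text \<open>Samples at the right ends of the cells are taken at times above t that tend to t. Only 4
  ^ i cells are kept, so that the range is finite.\<close>

lemma strongly_measurable_right_continuous:
  fixes g :: "real \<Rightarrow> 'b::real_normed_vector"
  assumes "\<And>t. 0 < t \<Longrightarrow> (g \<longlongrightarrow> g t) (at_right t)"
  shows "strongly_measurable half_line g"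
  unfolding strongly_measurable_def
proof (intro exI conjI allI)
  let ?v = "\<lambda>i n. if n < 4 ^ i then g ((real n + 1) / 2 ^ i) else 0"
  show "simple_function half_line (\<lambda>t. ?v i (idx i t))" for i
  proof (intro simple_function_idx idx_measurable)
    have "?v i ` idx i ` space half_line \<subseteq> insert 0 ((\<lambda>n. g ((real n + 1) / 2 ^ i)) ` {..<4 ^ i})"
      by auto
    thus "finite (?v i ` idx i ` space half_line)" by (rule finite_subset) auto
  qed
  show "AE t in half_line. (\<lambda>i. ?v i (idx i t)) \<longlonglongrightarrow> g t"
  proof (intro AE_I2)
    fix t assume "t \<in> space half_line"
    hence t: "0 < t" by simp
    define u where "u i = (real (idx i t) + 1) / 2 ^ i" for i
    have u: "t < u i" "u i \<le> t + (1 / 2) ^ i" for i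
      using idx_bounds[of t i] t by (auto simp: u_def add_divide_distrib power_divide)
    have "u \<longlonglongrightarrow> t"
    proof (rule tendsto_sandwich)
      show "\<forall>\<^sub>F i in sequentially. t \<le> u i" "\<forall>\<^sub>F i in sequentially. u i \<le> t + (1 / 2) ^ i"
        using u by (auto intro: always_eventually less_imp_le)
      show "(\<lambda>i. t + (1 / 2) ^ i) \<longlonglongrightarrow> t" by (intro tendsto_eq_intros LIMSEQ_power_zero) auto
    qed auto
    moreover have "u i \<noteq> t" for i using u(1)[of i] by simp
    ultimately have "filterlim u (at_right t) sequentially"
      using u(1) by (simp add: filterlim_at)
    hence "(\<lambda>i. g (u i)) \<longlonglongrightarrow> g t" using assms[OF t] by (rule filterlim_compose[rotated])
    moreover obtain i0 where i0: "t < 2 ^ i0" using real_arch_pow[of 2 t] by auto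
    have "\<forall>\<^sub>F i in sequentially. g (u i) = ?v i (idx i t)"
      using eventually_ge_at_top[of i0]
    proof eventually_elim
      case (elim i)
      have "(2::real) ^ i0 \<le> 2 ^ i" using elim by (intro power_increasing) auto
      hence "idx i t < 4 ^ i" using i0 by (intro idx_less) linarith
      thus ?case by (simp add: u_def)
    qed
    ultimately show "(\<lambda>i. ?v i (idx i t)) \<longlonglongrightarrow> g t" by (rule Lim_transform_eventually)
  qed
qed

section \<open>The maximal regularity operator on step functions\<close>

context regular_semigroup
begin

lemma sum: "0 \<le> t \<Longrightarrow> T t (\<Sum>i\<in>I. f i) = (\<Sum>i\<in>I. T t (f i))"
  by (induction I rule: infinite_finite_induct) (auto simp: add)

text \<open>The modulus is uniform in a because T b x - T a x = T a (T (b - a) x - x) and T a is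
  bounded by K.\<close>

lemma orbit_modulus:
  assumes "0 < \<epsilon>"
  shows "\<exists>d>0. \<forall>a b. 0 \<le> a \<and> a \<le> b \<and> b < a + d \<longrightarrow> norm (T b x - T a x) < \<epsilon>"
proof -
  have K: "0 < K" using K_ge_1 by simp
  have "\<forall>\<^sub>F t in at_right 0. dist (T t x) x < \<epsilon> / K"
    using assms K by (intro tendstoD[OF tendsto_zero]) auto
  then obtain d where d: "0 < d" "\<And>t. 0 < t \<Longrightarrow> t < d \<Longrightarrow> norm (T t x - x) < \<epsilon> / K"
    by (auto simp: eventually_at_right_field dist_norm)
  have "norm (T b x - T a x) < \<epsilon>" if "0 \<le> a" "a \<le> b" "b < a + d" for a b
  proof (cases "a = b")
    case False
    have "T b x - T a x = T a (T (b - a) x - x)"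
      using that add_time[of a "b - a" x] by (simp add: diff)
    also have "norm \<dots> \<le> K * norm (T (b - a) x - x)" using that by (intro bound)
    also have "\<dots> < K * (\<epsilon> / K)" using that False K by (intro mult_strict_left_mono d) auto
    finally show ?thesis using K by simp
  qed (use assms in simp)
  thus ?thesis using d(1) by blast
qed

text \<open>\<open>A exp (- (t - s) A) x\<close> is the derivative of \<open>exp (- (t - s) A) x\<close> in \<open>s\<close>, so on a step function
  the integral over \<open>s < t\<close> telescopes; cutting off at \<open>0\<close> turns the cells beyond \<open>t\<close> into zero terms.
  No value needs to lie in the domain of \<open>A\<close>.\<close>

definition step_regularity :: "nat \<Rightarrow> (real \<Rightarrow> 'h) \<Rightarrow> real \<Rightarrow> 'h" where
  "step_regularity k \<phi> t =
     (\<Sum>j<4 ^ k. T (max 0 (t - real (Suc j) / 2 ^ k)) (\<phi> (real j / 2 ^ k))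
               - T (max 0 (t - real j / 2 ^ k)) (\<phi> (real j / 2 ^ k)))"

lemma step_regularity_add_scaleC:
  "step_regularity k (\<lambda>t. \<phi> t + c *\<^sub>C \<psi> t) t = step_regularity k \<phi> t + c *\<^sub>C step_regularity k \<psi> t"
  by (simp add: step_regularity_def add scale scaleC_sum_right scaleC_diff_right sum.distrib[symmetric]
      algebra_simps del: of_nat_Suc)

text \<open>The two halves of a cell carry the same value, so their differences telescope.
  Independence of the level allows steps of different levels to be combined.\<close>

lemma step_regularity_Suc:
  assumes \<phi>: "dyadic_step k \<phi>"
  shows "step_regularity (Suc k) \<phi> t = step_regularity k \<phi> t"
proof -
  define F where "F c x = T (max 0 (t - c)) x" for c x
  have half: "\<phi> (real (2 * i) / 2 ^ Suc k) = \<phi> (real i / 2 ^ k)"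
    "\<phi> (real (Suc (2 * i)) / 2 ^ Suc k) = \<phi> (real i / 2 ^ k)" for i
  proof -
    show "\<phi> (real (2 * i) / 2 ^ Suc k) = \<phi> (real i / 2 ^ k)" by simp
    have "idx k (real (Suc (2 * i)) / 2 ^ Suc k) = Suc (2 * i) div 2"
      using idx_eq_div[of k "Suc k" "real (Suc (2 * i)) / 2 ^ Suc k"] by (simp only: idx_grid) simp
    thus "\<phi> (real (Suc (2 * i)) / 2 ^ Suc k) = \<phi> (real i / 2 ^ k)"
      using dyadic_step_eq[OF \<phi>, of "real (Suc (2 * i)) / 2 ^ Suc k"] by simp
  qed
  let ?f = "\<lambda>j. F (real (Suc j) / 2 ^ Suc k) (\<phi> (real j / 2 ^ Suc k)) - F (real j / 2 ^ Suc k) (\<phi> (real j / 2 ^ Suc k))"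
  let ?g = "\<lambda>i. F (real (Suc i) / 2 ^ k) (\<phi> (real i / 2 ^ k)) - F (real i / 2 ^ k) (\<phi> (real i / 2 ^ k))"
  have pair: "?f (2 * i) + ?f (Suc (2 * i)) = ?g i" for i
  proof -
    have "real (Suc (Suc (2 * i))) / 2 ^ Suc k = real (Suc i) / 2 ^ k"
      "real (2 * i) / 2 ^ Suc k = real i / 2 ^ k" by (simp_all add: field_simps)
    thus ?thesis unfolding half by (simp del: of_nat_Suc)
  qed
  have group: "(\<Sum>j<2 * n. ?f j) = (\<Sum>i<n. ?g i)" for n
  proof (induction n)
    case (Suc n)
    have "(\<Sum>j<2 * Suc n. ?f j) = (\<Sum>j<2 * n. ?f j) + (?f (2 * n) + ?f (Suc (2 * n)))"
      by (simp only: mult_Suc_right add_2_eq_Suc sum.lessThan_Suc add.assoc)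
    thus ?case unfolding pair Suc by simp
  qed simp
  \<comment> \<open>The 4 ^ Suc k fine cells merge into 2 * 4 ^ k coarse ones, twice as many as
    level k sums over; the excess lies beyond 2 ^ k, where the step vanishes.\<close>
  have "step_regularity (Suc k) \<phi> t = (\<Sum>j<2 * (2 * 4 ^ k). ?f j)"
    by (simp add: step_regularity_def F_def)
  also have "\<dots> = (\<Sum>i<2 * 4 ^ k. ?g i)" by (rule group)
  also have "\<dots> = (\<Sum>i<4 ^ k. ?g i)"
  proof (rule sum.mono_neutral_right)
    show "\<forall>i\<in>{..<2 * 4 ^ k} - {..<4 ^ k}. ?g i = 0"
      using dyadic_step_grid_eq_0[OF \<phi>] by (auto simp: F_def not_less)
  qed auto
  finally show ?thesis by (simp add: step_regularity_def F_def)
qed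

lemma step_regularity_mono:
  assumes "dyadic_step k \<phi>" "k \<le> l"
  shows "step_regularity l \<phi> t = step_regularity k \<phi> t"
  using assms(2)
proof (induction l rule: dec_induct)
  case (step n)
  thus ?case using step_regularity_Suc[OF dyadic_step_mono[OF assms(1)]] by simp
qed simp

lemma strongly_measurable_step_regularity: "strongly_measurable half_line (step_regularity k \<phi>)"
proof (rule strongly_measurable_right_continuous)
  fix t :: real
  have "((\<lambda>s. T (max 0 (s - c)) x) \<longlongrightarrow> T (max 0 (t - c)) x) (at_right t)" for c x
  proof (rule tendstoI)
    fix e :: real assume "0 < e"
    then obtain d where d: "0 < d"
      "\<And>a b. 0 \<le> a \<Longrightarrow> a \<le> b \<Longrightarrow> b < a + d \<Longrightarrow> norm (T b x - T a x) < e"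
      using orbit_modulus by meson
    have "\<forall>s>t. s < t + d \<longrightarrow> dist (T (max 0 (s - c)) x) (T (max 0 (t - c)) x) < e"
      unfolding dist_norm by (intro allI impI d(2)) auto
    thus "\<forall>\<^sub>F s in at_right t. dist (T (max 0 (s - c)) x) (T (max 0 (t - c)) x) < e"
      using d(1) unfolding eventually_at_right_field by (intro exI[of _ "t + d"]) auto
  qed
  thus "(step_regularity k \<phi> \<longlongrightarrow> step_regularity k \<phi> t) (at_right t)"
    unfolding step_regularity_def[abs_def] by (intro tendsto_sum tendsto_diff)
qed

text \<open>For t in cell n the elapsed times to earlier grid points share the part t - n h; pulling
  it out by the semigroup law leaves a convolution on the grid. The cell containing t is integrated
  only up to t and gives the last term.\<close>

lemma step_regularity_eq:
  fixes k
  assumes \<phi>: "dyadic_step k \<phi>" and t: "0 < t"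
  defines "h \<equiv> 1 / 2 ^ k" and "x \<equiv> \<lambda>j. \<phi> (real j / 2 ^ k)" and "n \<equiv> idx k t"
  shows "step_regularity k \<phi> t
    = T (t - real n * h) (\<Sum>j<n. T (real (n - 1 - j) * h) (x j) - T (real (Suc (n - 1 - j)) * h) (x j))
      + (x n - T (t - real n * h) (x n))"
proof -
  let ?F = "\<lambda>j. T (max 0 (t - real (Suc j) / 2 ^ k)) (x j) - T (max 0 (t - real j / 2 ^ k)) (x j)"
  have nt: "real n * h \<le> t" "t < real (Suc n) * h"
    using idx_bounds[of t k] t by (auto simp: n_def h_def add.commute)
  have h: "h > 0" by (simp add: h_def)
  have div_h: "real j / 2 ^ k = real j * h" for j by (simp add: h_def)
  \<comment> \<open>Either of 4 ^ k and n + 1 may be the larger, so the sum is first lengthened and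
    then cut. The added terms have value 0, the removed ones lie in cells after t.\<close>
  define N where "N = max (4 ^ k) (Suc n)"
  have "step_regularity k \<phi> t = (\<Sum>j<4 ^ k. ?F j)" by (simp add: step_regularity_def x_def)
  also have "\<dots> = (\<Sum>j<N. ?F j)"
  proof (rule sum.mono_neutral_left)
    show "\<forall>j\<in>{..<N} - {..<4 ^ k}. ?F j = 0"
      using dyadic_step_grid_eq_0[OF \<phi>] by (auto simp: x_def not_less)
  qed (auto simp: N_def)
  also have "\<dots> = (\<Sum>j<Suc n. ?F j)"
  proof (rule sum.mono_neutral_right)
    show "\<forall>j\<in>{..<N} - {..<Suc n}. ?F j = 0"
    proof
      fix j assume "j \<in> {..<N} - {..<Suc n}"
      hence "real (Suc n) * h \<le> real j * h" "real (Suc n) * h \<le> real (Suc j) * h"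
        using h by (auto intro!: mult_right_mono)
      thus "?F j = 0" using nt(2) unfolding div_h by simp
    qed
  qed (auto simp: N_def)
  also have "\<dots> = (\<Sum>j<n. ?F j) + ?F n" by simp
  also have "?F n = x n - T (t - real n * h) (x n)"
    using nt unfolding div_h by simp
  also have "(\<Sum>j<n. ?F j)
    = T (t - real n * h) (\<Sum>j<n. T (real (n - 1 - j) * h) (x j) - T (real (Suc (n - 1 - j)) * h) (x j))"
  proof -
    have "?F j = T (t - real n * h) (T (real (n - 1 - j) * h) (x j) - T (real (Suc (n - 1 - j)) * h) (x j))"
      if j: "j < n" for j
    proof -
      have e: "t - real (Suc j) * h = (t - real n * h) + real (n - 1 - j) * h"
        "t - real j * h = (t - real n * h) + real (Suc (n - 1 - j)) * h"
        using j by (auto simp: of_nat_diff algebra_simps)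
      have pos: "0 \<le> t - real n * h" "0 \<le> real (n - 1 - j) * h" "0 \<le> real (Suc (n - 1 - j)) * h"
        using nt h by auto
      have m: "max 0 (t - real (Suc j) * h) = (t - real n * h) + real (n - 1 - j) * h"
        "max 0 (t - real j * h) = (t - real n * h) + real (Suc (n - 1 - j)) * h"
        unfolding e using pos by (auto simp del: of_nat_Suc)
      show ?thesis unfolding div_h m add_time[OF pos(1,2)] add_time[OF pos(1,3)] diff[OF pos(1)] ..
    qed
    thus ?thesis using nt by (simp add: sum del: of_nat_Suc)
  qed
  finally show ?thesis .
qed

end

text \<open>A cell of index n \<ge> 1 lies between n h and 2 n h, so the weight can be frozen at its
  left end at the cost of this factor.\<close>

lemma powr_comparable:
  fixes a t \<beta> :: real
  assumes "0 < a" "a \<le> t" "t \<le> 2 * a"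
  shows "t powr \<beta> \<le> 2 powr \<bar>\<beta>\<bar> * a powr \<beta>" "a powr \<beta> \<le> 2 powr \<bar>\<beta>\<bar> * t powr \<beta>"
proof -
  have one: "1 \<le> (2::real) powr \<bar>\<beta>\<bar>" by (simp add: ge_one_powr_ge_zero)
  have "t powr \<beta> \<le> 2 powr \<bar>\<beta>\<bar> * a powr \<beta> \<and> a powr \<beta> \<le> 2 powr \<bar>\<beta>\<bar> * t powr \<beta>"
  proof (cases "0 \<le> \<beta>")
    case True
    have "t powr \<beta> \<le> (2 * a) powr \<beta>" using assms True by (intro powr_mono2) auto
    moreover have "a powr \<beta> \<le> t powr \<beta>" using assms True by (intro powr_mono2) auto
    moreover have "1 * t powr \<beta> \<le> 2 powr \<bar>\<beta>\<bar> * t powr \<beta>" using one by (intro mult_right_mono) auto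
    moreover have "(2 * a) powr \<beta> = 2 powr \<bar>\<beta>\<bar> * a powr \<beta>" using assms True by (simp add: powr_mult)
    ultimately show ?thesis by linarith
  next
    case False
    have "t powr \<beta> \<le> a powr \<beta>" using assms False by (intro powr_mono2') auto
    moreover have "(2 * a) powr \<beta> \<le> t powr \<beta>" using assms False by (intro powr_mono2') auto
    hence "2 powr \<bar>\<beta>\<bar> * (2 powr \<beta> * a powr \<beta>) \<le> 2 powr \<bar>\<beta>\<bar> * t powr \<beta>"
      using assms by (intro mult_left_mono) (auto simp: powr_mult)
    moreover have "2 powr \<bar>\<beta>\<bar> * (2 powr \<beta> * a powr \<beta>) = a powr \<beta>"
      using False by (simp add: mult.assoc[symmetric] powr_add[symmetric])
    moreover have "1 * a powr \<beta> \<le> 2 powr \<bar>\<beta>\<bar> * a powr \<beta>" using one by (intro mult_right_mono) auto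
    ultimately show ?thesis by linarith
  qed
  thus "t powr \<beta> \<le> 2 powr \<bar>\<beta>\<bar> * a powr \<beta>" "a powr \<beta> \<le> 2 powr \<bar>\<beta>\<bar> * t powr \<beta>" by auto
qed

lemma weightI:
  assumes "\<omega> \<in> borel_measurable borel" "\<And>t. 0 < t \<Longrightarrow> 0 < \<omega> t" "continuous_on {0<..} \<omega>"
  shows "weight \<omega>"
proof
  fix k
  have "{1 / 2 ^ k..2 ^ k :: real} \<subseteq> {0<..}"
  proof
    fix t :: real assume "t \<in> {1 / 2 ^ k..2 ^ k}"
    moreover have "0 < (1 / 2 ^ k :: real)" by simp
    ultimately show "t \<in> {0<..}" by (simp only: atLeastAtMost_iff greaterThan_iff) linarith
  qed
  hence "compact (\<omega> ` {1 / 2 ^ k..2 ^ k})"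
    using assms(3) by (intro compact_continuous_image) (auto intro: continuous_on_subset)
  hence "bounded (\<omega> ` {1 / 2 ^ k..2 ^ k})" by (rule compact_imp_bounded)
  then obtain B where "\<forall>y\<in>\<omega> ` {1 / 2 ^ k..2 ^ k}. norm y \<le> B" by (auto simp: bounded_iff)
  hence "\<omega> t \<le> B" if "1 / 2 ^ k \<le> t" "t \<le> 2 ^ k" for t
    using that by (fastforce simp: abs_le_iff)
  thus "\<exists>B. \<forall>t. 1 / 2 ^ k \<le> t \<and> t \<le> 2 ^ k \<longrightarrow> \<omega> t \<le> B" by blast
qed (use assms in auto)

section \<open>The weighted bound on step functions\<close>

locale weighted_semigroup = regular_semigroup +
  fixes \<beta> :: real
  assumes beta: "\<beta> < 1"

sublocale weighted_semigroup \<subseteq> weight "\<lambda>t. t powr \<beta>"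
  by (rule weightI) (auto intro!: continuous_intros)

context weighted_semigroup
begin

lemma M_eq: "M = weighted_half_line \<beta>"
  by (simp add: M_def weighted_half_line_def)

text \<open>4 powr |\<beta>| is the loss from freezing the weight, once for the output and once for
  the input. The numbers 2 and 8 = 2 * 2 ^ 2 arise from squaring the two terms of
  \<open>step_regularity_eq\<close>, bounded by K and 2 K. The exponent is halved because norms are
  squared.\<close>

definition step_const :: real where
  "step_const = 4 powr \<bar>\<beta>\<bar> * (2 * K\<^sup>2 * weighted_regularity_const (\<beta> / 2) regularity_const + 8 * K\<^sup>2)"

lemma step_const_nonneg: "0 \<le> step_const"
  by (auto simp: step_const_def weighted_regularity_const_def intro!: mult_nonneg_nonneg add_nonneg_nonneg)

lemma step_regularity_bound:
  assumes \<phi>: "dyadic_step k \<phi>"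
  shows "sq_norm M (step_regularity k \<phi>) \<le> ennreal step_const * sq_norm M \<phi>"
proof -
  define h where "h = (1::real) / 2 ^ k"
  have h: "h > 0" by (simp add: h_def)
  define x where "x j = \<phi> (real j / 2 ^ k)" for j
  define ker where "ker i v = T (real i * h) v - T (real (Suc i) * h) v" for i v
  define y where "y n = (\<Sum>j<n. ker (n - 1 - j) (x j))" for n
  define W where "W = weighted_regularity_const (\<beta> / 2) regularity_const"
  define P where "P = (2::real) powr \<bar>\<beta>\<bar>"
  have P: "P > 0" by (simp add: P_def)
  have W: "W \<ge> 0" by (auto simp: W_def weighted_regularity_const_def)
  have x0: "x 0 = 0" using dyadic_step_at_zero[OF \<phi>] by (simp add: x_def)
  \<comment> \<open>On cell n the weighted square of the output is at most g n and that of the input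
    at least q n; the theorem on sequences then compares g with q.\<close>
  define g where "g n = P * (real n * h) powr \<beta> * (2 * K\<^sup>2 * (norm (y n))\<^sup>2 + 8 * K\<^sup>2 * (norm (x n))\<^sup>2)" for n
  define q where "q n = (real n * h) powr \<beta> * (norm (x n))\<^sup>2 / P" for n
  have gq: "0 \<le> g n" "0 \<le> q n" for n using P by (auto simp: g_def q_def)
  have discrete: "(\<Sum>n<m. g n) \<le> step_const * (\<Sum>n<Suc m. q n)" for m
  proof -
    have sq: "(real n powr (\<beta> / 2) * r)\<^sup>2 = real n powr \<beta> * r\<^sup>2" for n :: nat and r :: real
      by (simp add: power_mult_distrib power2_eq_square powr_add[symmetric])
    have main: "(\<Sum>n=1..m. real n powr \<beta> * (norm (y n))\<^sup>2) \<le> W * (\<Sum>n=1..m. real n powr \<beta> * (norm (x n))\<^sup>2)"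
      unfolding W_def sq[symmetric] y_def
    proof (rule weighted_discrete_maximal_regularity)
      show "ker n (u + v) = ker n u + ker n v" "ker n (c *\<^sub>C v) = c *\<^sub>C ker n v" for n u v c
        using h by (auto simp: ker_def add scale scaleC_diff_right)
      show "norm (ker n v) \<le> regularity_const / (real n + 1) * norm v"
        "norm (ker n v - ker (Suc n) v) \<le> regularity_const / (real n + 1)\<^sup>2 * norm v"
        "norm (\<Sum>i<n. ker i v) \<le> regularity_const * norm v" for n v
        unfolding ker_def by (rule discrete_kernel_bounds[OF h])+
      show "\<beta> / 2 < 1 / 2" using beta by simp
    qed (rule regularity_const_nonneg x0)+
    have shift: "(\<Sum>n<Suc m. f n) = (\<Sum>n=1..m. f n)" if "f 0 = 0" for f :: "nat \<Rightarrow> real"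
      using that by (intro sum.mono_neutral_right) (auto simp: Suc_le_eq)
    have "(\<Sum>n<m. g n) \<le> (\<Sum>n<Suc m. g n)" using gq(1)[of m] by simp
    also have "\<dots> = (\<Sum>n=1..m. g n)" by (rule shift) (simp add: g_def x0 y_def)
    also have "\<dots> = P * h powr \<beta> * (2 * K\<^sup>2 * (\<Sum>n=1..m. real n powr \<beta> * (norm (y n))\<^sup>2)
        + 8 * K\<^sup>2 * (\<Sum>n=1..m. real n powr \<beta> * (norm (x n))\<^sup>2))"
      using h by (simp add: g_def powr_mult sum_distrib_left sum.distrib[symmetric] algebra_simps)
    also have "\<dots> \<le> P * h powr \<beta> * (2 * K\<^sup>2 * (W * (\<Sum>n=1..m. real n powr \<beta> * (norm (x n))\<^sup>2))
        + 8 * K\<^sup>2 * (\<Sum>n=1..m. real n powr \<beta> * (norm (x n))\<^sup>2))"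
      using P by (intro mult_left_mono add_right_mono main) auto
    also have "\<dots> = P * P * (2 * K\<^sup>2 * W + 8 * K\<^sup>2) * (\<Sum>n=1..m. q n)"
    proof -
      have "(\<Sum>n=1..m. q n) = h powr \<beta> * (\<Sum>n=1..m. real n powr \<beta> * (norm (x n))\<^sup>2) / P"
        using h by (simp add: q_def powr_mult sum_distrib_left sum_divide_distrib mult_ac)
      thus ?thesis using P by (simp add: distrib_left distrib_right mult_ac)
    qed
    also have "P * P = 4 powr \<bar>\<beta>\<bar>" by (simp add: P_def powr_mult[symmetric])
    also have "(\<Sum>n=1..m. q n) = (\<Sum>n<Suc m. q n)" by (rule shift[symmetric]) (simp add: q_def x0)
    finally show ?thesis by (simp add: step_const_def W_def)
  qed
  have cell: "0 < real (idx k t) * h" "real (idx k t) * h \<le> t" "t \<le> 2 * (real (idx k t) * h)"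
    if "0 < t" "idx k t \<noteq> 0" for t
  proof -
    show "0 < real (idx k t) * h" using that h by simp
    show "real (idx k t) * h \<le> t" using idx_bounds(1)[of t k] that by (simp add: h_def)
    have "t \<le> (real (idx k t) + 1) * h" using idx_bounds(2)[of t k] that by (simp add: h_def)
    also have "\<dots> \<le> (2 * real (idx k t)) * h" using that h by (intro mult_right_mono) auto
    finally show "t \<le> 2 * (real (idx k t) * h)" by simp
  qed
  have upper: "t powr \<beta> * (norm (step_regularity k \<phi> t))\<^sup>2 \<le> g (idx k t)" if t: "0 < t" for t
  proof -
    let ?n = "idx k t"
    have rep: "step_regularity k \<phi> t = T (t - real ?n * h) (y ?n) + (x ?n - T (t - real ?n * h) (x ?n))"
      using step_regularity_eq[OF \<phi> t] by (simp add: h_def x_def y_def ker_def)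
    show ?thesis
    proof (cases "?n = 0")
      \<comment> \<open>The weight is not comparable to a constant on cell 0, but the step vanishes
        there and so does the output.\<close>
      case True
      hence "step_regularity k \<phi> t = 0" unfolding rep using t by (simp add: y_def x0)
      thus ?thesis using gq by simp
    next
      case False
      have pos: "0 \<le> t - real ?n * h" using cell[OF t False] by simp
      have "norm (step_regularity k \<phi> t) \<le> norm (T (t - real ?n * h) (y ?n)) + norm (x ?n - T (t - real ?n * h) (x ?n))"
        unfolding rep by (rule norm_triangle_ineq)
      also have "\<dots> \<le> K * norm (y ?n) + 2 * K * norm (x ?n)"
        using bound[OF pos, of "y ?n"] bound[OF pos, of "x ?n"] K_ge_1 mult_right_mono[OF K_ge_1, of "norm (x ?n)"]
          norm_triangle_ineq4[of "x ?n" "T (t - real ?n * h) (x ?n)"] by simp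
      finally have "(norm (step_regularity k \<phi> t))\<^sup>2 \<le> (K * norm (y ?n) + 2 * K * norm (x ?n))\<^sup>2"
        by (intro power_mono) auto
      also have "\<dots> \<le> 2 * (K * norm (y ?n))\<^sup>2 + 2 * (2 * K * norm (x ?n))\<^sup>2"
        using sum_squares_bound[of "K * norm (y ?n)" "2 * K * norm (x ?n)"] by (simp only: power2_sum)
      also have "\<dots> = 2 * K\<^sup>2 * (norm (y ?n))\<^sup>2 + 8 * K\<^sup>2 * (norm (x ?n))\<^sup>2"
        by (simp add: power_mult_distrib)
      finally show ?thesis unfolding g_def P_def
        by (intro mult_mono powr_comparable(1) cell t False) auto
    qed
  qed
  have lower: "q (idx k t) \<le> t powr \<beta> * (norm (\<phi> t))\<^sup>2" if t: "0 < t" for t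
  proof (cases "idx k t = 0")
    case False
    have "x (idx k t) = \<phi> t" using dyadic_step_eq[OF \<phi>, of t] by (simp add: x_def)
    moreover have "(real (idx k t) * h) powr \<beta> * (norm (\<phi> t))\<^sup>2 \<le> (P * t powr \<beta>) * (norm (\<phi> t))\<^sup>2"
      unfolding P_def by (intro mult_right_mono powr_comparable(2) cell t False) auto
    ultimately show ?thesis using P by (simp add: q_def divide_le_eq mult_ac)
  qed (simp add: q_def x0)
  have sm: "strongly_measurable M (step_regularity k \<phi>)"
    by (simp add: strongly_measurable_M strongly_measurable_step_regularity)
  have nn: "sq_norm M f = (\<integral>\<^sup>+t. ennreal (t powr \<beta> * (norm (f t))\<^sup>2) \<partial>half_line)"
    if "strongly_measurable M f" for f :: "real \<Rightarrow> 'a"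
  proof -
    have [measurable]: "(\<lambda>t. norm (f t)) \<in> borel_measurable half_line"
      using that by (simp add: borel_measurable_norm_strongly_measurable strongly_measurable_M)
    show ?thesis unfolding sq_norm_def
      by (subst nn_integral_M) (auto simp: ennreal_mult)
  qed
  have "sq_norm M (step_regularity k \<phi>) \<le> (\<integral>\<^sup>+t. ennreal (g (idx k t)) \<partial>half_line)"
    unfolding nn[OF sm] by (intro nn_integral_mono ennreal_leI upper) simp
  also have "\<dots> = (\<Sum>n. ennreal (g n) * ennreal h)" unfolding h_def by (rule nn_integral_idx)
  also have "\<dots> \<le> ennreal step_const * (\<Sum>n. ennreal (q n) * ennreal h)"
  proof (rule suminf_le_const)
    fix m
    have "(\<Sum>n<m. ennreal (g n) * ennreal h) = ennreal ((\<Sum>n<m. g n) * h)"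
      using gq h by (simp add: ennreal_mult[symmetric] sum_distrib_right sum_nonneg sum_ennreal)
    also have "\<dots> \<le> ennreal ((step_const * (\<Sum>n<Suc m. q n)) * h)"
      using h by (intro ennreal_leI mult_right_mono discrete) auto
    also have "\<dots> = ennreal step_const * ennreal (\<Sum>n<Suc m. q n * h)"
      using step_const_nonneg h by (subst ennreal_mult[symmetric])
        (auto simp: sum_distrib_right mult.assoc simp del: sum.lessThan_Suc intro!: sum_nonneg gq mult_nonneg_nonneg)
    also have "ennreal (\<Sum>n<Suc m. q n * h) = (\<Sum>n<Suc m. ennreal (q n) * ennreal h)"
      using gq h by (subst sum_ennreal[symmetric]) (auto simp: ennreal_mult)
    also have "\<dots> \<le> (\<Sum>n. ennreal (q n) * ennreal h)" by (intro sum_le_suminf summableI) auto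
    finally show "(\<Sum>n<m. ennreal (g n) * ennreal h) \<le> ennreal step_const * (\<Sum>n. ennreal (q n) * ennreal h)"
      by (simp add: mult_left_mono)
  qed (rule summableI)
  also have "(\<Sum>n. ennreal (q n) * ennreal h) = (\<integral>\<^sup>+t. ennreal (q (idx k t)) \<partial>half_line)"
    unfolding h_def by (rule nn_integral_idx[symmetric])
  also have "\<dots> \<le> sq_norm M \<phi>"
    unfolding nn[OF strongly_measurable_dyadic_step[OF \<phi>]]
    by (intro nn_integral_mono ennreal_leI lower) simp
  finally show ?thesis by (simp add: mult_left_mono)
qed

end

section \<open>The bounded extension\<close>

lemma ennreal_le_of_le_add:
  fixes a b :: ennreal and c :: real
  assumes "\<And>\<epsilon>. 0 < \<epsilon> \<Longrightarrow> a \<le> b + ennreal (c * \<epsilon>)" "0 \<le> c"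
  shows "a \<le> b"
proof (cases "c = 0")
  case True
  thus ?thesis using assms(1)[of 1] by simp
next
  case False
  hence c: "0 < c" using assms(2) by simp
  show ?thesis
  proof (rule ennreal_le_epsilon)
    fix e :: real assume "0 < e"
    thus "a \<le> b + ennreal e" using assms(1)[of "e / c"] c by simp
  qed
qed

context weighted_semigroup
begin

text \<open>The closure of the graph of the step operator in L2 x L2. Boundedness makes it single
  valued up to null sets, completeness makes it defined on all of L2.\<close>

definition regularity_rel :: "(real \<Rightarrow> 'a) \<Rightarrow> (real \<Rightarrow> 'a) \<Rightarrow> bool" where
  "regularity_rel f g \<longleftrightarrow> strongly_measurable M f \<and> strongly_measurable M g \<and>
     (\<forall>\<epsilon>>0. \<exists>k \<phi>. dyadic_step k \<phi> \<and> sq_norm M (\<lambda>t. f t - \<phi> t) \<le> ennreal \<epsilon> \<and>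
        sq_norm M (\<lambda>t. g t - step_regularity k \<phi> t) \<le> ennreal \<epsilon>)"

lemma strongly_measurable_step: "strongly_measurable M (step_regularity k \<phi>)"
  by (simp add: strongly_measurable_M strongly_measurable_step_regularity)

lemma regularity_relD:
  assumes "regularity_rel f g" "0 < \<epsilon>"
  obtains k \<phi> where "dyadic_step k \<phi>" "sq_norm M (\<lambda>t. f t - \<phi> t) \<le> ennreal \<epsilon>"
    "sq_norm M (\<lambda>t. g t - step_regularity k \<phi> t) \<le> ennreal \<epsilon>"
  using assms unfolding regularity_rel_def by blast

lemma regularity_rel_step:
  assumes "dyadic_step k \<phi>"
  shows "regularity_rel \<phi> (step_regularity k \<phi>)"
  unfolding regularity_rel_def
proof (intro conjI allI impI)
  fix \<epsilon> :: real assume "0 < \<epsilon>"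
  show "\<exists>l \<psi>. dyadic_step l \<psi> \<and> sq_norm M (\<lambda>t. \<phi> t - \<psi> t) \<le> ennreal \<epsilon> \<and>
      sq_norm M (\<lambda>t. step_regularity k \<phi> t - step_regularity l \<psi> t) \<le> ennreal \<epsilon>"
    by (intro exI[of _ k] exI[of _ \<phi>]) (simp add: assms)
qed (simp_all add: strongly_measurable_dyadic_step[OF assms] strongly_measurable_step)

text \<open>The factor 4 reflects two uses of the factor-two triangle inequality: from g to the
  output of the step, and from the step to f.\<close>

lemma regularity_rel_bound:
  assumes "regularity_rel f g"
  shows "sq_norm M g \<le> ennreal (4 * step_const) * sq_norm M f"
proof (rule ennreal_le_of_le_add)
  have sm: "strongly_measurable M f" "strongly_measurable M g"
    using assms by (auto simp: regularity_rel_def)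
  show "0 \<le> 2 + 4 * step_const" using step_const_nonneg by simp
  fix \<epsilon> :: real assume \<epsilon>: "0 < \<epsilon>"
  obtain k \<phi> where \<phi>: "dyadic_step k \<phi>" "sq_norm M (\<lambda>t. f t - \<phi> t) \<le> ennreal \<epsilon>"
    "sq_norm M (\<lambda>t. g t - step_regularity k \<phi> t) \<le> ennreal \<epsilon>"
    using regularity_relD[OF assms \<epsilon>] .
  have sm\<phi>: "strongly_measurable M \<phi>" by (rule strongly_measurable_dyadic_step[OF \<phi>(1)])
  have c: "ennreal (2::real) = 2" "ennreal (4::real) = 4" by simp_all
  have "sq_norm M \<phi> \<le> 2 * sq_norm M (\<lambda>t. \<phi> t - f t) + 2 * sq_norm M (\<lambda>t. f t - 0)"
    using sq_norm_triangle[OF sm\<phi> sm(1) strongly_measurable_const[of M 0]] by simp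
  also have "\<dots> \<le> 2 * ennreal \<epsilon> + 2 * sq_norm M f"
    using \<phi>(2) by (intro add_mono mult_left_mono) (auto simp: sq_norm_minus_commute[of M \<phi>])
  finally have 1: "sq_norm M \<phi> \<le> 2 * ennreal \<epsilon> + 2 * sq_norm M f" .
  have "sq_norm M g \<le> 2 * sq_norm M (\<lambda>t. g t - step_regularity k \<phi> t) + 2 * sq_norm M (\<lambda>t. step_regularity k \<phi> t - 0)"
    using sq_norm_triangle[OF sm(2) strongly_measurable_step strongly_measurable_const[of M 0]] by simp
  also have "\<dots> \<le> 2 * ennreal \<epsilon> + 2 * (ennreal step_const * sq_norm M \<phi>)"
    using \<phi>(3) step_regularity_bound[OF \<phi>(1)] by (intro add_mono mult_left_mono) auto
  also have "\<dots> \<le> 2 * ennreal \<epsilon> + 2 * (ennreal step_const * (2 * ennreal \<epsilon> + 2 * sq_norm M f))"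
    by (intro add_mono mult_left_mono 1 order_refl) auto
  also have "\<dots> = ennreal (4 * step_const) * sq_norm M f + (ennreal 2 * ennreal \<epsilon> + ennreal 4 * (ennreal step_const * ennreal \<epsilon>))"
    using step_const_nonneg by (simp add: ennreal_mult c algebra_simps)
  also have "ennreal 2 * ennreal \<epsilon> + ennreal 4 * (ennreal step_const * ennreal \<epsilon>) = ennreal ((2 + 4 * step_const) * \<epsilon>)"
    using step_const_nonneg \<epsilon> unfolding distrib_right
    by (subst ennreal_plus) (auto simp: ennreal_mult mult.assoc)
  finally show "sq_norm M g \<le> ennreal (4 * step_const) * sq_norm M f + ennreal ((2 + 4 * step_const) * \<epsilon>)" .
qed

lemma sq_norm_scaleC:
  assumes "strongly_measurable M f"
  shows "sq_norm M (\<lambda>t. c *\<^sub>C f t) = ennreal ((cmod c)\<^sup>2) * sq_norm M f"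
proof -
  have "sq_norm M (\<lambda>t. c *\<^sub>C f t) = (\<integral>\<^sup>+t. ennreal ((cmod c)\<^sup>2) * ennreal ((norm (f t))\<^sup>2) \<partial>M)"
    unfolding sq_norm_def by (simp add: norm_scaleC power_mult_distrib ennreal_mult)
  also have "\<dots> = ennreal ((cmod c)\<^sup>2) * sq_norm M f"
    unfolding sq_norm_def by (rule nn_integral_cmult) (use borel_measurable_norm[OF assms] in measurable)
  finally show ?thesis .
qed

lemma sq_norm_add_scaleC_le:
  assumes f: "strongly_measurable M f" and f': "strongly_measurable M f'"
    and le: "sq_norm M f \<le> ennreal \<epsilon>" "sq_norm M f' \<le> ennreal \<epsilon>" and "0 \<le> \<epsilon>"
  shows "sq_norm M (\<lambda>t. f t + c *\<^sub>C f' t) \<le> ennreal ((2 + 2 * (cmod c)\<^sup>2) * \<epsilon>)"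
proof -
  have "sq_norm M (\<lambda>t. f t + c *\<^sub>C f' t) \<le> 2 * sq_norm M f + 2 * sq_norm M (\<lambda>t. c *\<^sub>C f' t)"
    by (intro sq_norm_add_le f strongly_measurable_scaleC f')
  also have "\<dots> \<le> 2 * ennreal \<epsilon> + 2 * (ennreal ((cmod c)\<^sup>2) * ennreal \<epsilon>)"
    unfolding sq_norm_scaleC[OF f'] by (intro add_mono mult_left_mono le) auto
  also have "\<dots> = ennreal ((2 + 2 * (cmod c)\<^sup>2) * \<epsilon>)"
    using \<open>0 \<le> \<epsilon>\<close> unfolding distrib_right by (subst ennreal_plus) (auto simp: ennreal_mult mult.assoc)
  finally show ?thesis .
qed

lemma regularity_rel_add_scaleC:
  assumes rel: "regularity_rel f g" "regularity_rel f' g'"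
  shows "regularity_rel (\<lambda>t. f t + c *\<^sub>C f' t) (\<lambda>t. g t + c *\<^sub>C g' t)"
  unfolding regularity_rel_def
proof (intro conjI allI impI)
  have sm: "strongly_measurable M f" "strongly_measurable M g" "strongly_measurable M f'" "strongly_measurable M g'"
    using rel by (auto simp: regularity_rel_def)
  show "strongly_measurable M (\<lambda>t. f t + c *\<^sub>C f' t)" "strongly_measurable M (\<lambda>t. g t + c *\<^sub>C g' t)"
    using sm by (auto intro: strongly_measurable_add strongly_measurable_scaleC)
  fix \<epsilon> :: real assume "0 < \<epsilon>"
  define r where "r = 2 + 2 * (cmod c)\<^sup>2"
  have r: "0 < r" unfolding r_def by (intro add_pos_nonneg) auto
  define e where "e = \<epsilon> / r"
  have e: "0 < e" "r * e = \<epsilon>" using r \<open>0 < \<epsilon>\<close> by (auto simp: e_def)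
  obtain k \<phi> where \<phi>: "dyadic_step k \<phi>" "sq_norm M (\<lambda>t. f t - \<phi> t) \<le> ennreal e"
    "sq_norm M (\<lambda>t. g t - step_regularity k \<phi> t) \<le> ennreal e"
    using regularity_relD[OF rel(1) e(1)] .
  obtain l \<psi> where \<psi>: "dyadic_step l \<psi>" "sq_norm M (\<lambda>t. f' t - \<psi> t) \<le> ennreal e"
    "sq_norm M (\<lambda>t. g' t - step_regularity l \<psi> t) \<le> ennreal e"
    using regularity_relD[OF rel(2) e(1)] .
  let ?m = "max k l"
  have step: "dyadic_step ?m \<phi>" "dyadic_step ?m \<psi>"
    using dyadic_step_mono[OF \<phi>(1)] dyadic_step_mono[OF \<psi>(1)] by auto
  have reg: "step_regularity ?m (\<lambda>t. \<phi> t + c *\<^sub>C \<psi> t) t = step_regularity k \<phi> t + c *\<^sub>C step_regularity l \<psi> t" for t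
    unfolding step_regularity_add_scaleC step_regularity_mono[OF \<phi>(1) max.cobounded1]
      step_regularity_mono[OF \<psi>(1) max.cobounded2] ..
  have "dyadic_step ?m (\<lambda>t. \<phi> t + c *\<^sub>C \<psi> t)"
    by (rule dyadic_step_compose2[OF step]) simp
  moreover have "sq_norm M (\<lambda>t. f t + c *\<^sub>C f' t - (\<phi> t + c *\<^sub>C \<psi> t)) \<le> ennreal \<epsilon>"
  proof -
    have "sq_norm M (\<lambda>t. (f t - \<phi> t) + c *\<^sub>C (f' t - \<psi> t)) \<le> ennreal (r * e)"
      unfolding r_def using e strongly_measurable_dyadic_step[OF \<phi>(1)] strongly_measurable_dyadic_step[OF \<psi>(1)]
      by (intro sq_norm_add_scaleC_le strongly_measurable_diff sm \<phi> \<psi>) auto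
    thus ?thesis unfolding e(2) by (simp add: scaleC_diff_right algebra_simps)
  qed
  moreover have "sq_norm M (\<lambda>t. g t + c *\<^sub>C g' t - step_regularity ?m (\<lambda>t. \<phi> t + c *\<^sub>C \<psi> t) t) \<le> ennreal \<epsilon>"
  proof -
    have "sq_norm M (\<lambda>t. (g t - step_regularity k \<phi> t) + c *\<^sub>C (g' t - step_regularity l \<psi> t)) \<le> ennreal (r * e)"
      unfolding r_def using e
      by (intro sq_norm_add_scaleC_le strongly_measurable_diff sm \<phi> \<psi> strongly_measurable_step) auto
    thus ?thesis unfolding reg e(2) by (simp add: scaleC_diff_right algebra_simps)
  qed
  ultimately show "\<exists>k \<rho>. dyadic_step k \<rho> \<and> sq_norm M (\<lambda>t. f t + c *\<^sub>C f' t - \<rho> t) \<le> ennreal \<epsilon> \<and>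
      sq_norm M (\<lambda>t. g t + c *\<^sub>C g' t - step_regularity k \<rho> t) \<le> ennreal \<epsilon>" by blast
qed

lemma regularity_rel_diff:
  "regularity_rel f g \<Longrightarrow> regularity_rel f' g' \<Longrightarrow> regularity_rel (\<lambda>t. f t - f' t) (\<lambda>t. g t - g' t)"
  using regularity_rel_add_scaleC[of f g f' g' "-1"] by (simp add: scaleC_minus_one)

text \<open>By linearity the difference of two pairs is again in the relation, and its first
  component is 0 almost everywhere, so the bound annihilates the second.\<close>

lemma regularity_rel_unique:
  assumes "regularity_rel f g" "regularity_rel f' g'" "AE t in M. f t = f' t"
  shows "AE t in M. g t = g' t"
proof -
  have rel: "regularity_rel (\<lambda>t. f t - f' t) (\<lambda>t. g t - g' t)"
    using assms(1,2) by (rule regularity_rel_diff)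
  have "sq_norm M (\<lambda>t. f t - f' t) = sq_norm M (\<lambda>t. 0 :: 'a)"
    using assms(3) by (intro sq_norm_cong_AE) auto
  hence "sq_norm M (\<lambda>t. g t - g' t) = 0" using regularity_rel_bound[OF rel] by simp
  moreover have "strongly_measurable M (\<lambda>t. g t - g' t)" using rel by (simp add: regularity_rel_def)
  from borel_measurable_norm[OF this]
  have "(\<lambda>t. ennreal ((norm (g t - g' t))\<^sup>2)) \<in> borel_measurable M" by measurable
  ultimately have "AE t in M. ennreal ((norm (g t - g' t))\<^sup>2) = 0"
    unfolding sq_norm_def by (simp add: nn_integral_0_iff_AE)
  thus ?thesis by eventually_elim simp
qed

text \<open>The outputs G i of approximating steps form a Cauchy sequence but are not simple, as
  \<open>L2_complete\<close> demands; each is therefore replaced by a dyadic step \<sigma> i within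
  1 / 4 ^ i, and the limit of these serves for G.\<close>

lemma regularity_rel_exists:
  assumes f: "strongly_measurable M f" "sq_norm M f < \<infinity>"
  shows "\<exists>g. regularity_rel f g"
proof -
  define R where "R = step_const"
  have R: "0 \<le> R" by (simp add: R_def step_const_nonneg)
  have "approximable UNIV f" by (rule approximable_if_square_integrable) (use f in auto)
  hence "\<exists>k \<phi>. dyadic_step k \<phi> \<and> sq_norm M (\<lambda>t. f t - \<phi> t) \<le> ennreal (1 / 4 ^ i)" for i :: nat
    using approximableD[of UNIV f "1 / 4 ^ i"] by auto
  then obtain k \<phi> where \<phi>: "\<And>i. dyadic_step (k i) (\<phi> i)"
    "\<And>i. sq_norm M (\<lambda>t. f t - \<phi> i t) \<le> ennreal (1 / 4 ^ i)" by metis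
  define G where "G i = step_regularity (k i) (\<phi> i)" for i
  have smG: "strongly_measurable M (G i)" for i by (simp add: G_def strongly_measurable_step)
  have sm\<phi>: "strongly_measurable M (\<phi> i)" for i by (rule strongly_measurable_dyadic_step[OF \<phi>(1)])
  have relG: "regularity_rel (\<phi> i) (G i)" for i unfolding G_def by (rule regularity_rel_step[OF \<phi>(1)])
  have finG: "sq_norm M (G i) < \<infinity>" for i
  proof -
    have "sq_norm M (\<phi> i) \<le> 2 * sq_norm M (\<lambda>t. \<phi> i t - f t) + 2 * sq_norm M (\<lambda>t. f t - 0)"
      using sq_norm_triangle[OF sm\<phi> f(1) strongly_measurable_const[of M 0]] by simp
    also have "\<dots> < \<infinity>"
      using f(2) le_less_trans[OF \<phi>(2)[of i] ennreal_less_top]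
      by (simp add: sq_norm_minus_commute[of M "\<phi> i"] ennreal_mult_less_top)
    finally have "ennreal (4 * step_const) * sq_norm M (\<phi> i) < \<infinity>" by (simp add: ennreal_mult_less_top)
    thus ?thesis using regularity_rel_bound[OF relG[of i]] by (rule le_less_trans[rotated])
  qed
  have "approximable UNIV (G i)" for i
    by (rule approximable_if_square_integrable) (use smG finG in auto)
  hence "\<exists>l \<sigma>. dyadic_step l \<sigma> \<and> sq_norm M (\<lambda>t. G i t - \<sigma> t) \<le> ennreal (1 / 4 ^ i)" for i :: nat
    using approximableD[of UNIV "G i" "1 / 4 ^ i"] by auto
  then obtain l \<sigma> where \<sigma>: "\<And>i. dyadic_step (l i) (\<sigma> i)"
    "\<And>i. sq_norm M (\<lambda>t. G i t - \<sigma> i t) \<le> ennreal (1 / 4 ^ i)" by metis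
  have sm\<sigma>: "strongly_measurable M (\<sigma> i)" for i by (rule strongly_measurable_dyadic_step[OF \<sigma>(1)])
  \<comment> \<open>Collected from 2 p + 2 (32 R p + 2 p) with p = 1 / 4 ^ i: the R term measures
    the distance of the outputs, the rest the replacement of G by \<sigma> at both indices.\<close>
  define c where "c = 6 + 64 * R"
  have cauchy: "sq_norm M (\<lambda>t. \<sigma> n t - \<sigma> i t) \<le> ennreal (c / 4 ^ i)" if "i \<le> n" for i n
  proof -
    define p where "p = 1 / (4::real) ^ i"
    have p: "0 < p" by (simp add: p_def)
    have "1 / 4 ^ n \<le> p" using that by (auto simp: p_def intro!: divide_left_mono power_increasing)
    hence le: "ennreal (1 / 4 ^ n) \<le> ennreal p" by (rule ennreal_leI)
    have "sq_norm M (\<lambda>t. \<phi> n t - \<phi> i t) \<le> 2 * sq_norm M (\<lambda>t. \<phi> n t - f t) + 2 * sq_norm M (\<lambda>t. f t - \<phi> i t)"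
      by (intro sq_norm_triangle sm\<phi> f)
    also have "\<dots> \<le> 2 * ennreal p + 2 * ennreal p"
      using \<phi>(2)[of i] order.trans[OF \<phi>(2)[of n] le] unfolding p_def[symmetric] sq_norm_minus_commute[of M "\<phi> n"]
      by (intro add_mono mult_left_mono) auto
    also have "\<dots> = ennreal (4 * p)" using p by (subst two_ennreal_add) auto
    finally have d\<phi>: "sq_norm M (\<lambda>t. \<phi> n t - \<phi> i t) \<le> ennreal (4 * p)" .
    have "sq_norm M (\<lambda>t. G n t - G i t) \<le> ennreal (4 * R) * sq_norm M (\<lambda>t. \<phi> n t - \<phi> i t)"
      unfolding R_def by (intro regularity_rel_bound regularity_rel_diff relG)
    also have "\<dots> \<le> ennreal (4 * R) * ennreal (4 * p)" by (intro mult_left_mono d\<phi>) auto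
    also have "\<dots> = ennreal (16 * R * p)" using R p by (subst ennreal_mult[symmetric]) auto
    finally have dG: "sq_norm M (\<lambda>t. G n t - G i t) \<le> ennreal (16 * R * p)" .
    have "sq_norm M (\<lambda>t. G n t - \<sigma> i t) \<le> 2 * sq_norm M (\<lambda>t. G n t - G i t) + 2 * sq_norm M (\<lambda>t. G i t - \<sigma> i t)"
      by (intro sq_norm_triangle smG sm\<sigma>)
    also have "\<dots> \<le> 2 * ennreal (16 * R * p) + 2 * ennreal p"
      using \<sigma>(2)[of i] unfolding p_def[symmetric] by (intro add_mono mult_left_mono dG) auto
    also have "\<dots> = ennreal (32 * R * p + 2 * p)" using R p by (subst two_ennreal_add) auto
    finally have dG\<sigma>: "sq_norm M (\<lambda>t. G n t - \<sigma> i t) \<le> ennreal (32 * R * p + 2 * p)" .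
    have "sq_norm M (\<lambda>t. \<sigma> n t - \<sigma> i t) \<le> 2 * sq_norm M (\<lambda>t. \<sigma> n t - G n t) + 2 * sq_norm M (\<lambda>t. G n t - \<sigma> i t)"
      by (intro sq_norm_triangle smG sm\<sigma>)
    also have "\<dots> \<le> 2 * ennreal p + 2 * ennreal (32 * R * p + 2 * p)"
      using order.trans[OF \<sigma>(2)[of n] le] unfolding sq_norm_minus_commute[of M "\<sigma> n"]
      by (intro add_mono mult_left_mono dG\<sigma>) auto
    also have "\<dots> = ennreal (c * p)" using R p by (subst two_ennreal_add) (auto simp: c_def algebra_simps)
    finally show ?thesis by (simp add: p_def)
  qed
  have "simple_function M (\<sigma> i)" for i
    by (simp add: simple_function_M simple_function_dyadic_step[OF \<sigma>(1)])
  then obtain g where g: "strongly_measurable M g" "\<And>i. sq_norm M (\<lambda>t. g t - \<sigma> i t) \<le> ennreal (c / 4 ^ i)"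
    using L2_complete[OF _ cauchy] by blast
  have c: "1 \<le> 2 * c + 2" "0 \<le> c" using R by (auto simp: c_def)
  have gG: "sq_norm M (\<lambda>t. g t - G i t) \<le> ennreal ((2 * c + 2) / 4 ^ i)" for i
  proof -
    have "sq_norm M (\<lambda>t. g t - G i t) \<le> 2 * sq_norm M (\<lambda>t. g t - \<sigma> i t) + 2 * sq_norm M (\<lambda>t. \<sigma> i t - G i t)"
      by (intro sq_norm_triangle smG sm\<sigma> g)
    also have "\<dots> \<le> 2 * ennreal (c / 4 ^ i) + 2 * ennreal (1 / 4 ^ i)"
      using \<sigma>(2)[of i] unfolding sq_norm_minus_commute[of M "\<sigma> i"]
      by (intro add_mono mult_left_mono g) auto
    also have "\<dots> = ennreal ((2 * c + 2) / 4 ^ i)"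
      using c by (subst two_ennreal_add) (auto simp: add_divide_distrib)
    finally show ?thesis .
  qed
  have "regularity_rel f g"
    unfolding regularity_rel_def
  proof (intro conjI allI impI f g)
    fix \<epsilon> :: real assume "0 < \<epsilon>"
    then obtain i where i: "(1 / 4) ^ i < \<epsilon> / (2 * c + 2)"
      using real_arch_pow_inv[of "\<epsilon> / (2 * c + 2)" "1 / 4"] c by auto
    hence i': "(2 * c + 2) / 4 ^ i \<le> \<epsilon>" using c by (simp add: field_simps)
    moreover have "1 / 4 ^ i \<le> (2 * c + 2) / 4 ^ i" using c by (intro divide_right_mono) auto
    ultimately have "1 / 4 ^ i \<le> \<epsilon>" by linarith
    thus "\<exists>k \<phi>. dyadic_step k \<phi> \<and> sq_norm M (\<lambda>t. f t - \<phi> t) \<le> ennreal \<epsilon> \<and>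
        sq_norm M (\<lambda>t. g t - step_regularity k \<phi> t) \<le> ennreal \<epsilon>"
      using \<phi>[of i] gG[of i] i' unfolding G_def
      by (intro exI[of _ "k i"] exI[of _ "\<phi> i"]) (auto intro: order.trans[OF _ ennreal_leI])
  qed
  thus ?thesis by blast
qed

definition extension :: "(real \<Rightarrow> 'a) \<Rightarrow> real \<Rightarrow> 'a" where
  "extension f = (SOME g. regularity_rel f g)"

lemma regularity_rel_extension:
  assumes "f \<in> L2_fun M"
  shows "regularity_rel f (extension f)"
proof -
  have "\<exists>g. regularity_rel f g"
    using assms by (intro regularity_rel_exists) (auto simp: L2_fun_iff)
  thus ?thesis unfolding extension_def by (rule someI_ex)
qed

text \<open>\<open>extension\<close> chooses a representative separately for each f, so its
  algebraic laws hold almost everywhere only, each by \<open>regularity_rel_unique\<close>.\<close>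

lemma bounded_operator_extension: "bounded_operator_L2 M extension"
  unfolding bounded_operator_L2_def
proof (intro conjI ballI allI impI)
  have sm: "strongly_measurable M (extension f)" if "f \<in> L2_fun M" for f :: "real \<Rightarrow> 'a"
    using regularity_rel_extension[OF that] by (simp add: regularity_rel_def)
  have add_scale_mem: "(\<lambda>t. f t + c *\<^sub>C g t) \<in> L2_fun M" if fg: "f \<in> L2_fun M" "g \<in> L2_fun M" for f g :: "real \<Rightarrow> 'a" and c
  proof -
    have "sq_norm M (\<lambda>t. f t + c *\<^sub>C g t) \<le> 2 * sq_norm M f + 2 * (ennreal ((cmod c)\<^sup>2) * sq_norm M g)"
      using sq_norm_add_le[of f "\<lambda>t. c *\<^sub>C g t"] fg
      by (simp add: L2_fun_iff strongly_measurable_scaleC sq_norm_scaleC)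
    also have "\<dots> < \<infinity>" using fg by (simp add: L2_fun_iff ennreal_mult_less_top)
    finally show ?thesis
      using fg by (simp add: L2_fun_iff strongly_measurable_scaleC strongly_measurable_add)
  qed
  have linear: "AE t in M. extension (\<lambda>t. f t + c *\<^sub>C g t) t = extension f t + c *\<^sub>C extension g t"
    if fg: "f \<in> L2_fun M" "g \<in> L2_fun M" for f g :: "real \<Rightarrow> 'a" and c
    by (rule regularity_rel_unique[OF regularity_rel_extension[OF add_scale_mem[OF fg]]
          regularity_rel_add_scaleC[OF regularity_rel_extension[OF fg(1)] regularity_rel_extension[OF fg(2)]]]) simp
  have zero_mem: "(\<lambda>_. 0) \<in> L2_fun M" by (simp add: L2_fun_iff)
  have zero: "AE t in M. extension (\<lambda>_. 0) t = 0"
  proof -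
    have "regularity_rel (\<lambda>_. 0) (step_regularity 0 (\<lambda>_. 0))"
      by (rule regularity_rel_step[OF dyadic_step_zero])
    also have "step_regularity 0 (\<lambda>_. 0) = (\<lambda>_. 0)" by (simp add: step_regularity_def fun_eq_iff)
    finally show ?thesis
      by (rule regularity_rel_unique[OF regularity_rel_extension[OF zero_mem]]) simp
  qed
  fix f :: "real \<Rightarrow> 'a" assume f: "f \<in> L2_fun M"
  note bd = regularity_rel_bound[OF regularity_rel_extension[OF f]]
  show "extension f \<in> L2_fun M"
    using bd f sm[OF f] le_less_trans[OF bd] by (simp add: L2_fun_iff ennreal_mult_less_top)
  show "AE t in M. extension (\<lambda>t. c *\<^sub>C f t) t = c *\<^sub>C extension f t" for c
  proof -
    have "AE t in M. extension (\<lambda>t. c *\<^sub>C f t) t = extension (\<lambda>_. 0) t + c *\<^sub>C extension f t"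
      using linear[OF zero_mem f, of c] by simp
    thus ?thesis using zero by eventually_elim simp
  qed
  fix g :: "real \<Rightarrow> 'a" assume g: "g \<in> L2_fun M"
  show "AE t in M. extension (\<lambda>t. f t + g t) t = extension f t + extension g t"
    using linear[OF f g, of 1] by simp
  show "AE t in M. extension f t = extension g t" if "AE t in M. f t = g t"
    using that by (rule regularity_rel_unique[OF regularity_rel_extension[OF f] regularity_rel_extension[OF g]])
next
  show "\<exists>C. \<forall>f\<in>L2_fun M. L2_norm M (extension f) \<le> C * L2_norm M f"
  proof (intro exI ballI)
    fix f :: "real \<Rightarrow> 'a" assume f: "f \<in> L2_fun M"
    have "enn2real (sq_norm M (extension f)) \<le> enn2real (ennreal (4 * step_const) * sq_norm M f)"
      using regularity_rel_bound[OF regularity_rel_extension[OF f]] f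
      by (intro enn2real_mono) (auto simp: L2_fun_iff ennreal_mult_less_top)
    also have "\<dots> = (4 * step_const) * enn2real (sq_norm M f)"
      using step_const_nonneg by (simp add: enn2real_mult)
    finally have "sqrt (enn2real (sq_norm M (extension f))) \<le> sqrt (4 * step_const) * sqrt (enn2real (sq_norm M f))"
      by (subst real_sqrt_mult[symmetric]) (rule real_sqrt_le_mono)
    thus "L2_norm M (extension f) \<le> sqrt (4 * step_const) * L2_norm M f"
      by (simp add: L2_norm_def sq_norm_def)
  qed
qed

end

section \<open>Identification with the singular integral\<close>

abbreviation "simple_integrable \<equiv> Bochner_Integration.simple_bochner_integrable"
abbreviation "simple_integral_of \<equiv> Bochner_Integration.simple_bochner_integral"

text \<open>Two approximating sequences are compared through f in L1. Uniqueness turns the definite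
  description in \<open>strong_integral\<close> into the value found by any one
  approximation.\<close>

lemma has_strong_integral_unique:
  fixes f :: "real \<Rightarrow> 'b::real_normed_vector"
  assumes S: "S \<in> sets lebesgue"
    and y: "has_strong_integral (lebesgue_on S) f y" and z: "has_strong_integral (lebesgue_on S) f z"
  shows "y = z"
proof -
  let ?N = "lebesgue_on S"
  have f: "strongly_measurable ?N f" using y by (simp add: has_strong_integral_def)
  obtain s where s: "\<And>i. simple_integrable ?N (s i)"
    "(\<lambda>i. \<integral>\<^sup>+x. ennreal (norm (f x - s i x)) \<partial>?N) \<longlonglongrightarrow> 0"
    "(\<lambda>i. simple_integral_of ?N (s i)) \<longlonglongrightarrow> y"
    using y unfolding has_strong_integral_def by blast
  obtain r where r: "\<And>i. simple_integrable ?N (r i)"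
    "(\<lambda>i. \<integral>\<^sup>+x. ennreal (norm (f x - r i x)) \<partial>?N) \<longlonglongrightarrow> 0"
    "(\<lambda>i. simple_integral_of ?N (r i)) \<longlonglongrightarrow> z"
    using z unfolding has_strong_integral_def by blast
  have meas: "(\<lambda>x. ennreal (norm (f x - u x))) \<in> borel_measurable ?N"
    if "simple_integrable ?N u" for u
  proof -
    have "strongly_measurable ?N u"
      using that by (intro strongly_measurable_simple) (simp add: simple_bochner_integrable.simps)
    hence "(\<lambda>x. norm (f x - u x)) \<in> borel_measurable ?N"
      by (intro borel_measurable_norm_lebesgue_on[OF S] strongly_measurable_diff f)
    thus ?thesis by measurable
  qed
  have le: "ennreal (norm (simple_integral_of ?N (s i) - simple_integral_of ?N (r i)))
      \<le> (\<integral>\<^sup>+x. ennreal (norm (f x - s i x)) \<partial>?N) + (\<integral>\<^sup>+x. ennreal (norm (f x - r i x)) \<partial>?N)" for i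
  proof -
    have sr: "simple_integrable ?N (\<lambda>x. s i x - r i x)"
      using s(1) r(1) by (intro simple_bochner_integrable_compose2[where p = "(-)"]) auto
    have nsr: "simple_integrable ?N (\<lambda>x. norm (s i x - r i x))"
      by (rule simple_bochner_integrable_compose2[where p = "\<lambda>x y. norm x", OF _ sr sr]) simp
    have "ennreal (norm (simple_integral_of ?N (s i) - simple_integral_of ?N (r i)))
        \<le> ennreal (simple_integral_of ?N (\<lambda>x. norm (s i x - r i x)))"
      unfolding simple_bochner_integral_diff[OF s(1) r(1), symmetric]
      by (intro ennreal_leI simple_bochner_integral_norm_bound sr)
    also have "\<dots> = (\<integral>\<^sup>+x. ennreal (norm (s i x - r i x)) \<partial>?N)"
      by (rule simple_bochner_integral_eq_nn_integral[OF nsr]) simp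
    also have "\<dots> \<le> (\<integral>\<^sup>+x. ennreal (norm (f x - s i x)) + ennreal (norm (f x - r i x)) \<partial>?N)"
    proof (intro nn_integral_mono)
      fix x
      have "norm (s i x - r i x) \<le> norm (f x - s i x) + norm (f x - r i x)"
        using norm_triangle_ineq4[of "f x - r i x" "f x - s i x"] by (simp add: algebra_simps)
      hence "ennreal (norm (s i x - r i x)) \<le> ennreal (norm (f x - s i x) + norm (f x - r i x))"
        by (rule ennreal_leI)
      thus "ennreal (norm (s i x - r i x)) \<le> ennreal (norm (f x - s i x)) + ennreal (norm (f x - r i x))"
        by (simp add: ennreal_plus)
    qed
    also have "\<dots> = (\<integral>\<^sup>+x. ennreal (norm (f x - s i x)) \<partial>?N) + (\<integral>\<^sup>+x. ennreal (norm (f x - r i x)) \<partial>?N)"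
      by (intro nn_integral_add meas s r)
    finally show ?thesis .
  qed
  have "ennreal (norm (y - z)) \<le> 0 + 0"
  proof (rule LIMSEQ_le)
    show "(\<lambda>i. ennreal (norm (simple_integral_of ?N (s i)
        - simple_integral_of ?N (r i)))) \<longlonglongrightarrow> ennreal (norm (y - z))"
      by (intro tendsto_ennrealI tendsto_norm tendsto_diff s r)
    show "(\<lambda>i. (\<integral>\<^sup>+x. ennreal (norm (f x - s i x)) \<partial>?N) + (\<integral>\<^sup>+x. ennreal (norm (f x - r i x)) \<partial>?N)) \<longlonglongrightarrow> 0 + 0"
      by (intro tendsto_add s r)
  qed (use le in blast)
  thus ?thesis by (simp add: ennreal_eq_0_iff)
qed

lemma strong_integral_eqI:
  fixes f :: "real \<Rightarrow> 'b::real_normed_vector"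
  assumes "S \<in> sets lebesgue" "has_strong_integral (lebesgue_on S) f y"
  shows "strong_integral (lebesgue_on S) f = y"
proof -
  have "(THE y. has_strong_integral (lebesgue_on S) f y) = y"
    using assms(2) by (rule the_equality) (rule has_strong_integral_unique[OF assms(1) _ assms(2)])
  thus ?thesis using assms(2) by (auto simp: strong_integral_def)
qed

section \<open>Step functions with values in the domain\<close>

context regular_semigroup
begin

text \<open>T a carries the difference quotient at 0 to the one at a with loss K, whence uniformity
  in a; continuity of the orbit of A x then moves the evaluation point from a to any c in the
  interval.\<close>

lemma difference_quotient_uniform:
  assumes x: "x \<in> D" and \<epsilon>: "0 < \<epsilon>"
  shows "\<exists>d>0. \<forall>a b c. 0 \<le> a \<and> a < b \<and> b < a + d \<and> a \<le> c \<and> c \<le> b \<longrightarrow>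
           norm (inverse (b - a) *\<^sub>R (T a x - T b x) - T c (A x)) < \<epsilon>"
proof -
  have K: "0 < K" using K_ge_1 by simp
  have "\<forall>\<^sub>F r in at_right 0. dist (inverse r *\<^sub>R (T r x - x)) (- A x) < \<epsilon> / (2 * K)"
    using \<epsilon> K by (intro tendstoD[OF generator[OF x]]) auto
  then obtain d1 where d1: "0 < d1"
    "\<And>r. 0 < r \<Longrightarrow> r < d1 \<Longrightarrow> norm (inverse r *\<^sub>R (T r x - x) + A x) < \<epsilon> / (2 * K)"
    by (auto simp: eventually_at_right_field dist_norm)
  obtain d2 where d2: "0 < d2"
    "\<And>a b. 0 \<le> a \<Longrightarrow> a \<le> b \<Longrightarrow> b < a + d2 \<Longrightarrow> norm (T b (A x) - T a (A x)) < \<epsilon> / 2"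
    using orbit_modulus[of "\<epsilon> / 2" "A x"] \<epsilon> by auto
  have "norm (inverse (b - a) *\<^sub>R (T a x - T b x) - T c (A x)) < \<epsilon>"
    if h: "0 \<le> a" "a < b" "b < a + min d1 d2" "a \<le> c" "c \<le> b" for a b c
  proof -
    define r where "r = b - a"
    have r: "0 < r" "r < d1" "r < d2" "b = a + r" using h by (auto simp: r_def)
    have "T a (inverse r *\<^sub>R (T r x - x) + A x) = inverse r *\<^sub>R (T b x - T a x) + T a (A x)"
      using h r add_time[of a r x] by (simp add: add scaleR diff)
    hence "inverse r *\<^sub>R (T a x - T b x) - T c (A x)
        = - T a (inverse r *\<^sub>R (T r x - x) + A x) - (T c (A x) - T a (A x))"
      by (simp add: algebra_simps)
    also have "norm \<dots> \<le> norm (T a (inverse r *\<^sub>R (T r x - x) + A x)) + norm (T c (A x) - T a (A x))"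
      by (rule order.trans[OF norm_triangle_ineq4]) simp
    also have "\<dots> \<le> K * norm (inverse r *\<^sub>R (T r x - x) + A x) + norm (T c (A x) - T a (A x))"
      using bound[OF h(1)] by (intro add_right_mono)
    also have "\<dots> < K * (\<epsilon> / (2 * K)) + \<epsilon> / 2"
      using h r K by (intro add_strict_mono mult_strict_left_mono d1(2) d2(2)) auto
    also have "\<dots> = \<epsilon>" using K by simp
    finally show ?thesis by (simp add: r_def)
  qed
  thus ?thesis using d1(1) d2(1) by (intro exI[of _ "min d1 d2"]) auto
qed

lemma difference_quotient_uniform_finite:
  assumes "finite X" "X \<subseteq> D" and \<epsilon>: "0 < \<epsilon>"
  shows "\<exists>d>0. \<forall>x\<in>X. \<forall>a b c. 0 \<le> a \<and> a < b \<and> b < a + d \<and> a \<le> c \<and> c \<le> b \<longrightarrow>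
           norm (inverse (b - a) *\<^sub>R (T a x - T b x) - T c (A x)) < \<epsilon>"
  using assms(1,2)
proof (induction X)
  case empty
  show ?case by (intro exI[of _ 1]) simp
next
  case (insert y X)
  then obtain d where d: "0 < d" "\<And>x a b c. x \<in> X \<Longrightarrow> 0 \<le> a \<Longrightarrow> a < b \<Longrightarrow> b < a + d \<Longrightarrow> a \<le> c \<Longrightarrow> c \<le> b \<Longrightarrow>
           norm (inverse (b - a) *\<^sub>R (T a x - T b x) - T c (A x)) < \<epsilon>"
    by auto
  obtain e where e: "0 < e" "\<And>a b c. 0 \<le> a \<Longrightarrow> a < b \<Longrightarrow> b < a + e \<Longrightarrow> a \<le> c \<Longrightarrow> c \<le> b \<Longrightarrow>
           norm (inverse (b - a) *\<^sub>R (T a y - T b y) - T c (A y)) < \<epsilon>"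
    using difference_quotient_uniform[OF _ \<epsilon>, of y] insert.prems by auto
  show ?case using d e by (intro exI[of _ "min d e"]) auto
qed

text \<open>On each cell of a fine grid the integrand is replaced by the difference quotient of the
  orbit over that cell. The integral of the resulting simple function is exactly the telescoping
  sum, while the integrand changes by less than \<epsilon>.\<close>

lemma step_regularity_simple_integral:
  assumes \<phi>: "dyadic_step k \<phi>" and \<phi>D: "range \<phi> \<subseteq> D" and t: "0 < t" and \<epsilon>: "0 < \<epsilon>"
  shows "\<exists>\<sigma>. simple_integrable (lebesgue_on {0<..<t}) \<sigma> \<and>
           simple_integral_of (lebesgue_on {0<..<t}) \<sigma> = step_regularity k \<phi> t \<and>
           (\<forall>s\<in>{0<..<t}. norm (T (t - s) (A (\<phi> s)) - \<sigma> s) < \<epsilon>)"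
proof -
  let ?N = "lebesgue_on {0<..<t}"
  obtain d where d: "0 < d"
    "\<And>x a b c. x \<in> range \<phi> \<Longrightarrow> 0 \<le> a \<Longrightarrow> a < b \<Longrightarrow> b < a + d \<Longrightarrow> a \<le> c \<Longrightarrow> c \<le> b \<Longrightarrow>
       norm (inverse (b - a) *\<^sub>R (T a x - T b x) - T c (A x)) < \<epsilon>"
    using difference_quotient_uniform_finite[OF finite_range_dyadic_step[OF \<phi>] \<phi>D \<epsilon>] by blast
  obtain m where m: "(1 / 2) ^ m < d" using real_arch_pow_inv[OF d(1), of "1/2"] by auto
  define l where "l = max k m"
  define h where "h = (1::real) / 2 ^ l"
  have h: "0 < h" "h < d"
  proof -
    have "h \<le> 1 / 2 ^ m" unfolding h_def by (intro divide_left_mono power_increasing) (auto simp: l_def)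
    thus "h < d" using m by (simp add: power_divide)
  qed (simp add: h_def)
  have \<phi>l: "dyadic_step l \<phi>" by (rule dyadic_step_mono[OF \<phi>]) (simp add: l_def)
  \<comment> \<open>\<open>a j\<close> and \<open>b j\<close> are the elapsed times t - s at the two
    ends of cell j, cut off at 0, so b j - a j is the length of the part of the cell before
    t.\<close>
  define a where "a j = max 0 (t - real (Suc j) * h)" for j
  define b where "b j = max 0 (t - real j * h)" for j
  define x where "x j = \<phi> (real j * h)" for j
  define v where "v j = inverse (b j - a j) *\<^sub>R (T (a j) (x j) - T (b j) (x j))" for j
  have x0: "x 0 = 0" using dyadic_step_at_zero[OF \<phi>] by (simp add: x_def)
  have cell: "real (idx l s) * h \<le> s" "s < real (Suc (idx l s)) * h" if "0 < s" for s
    using idx_bounds[of s l] that by (auto simp: h_def add.commute)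
  have idx_meas: "idx l \<in> ?N \<rightarrow>\<^sub>M count_space UNIV"
    unfolding lebesgue_on_Ioo by (intro measurable_restrict_space1 idx_measurable)
  have idx_bd: "idx l s < nat \<lceil>t / h\<rceil> + 1" if "s \<in> {0<..<t}" for s
  proof -
    have "real (idx l s) \<le> t / h" using cell(1)[of s] that h by (simp add: field_simps)
    also have "\<dots> \<le> real (nat \<lceil>t / h\<rceil>)" by linarith
    finally show ?thesis by simp
  qed
  have fin: "finite (w ` idx l ` space ?N)" for w :: "nat \<Rightarrow> 'c"
    using idx_bd by (intro finite_imageI finite_subset[of "idx l ` space ?N" "{..<nat \<lceil>t / h\<rceil> + 1}"]) auto
  note simple = simple_function_idx[OF idx_meas fin]
  define \<sigma> where "\<sigma> s = v (idx l s)" for s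
  have sbi: "simple_integrable ?N \<sigma>"
  proof (rule simple_bochner_integrable.intros)
    show "simple_function ?N \<sigma>" unfolding \<sigma>_def by (rule simple)
    have "emeasure ?N {s \<in> space ?N. \<sigma> s \<noteq> 0} \<le> emeasure ?N (space ?N)" by (rule emeasure_space)
    also have "\<dots> = emeasure lborel {0<..<t}" by (simp add: emeasure_restrict_space)
    also have "\<dots> < \<infinity>" using t by simp
    finally show "emeasure ?N {s \<in> space ?N. \<sigma> s \<noteq> 0} \<noteq> \<infinity>" by simp
  qed
  have measure_cell: "measure ?N {s \<in> space ?N. idx l s = j} = b j - a j" if j: "j \<noteq> 0" "real j * h < t" for j
  proof -
    have "{s \<in> space ?N. idx l s = j} = {real j * h..<min (real (Suc j) * h) t}"
    proof (intro set_eqI iffI)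
      fix s assume "s \<in> {s \<in> space ?N. idx l s = j}"
      thus "s \<in> {real j * h..<min (real (Suc j) * h) t}" using cell[of s] by auto
    next
      fix s assume s: "s \<in> {real j * h..<min (real (Suc j) * h) t}"
      have "0 < real j * h" using j h by simp
      hence "0 < s" using s by simp
      moreover have "idx l s = j"
      proof -
        have "j \<le> idx l s" using s \<open>0 < s\<close> idx_le_iff[of s j l] by (simp add: h_def)
        moreover have "\<not> Suc j \<le> idx l s" using s \<open>0 < s\<close> idx_le_iff[of s "Suc j" l] by (simp add: h_def)
        ultimately show ?thesis by simp
      qed
      ultimately show "s \<in> {s \<in> space ?N. idx l s = j}" using s by simp
    qed
    moreover have "measure ?N {real j * h..<min (real (Suc j) * h) t} = measure lborel {real j * h..<min (real (Suc j) * h) t}"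
    proof -
      have "0 < real j * h" using j h by simp
      hence "{real j * h..<min (real (Suc j) * h) t} \<subseteq> {0<..<t}" by auto
      thus ?thesis by (subst measure_restrict_space) auto
    qed
    moreover have "real j * h \<le> min (real (Suc j) * h) t" using j h by simp
    ultimately have "measure ?N {s \<in> space ?N. idx l s = j} = min (real (Suc j) * h) t - real j * h"
      by simp
    also have "\<dots> = b j - a j" using j h by (auto simp: a_def b_def)
    finally show ?thesis .
  qed
  have "simple_integral_of ?N \<sigma>
      = (\<Sum>j\<in>idx l ` space ?N. measure ?N {s \<in> space ?N. idx l s = j} *\<^sub>R v j)"
  proof (rule simple_bochner_integral_partition[OF sbi])
    show "simple_function ?N (idx l)" using simple[of "\<lambda>n. n"] by simp
  qed (auto simp: \<sigma>_def)
  also have "\<dots> = (\<Sum>j\<in>idx l ` space ?N. T (a j) (x j) - T (b j) (x j))"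
  proof (intro sum.cong refl)
    fix j assume "j \<in> idx l ` space ?N"
    then obtain s where s: "0 < s" "s < t" "j = idx l s" by auto
    show "measure ?N {s \<in> space ?N. idx l s = j} *\<^sub>R v j = T (a j) (x j) - T (b j) (x j)"
    proof (cases "j = 0")
      case True
      thus ?thesis by (simp add: v_def x0 a_def b_def)
    next
      case False
      have lt: "real j * h < t" using cell(1)[OF s(1)] s by simp
      hence "a j < b j" using h by (auto simp: a_def b_def algebra_simps)
      thus ?thesis unfolding measure_cell[OF False lt] v_def by simp
    qed
  qed
  \<comment> \<open>The index sets differ by zero terms: beyond 4 ^ l the step vanishes, cell 0
    carries the value 0, and an unvisited cell starts at or after t, where both elapsed times are
    0.\<close>
  also have "\<dots> = (\<Sum>j<4 ^ l. T (a j) (x j) - T (b j) (x j))"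
  proof (rule sum.mono_neutral_cong)
    show "finite (idx l ` space ?N)" using fin[of "\<lambda>n. n"] by simp
    show "T (a j) (x j) - T (b j) (x j) = 0" if "j \<in> idx l ` space ?N - {..<4 ^ l}" for j
    proof -
      have "x j = 0" using that dyadic_step_grid_eq_0[OF \<phi>l, of j] by (simp add: x_def h_def)
      thus ?thesis by (simp add: a_def b_def)
    qed
    show "T (a j) (x j) - T (b j) (x j) = 0" if j: "j \<in> {..<4 ^ l} - idx l ` space ?N" for j
    proof (cases "j = 0")
      case True
      thus ?thesis by (simp add: x0 a_def b_def)
    next
      case False
      have "\<not> real j * h < t"
      proof
        assume "real j * h < t"
        moreover have "0 < real j * h" using False h by simp
        moreover have "idx l (real j * h) = j" using idx_grid[of l j] by (simp add: h_def)
        ultimately have "j \<in> idx l ` space ?N" by (intro image_eqI[of _ _ "real j * h"]) auto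
        thus False using j by simp
      qed
      moreover have "real j * h \<le> real (Suc j) * h" using h by simp
      ultimately have "a j = 0" "b j = 0" by (auto simp: a_def b_def)
      thus ?thesis by simp
    qed
  qed auto
  also have "\<dots> = step_regularity l \<phi> t"
    by (simp add: step_regularity_def a_def b_def x_def h_def)
  also have "\<dots> = step_regularity k \<phi> t" by (rule step_regularity_mono[OF \<phi>]) (simp add: l_def)
  finally have int: "simple_integral_of ?N \<sigma> = step_regularity k \<phi> t" .
  have "norm (T (t - s) (A (\<phi> s)) - \<sigma> s) < \<epsilon>" if s: "s \<in> {0<..<t}" for s
  proof -
    let ?j = "idx l s"
    have s0: "0 < s" "s < t" using s by auto
    have c: "real ?j * h \<le> s" "s < real (Suc ?j) * h" by (rule cell[OF s0(1)])+
    have x: "x ?j = \<phi> s" using dyadic_step_eq[OF \<phi>l, of s] by (simp add: x_def h_def)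
    have step: "real (Suc ?j) * h = real ?j * h + h" by (simp add: algebra_simps)
    have "norm (inverse (b ?j - a ?j) *\<^sub>R (T (a ?j) (\<phi> s) - T (b ?j) (\<phi> s)) - T (t - s) (A (\<phi> s))) < \<epsilon>"
    proof (rule d(2))
      show "0 \<le> a ?j" "a ?j < b ?j" "b ?j < a ?j + d" "a ?j \<le> t - s" "t - s \<le> b ?j"
        unfolding a_def b_def using c s0 h step by linarith+
    qed simp
    thus ?thesis by (simp add: \<sigma>_def v_def x norm_minus_commute)
  qed
  thus ?thesis using sbi int by blast
qed

end

section \<open>Approximation in the graph norm and passage to the limit\<close>

context weighted_semigroup
begin

text \<open>One sequence must converge both for t powr \<beta>, to reach the extension, and without
  weight, to control the integrals over bounded intervals; the sum of the two weights achieves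
  both.\<close>

lemma weight_one_plus: "weight (\<lambda>t. 1 + t powr \<beta>)"
  by (rule weightI) (auto intro!: continuous_intros add_pos_nonneg)

interpretation graph: weight "\<lambda>t. 1 + t powr \<beta>"
  by (rule weight_one_plus)

lemma square_integrals_le_graph:
  fixes F :: "real \<Rightarrow> 'a \<times> 'a"
  assumes F: "strongly_measurable half_line F"
  shows "sq_norm M (\<lambda>t. fst (F t)) \<le> sq_norm graph.M F" "sq_norm half_line F \<le> sq_norm graph.M F"
proof -
  have [measurable]: "(\<lambda>t. norm (F t)) \<in> borel_measurable half_line" "(\<lambda>t. norm (fst (F t))) \<in> borel_measurable half_line"
    using F by (auto intro: borel_measurable_norm_strongly_measurable strongly_measurable_fst)
  have graph: "sq_norm graph.M F = (\<integral>\<^sup>+t. ennreal (1 + t powr \<beta>) * ennreal ((norm (F t))\<^sup>2) \<partial>half_line)"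
    unfolding sq_norm_def by (rule graph.nn_integral_M) measurable
  have "sq_norm M (\<lambda>t. fst (F t)) = (\<integral>\<^sup>+t. ennreal (t powr \<beta>) * ennreal ((norm (fst (F t)))\<^sup>2) \<partial>half_line)"
    unfolding sq_norm_def by (rule nn_integral_M) measurable
  also have "\<dots> \<le> sq_norm graph.M F"
  proof -
    have "norm (fst (F t)) \<le> norm (F t)" for t using norm_fst_le[of "fst (F t)" "snd (F t)"] by simp
    thus ?thesis unfolding graph by (intro nn_integral_mono mult_mono ennreal_leI power_mono) auto
  qed
  finally show "sq_norm M (\<lambda>t. fst (F t)) \<le> sq_norm graph.M F" .
  have "sq_norm half_line F = (\<integral>\<^sup>+t. ennreal 1 * ennreal ((norm (F t))\<^sup>2) \<partial>half_line)"
    by (simp add: sq_norm_def)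
  also have "\<dots> \<le> sq_norm graph.M F" unfolding graph
    by (intro nn_integral_mono mult_right_mono ennreal_leI) auto
  finally show "sq_norm half_line F \<le> sq_norm graph.M F" .
qed

lemma graph_square_integrable_if_compact_support:
  fixes F :: "real \<Rightarrow> 'a \<times> 'a"
  assumes F: "F \<in> L2_fun half_line" and Q: "compact Q" "Q \<subseteq> {0<..}"
    and supp: "AE t in half_line. t \<notin> Q \<longrightarrow> F t = 0"
  shows "sq_norm graph.M F < \<infinity>"
proof -
  have sm: "strongly_measurable half_line F" and fin: "sq_norm half_line F < \<infinity>"
    using F by (auto simp: L2_fun_iff)
  have [measurable]: "(\<lambda>t. norm (F t)) \<in> borel_measurable half_line"
    using sm by (rule borel_measurable_norm_strongly_measurable)
  have "continuous_on Q (\<lambda>t. 1 + t powr \<beta>)"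
    using Q(2) by (intro continuous_intros) auto
  hence "bounded ((\<lambda>t. 1 + t powr \<beta>) ` Q)" using Q(1) by (intro compact_imp_bounded compact_continuous_image)
  then obtain B where B: "\<And>t. t \<in> Q \<Longrightarrow> norm (1 + t powr \<beta>) \<le> B" by (auto simp: bounded_iff)
  have "sq_norm graph.M F = (\<integral>\<^sup>+t. ennreal (1 + t powr \<beta>) * ennreal ((norm (F t))\<^sup>2) \<partial>half_line)"
    unfolding sq_norm_def by (rule graph.nn_integral_M) measurable
  also have "\<dots> \<le> (\<integral>\<^sup>+t. ennreal B * ennreal ((norm (F t))\<^sup>2) \<partial>half_line)"
  proof (rule nn_integral_mono_AE, use supp in eventually_elim)
    case (elim t)
    show ?case
    proof (cases "t \<in> Q")
      case True
      thus ?thesis using B[OF True] by (intro mult_right_mono ennreal_leI) auto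
    qed (use elim in simp)
  qed
  also have "\<dots> = ennreal B * sq_norm half_line F"
    unfolding sq_norm_def by (rule nn_integral_cmult) measurable
  also have "\<dots> < \<infinity>" using fin by (simp add: ennreal_mult_less_top)
  finally show ?thesis .
qed

text \<open>One sequence of steps serves twice. Weighted convergence of the first components makes
  their images tend to the extension almost everywhere; unweighted convergence of the second
  components shows that at every such t the limit is the strong integral.\<close>

lemma max_regularity_eq_extension:
  assumes cd: "closed_densely_defined D A" and f: "f \<in> L2c_domain D A"
  shows "AE t in half_line. extension f t = strong_integral (lebesgue_on {0<..<t}) (\<lambda>s. A (T (t - s) (f s)))"
proof -
  have D0: "0 \<in> D" and Dadd: "\<And>x y. x \<in> D \<Longrightarrow> y \<in> D \<Longrightarrow> x + y \<in> D \<and> A (x + y) = A x + A y"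
    and closed: "closed {(x, A x) | x. x \<in> D}"
    using cd by (auto simp: closed_densely_defined_def)
  have A0: "A 0 = 0" using Dadd[OF D0 D0] by simp
  \<comment> \<open>Approximating (f, A f) inside its closed graph forces the steps to be D-valued
    and makes A of them converge along with them.\<close>
  define G where "G = {(x, A x) | x. x \<in> D}"
  define F where "F t = (f t, A (f t))" for t
  have fD: "AE t in half_line. f t \<in> D" and F: "F \<in> L2_fun half_line"
    using f by (auto simp: L2c_domain_def F_def[abs_def])
  obtain Q where Q: "compact Q" "Q \<subseteq> {0<..}" "AE t in half_line. t \<notin> Q \<longrightarrow> f t = 0"
    using f by (auto simp: L2c_domain_def)
  have F0: "AE t in half_line. t \<notin> Q \<longrightarrow> F t = 0"
    using Q(3) by eventually_elim (auto simp: F_def A0 zero_prod_def)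
  have smF: "strongly_measurable half_line F" using F by (simp add: L2_fun_iff)
  have finF: "sq_norm graph.M F < \<infinity>"
    by (rule graph_square_integrable_if_compact_support[OF F Q(1,2) F0])
  have "graph.approximable G F"
  proof (rule graph.approximable_if_square_integrable)
    show "strongly_measurable graph.M F" using smF by (simp add: graph.strongly_measurable_M)
    show "AE t in graph.M. F t \<in> G" unfolding graph.AE_M using fD
      by eventually_elim (auto simp: G_def F_def)
    show "closed G" using closed by (simp add: G_def)
    show "0 \<in> G" using D0 A0 by (auto simp: G_def zero_prod_def)
    show "x + y \<in> G" if "x \<in> G" "y \<in> G" for x y using that Dadd by (auto simp: G_def)
  qed (rule finF)
  hence "\<exists>k \<Phi>. dyadic_step k \<Phi> \<and> range \<Phi> \<subseteq> G \<and> sq_norm graph.M (\<lambda>t. F t - \<Phi> t) \<le> ennreal (1 / 4 ^ i)" for i :: nat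
    by (rule graph.approximableD) simp
  hence "\<forall>i. \<exists>p. dyadic_step (fst p) (snd p) \<and> range (snd p) \<subseteq> G \<and>
      sq_norm graph.M (\<lambda>t. F t - snd p t) \<le> ennreal (1 / 4 ^ i)"
    by (simp only: split_paired_Ex fst_conv snd_conv simp_thms)
  from choice[OF this] obtain p where p: "\<And>i. dyadic_step (fst (p i)) (snd (p i))"
    "\<And>i. range (snd (p i)) \<subseteq> G" "\<And>i. sq_norm graph.M (\<lambda>t. F t - snd (p i) t) \<le> ennreal (1 / 4 ^ i)"
    by blast
  define k where "k i = fst (p i)" for i
  define \<Phi> where "\<Phi> i = snd (p i)" for i
  note \<Phi> = p[folded k_def \<Phi>_def]
  define \<phi> where "\<phi> i t = fst (\<Phi> i t)" for i t
  have \<phi>: "dyadic_step (k i) (\<phi> i)" for i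
    unfolding \<phi>_def by (rule dyadic_step_compose[OF \<Phi>(1)]) simp
  have \<Phi>_eq: "\<Phi> i t = (\<phi> i t, A (\<phi> i t))" "\<phi> i t \<in> D" for i t
  proof -
    have "\<Phi> i t \<in> G" using \<Phi>(2) by blast
    thus "\<Phi> i t = (\<phi> i t, A (\<phi> i t))" "\<phi> i t \<in> D" by (auto simp: G_def \<phi>_def)
  qed
  have sm\<Phi>: "strongly_measurable half_line (\<Phi> i)" for i
    by (rule strongly_measurable_simple[OF simple_function_dyadic_step[OF \<Phi>(1)]])
  have smd: "strongly_measurable half_line (\<lambda>t. F t - \<Phi> i t)" for i
    by (rule strongly_measurable_diff[OF smF sm\<Phi>])
  have lim\<Phi>: "AE t in half_line. (\<lambda>i. \<Phi> i t) \<longlonglongrightarrow> F t"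
    by (rule graph.AE_tendsto_if_sq_norm_le[where c = 1])
       (use smF sm\<Phi> \<Phi>(3) sq_norm_minus_commute[of graph.M F] in \<open>auto simp: graph.strongly_measurable_M\<close>)
  have fL2: "f \<in> L2_fun M"
  proof -
    have "sq_norm M (\<lambda>t. fst (F t)) < \<infinity>"
      by (rule le_less_trans[OF square_integrals_le_graph(1)[OF smF] finF])
    moreover have "strongly_measurable half_line (\<lambda>t. fst (F t))" by (rule strongly_measurable_fst[OF smF])
    ultimately show ?thesis by (simp add: L2_fun_iff strongly_measurable_M F_def)
  qed
  have lim: "AE t in half_line. (\<lambda>i. step_regularity (k i) (\<phi> i) t) \<longlonglongrightarrow> extension f t"
  proof (rule AE_tendsto_if_sq_norm_le[where c = "4 * step_const"])
    show "strongly_measurable M (extension f)"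
      using regularity_rel_extension[OF fL2] by (simp add: regularity_rel_def)
    fix i
    have "sq_norm M (\<lambda>t. step_regularity (k i) (\<phi> i) t - extension f t)
        = sq_norm M (\<lambda>t. extension f t - step_regularity (k i) (\<phi> i) t)" by (rule sq_norm_minus_commute)
    also have "\<dots> \<le> ennreal (4 * step_const) * sq_norm M (\<lambda>t. f t - \<phi> i t)"
      by (intro regularity_rel_bound regularity_rel_diff regularity_rel_extension fL2 regularity_rel_step \<phi>)
    also have "sq_norm M (\<lambda>t. f t - \<phi> i t) \<le> ennreal (1 / 4 ^ i)"
      using order.trans[OF square_integrals_le_graph(1)[OF smd] \<Phi>(3)] by (simp add: F_def \<phi>_def)
    also have "ennreal (4 * step_const) * ennreal (1 / 4 ^ i) = ennreal (4 * step_const / 4 ^ i)"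
      using step_const_nonneg by (subst ennreal_mult[symmetric]) auto
    finally show "sq_norm M (\<lambda>t. step_regularity (k i) (\<phi> i) t - extension f t) \<le> ennreal (4 * step_const / 4 ^ i)"
      by (simp add: mult_left_mono)
  qed (rule strongly_measurable_step)
  \<comment> \<open>Stated for any t at which the images converge, so the exceptional null set of
    times is the one of \<open>lim\<close> alone.\<close>
  have "has_strong_integral (lebesgue_on {0<..<t}) (\<lambda>s. A (T (t - s) (f s))) y"
    if t: "0 < t" and y: "(\<lambda>i. step_regularity (k i) (\<phi> i) t) \<longlonglongrightarrow> y" for t y
  proof -
    let ?N = "lebesgue_on {0<..<t}"
    have AE_N: "AE s in ?N. P s" if "AE s in half_line. P s" for P
    proof -
      have "AE s in lebesgue. s \<in> {0<..<t} \<longrightarrow> P s"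
        using that unfolding AE_half_line by eventually_elim auto
      thus ?thesis by (subst AE_restrict_space_iff) auto
    qed
    have "range (\<phi> i) \<subseteq> D" for i using \<Phi>_eq(2) by blast
    hence "\<exists>\<sigma>. simple_integrable ?N \<sigma> \<and>
        simple_integral_of ?N \<sigma> = step_regularity (k i) (\<phi> i) t \<and>
        (\<forall>s\<in>{0<..<t}. norm (T (t - s) (A (\<phi> i s)) - \<sigma> s) < (1 / 2) ^ i)" for i
      by (intro step_regularity_simple_integral \<phi> t) auto
    then obtain \<sigma> where \<sigma>: "\<And>i. simple_integrable ?N (\<sigma> i)"
      "\<And>i. simple_integral_of ?N (\<sigma> i) = step_regularity (k i) (\<phi> i) t"
      "\<And>i s. s \<in> {0<..<t} \<Longrightarrow> norm (T (t - s) (A (\<phi> i s)) - \<sigma> i s) < (1 / 2) ^ i" by metis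
    \<comment> \<open>A commutes with the semigroup on D, so boundedness of T (t - s) takes the
      place of any bound on the singular kernel; what remains is a distance in the graph
      norm.\<close>
    have err: "norm (A (T (t - s) (f s)) - \<sigma> i s) \<le> K * norm (F s - \<Phi> i s) + (1 / 2) ^ i"
      if s: "s \<in> {0<..<t}" "f s \<in> D" for i s
    proof -
      have pos: "0 \<le> t - s" using s by simp
      have "A (T (t - s) (f s)) - \<sigma> i s = T (t - s) (A (f s) - A (\<phi> i s)) + (T (t - s) (A (\<phi> i s)) - \<sigma> i s)"
        using domain[OF s(2) pos] by (simp add: diff[OF pos])
      also have "norm \<dots> \<le> K * norm (A (f s) - A (\<phi> i s)) + (1 / 2) ^ i"
        using \<sigma>(3)[OF s(1), of i] bound[OF pos]
        by (intro order.trans[OF norm_triangle_ineq] add_mono) auto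
      also have "norm (A (f s) - A (\<phi> i s)) \<le> norm (F s - \<Phi> i s)"
        unfolding F_def \<Phi>_eq(1) by (simp add: norm_snd_le)
      finally show ?thesis using K_ge_1 by (simp add: mult_left_mono)
    qed
    have sm: "strongly_measurable ?N (\<lambda>s. A (T (t - s) (f s)))"
      unfolding strongly_measurable_def
    proof (intro exI conjI allI)
      show "simple_function ?N (\<sigma> i)" for i
        using \<sigma>(1) by (simp add: simple_bochner_integrable.simps)
      have "AE s in ?N. s \<in> {0<..<t}" by (rule AE_I2) simp
      thus "AE s in ?N. (\<lambda>i. \<sigma> i s) \<longlonglongrightarrow> A (T (t - s) (f s))"
        using AE_N[OF lim\<Phi>] AE_N[OF fD]
      proof eventually_elim
        case (elim s)
        have "(\<lambda>i. K * norm (F s - \<Phi> i s) + (1 / 2) ^ i) \<longlonglongrightarrow> K * norm (F s - F s) + 0"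
          by (intro tendsto_intros elim LIMSEQ_power_zero) auto
        hence "(\<lambda>i. A (T (t - s) (f s)) - \<sigma> i s) \<longlonglongrightarrow> 0"
          by (intro Lim_null_comparison[OF always_eventually[OF allI[OF err[OF elim(1,3)]]]]) simp
        from tendsto_diff[OF tendsto_const[of "A (T (t - s) (f s))"] this] show ?case by simp
      qed
    qed
    \<comment> \<open>With p = 1 / 2 ^ i, the term (K + 1) t comes from integrating (K + 1) p over
      the interval, and K from K / p times a squared distance of at most p ^ 2.\<close>
    define c where "c = (K + 1) * t + K"
    have int: "(\<integral>\<^sup>+s. ennreal (norm (A (T (t - s) (f s)) - \<sigma> i s)) \<partial>?N) \<le> ennreal (c * (1 / 2) ^ i)" for i
    proof -
      define p where "p = (1 / 2 :: real) ^ i"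
      have p: "0 < p" "1 / 4 ^ i = p * p" by (auto simp: p_def power_mult_distrib[symmetric] power_divide)
      have [measurable]: "(\<lambda>s. norm (F s - \<Phi> i s)) \<in> borel_measurable half_line"
        by (rule borel_measurable_norm_strongly_measurable[OF smd])
      have "(\<integral>\<^sup>+s. ennreal (norm (A (T (t - s) (f s)) - \<sigma> i s)) \<partial>?N)
          \<le> (\<integral>\<^sup>+s. ennreal ((K + 1) * p + K / p * (norm (F s - \<Phi> i s))\<^sup>2) \<partial>?N)"
      proof (rule nn_integral_mono_AE)
        have "AE s in ?N. s \<in> {0<..<t}" by (rule AE_I2) simp
        thus "AE s in ?N. ennreal (norm (A (T (t - s) (f s)) - \<sigma> i s))
            \<le> ennreal ((K + 1) * p + K / p * (norm (F s - \<Phi> i s))\<^sup>2)"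
          using AE_N[OF fD]
        proof eventually_elim
          case (elim s)
          define w where "w = norm (F s - \<Phi> i s)"
          \<comment> \<open>The inequality w \<le> p + w ^ 2 / p converts the L2 estimate of size p
            ^ 2 into an L1 estimate of size p.\<close>
          have "0 \<le> (p - w)\<^sup>2 + p * w" using p by (simp add: w_def)
          hence "w * p \<le> p * p + w\<^sup>2" by (simp add: power2_eq_square algebra_simps)
          hence "w \<le> p + w\<^sup>2 / p" using p(1) by (simp add: field_simps)
          hence "K * w \<le> K * (p + w\<^sup>2 / p)" using K_ge_1 by (intro mult_left_mono) auto
          hence "norm (A (T (t - s) (f s)) - \<sigma> i s) \<le> (K + 1) * p + K / p * w\<^sup>2"
            using err[OF elim, of i] unfolding w_def[symmetric] p_def[symmetric] by (simp add: algebra_simps)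
          thus ?case unfolding w_def by (rule ennreal_leI)
        qed
      qed
      also have "\<dots> = (\<integral>\<^sup>+s. ennreal ((K + 1) * p) * indicator {0<..<t} s + ennreal (K / p) * (ennreal ((norm (F s - \<Phi> i s))\<^sup>2) * indicator {0<..<t} s) \<partial>half_line)"
      proof -
        have "{0<..<t} \<inter> space half_line \<in> sets half_line" by (auto simp: sets_half_line)
        moreover have "ennreal ((K + 1) * p + K / p * r) = ennreal ((K + 1) * p) + ennreal (K / p) * ennreal r"
          if "0 \<le> r" for r
          using that p(1) K_ge_1 by (subst ennreal_mult[symmetric]) (auto simp: ennreal_plus[symmetric] simp del: ennreal_plus)
        ultimately show ?thesis
          by (simp only: lebesgue_on_Ioo nn_integral_restrict_space zero_le_power2)
             (auto intro!: nn_integral_cong simp: indicator_def)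
      qed
      also have "\<dots> \<le> (\<integral>\<^sup>+s. ennreal ((K + 1) * p) * indicator {0<..<t} s + ennreal (K / p) * ennreal ((norm (F s - \<Phi> i s))\<^sup>2) \<partial>half_line)"
        by (intro nn_integral_mono add_left_mono mult_left_mono) (auto simp: indicator_def)
      also have "\<dots> = ennreal ((K + 1) * p) * emeasure half_line {0<..<t} + ennreal (K / p) * sq_norm half_line (\<lambda>s. F s - \<Phi> i s)"
      proof -
        have [measurable]: "{0<..<t} \<in> sets half_line" by (auto simp: sets_half_line)
        show ?thesis unfolding sq_norm_def
          by (subst nn_integral_add) (auto simp: nn_integral_cmult_indicator nn_integral_cmult)
      qed
      also have "\<dots> \<le> ennreal ((K + 1) * p) * ennreal t + ennreal (K / p) * ennreal (p * p)"
      proof (intro add_mono mult_left_mono)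
        have "emeasure half_line {0<..<t} = emeasure lebesgue {0<..<t}"
          unfolding half_line_def by (intro emeasure_restrict_space) auto
        thus "emeasure half_line {0<..<t} \<le> ennreal t" using t by simp
        show "sq_norm half_line (\<lambda>s. F s - \<Phi> i s) \<le> ennreal (p * p)"
          unfolding p(2)[symmetric] by (rule order.trans[OF square_integrals_le_graph(2)[OF smd] \<Phi>(3)])
      qed auto
      also have "\<dots> = ennreal (c * p)"
        using p K_ge_1 t by (simp add: ennreal_mult[symmetric] ennreal_plus[symmetric] c_def algebra_simps del: ennreal_plus)
      finally show ?thesis by (simp add: p_def)
    qed
    show ?thesis unfolding has_strong_integral_def
    proof (intro conjI sm exI[of _ \<sigma>] allI \<sigma>(1))
      have "(\<lambda>i. ennreal (c * (1 / 2) ^ i)) \<longlonglongrightarrow> ennreal (c * 0)"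
        by (intro tendsto_ennrealI tendsto_mult_left LIMSEQ_power_zero) auto
      hence up: "(\<lambda>i. ennreal (c * (1 / 2) ^ i)) \<longlonglongrightarrow> 0" by simp
      show "(\<lambda>i. \<integral>\<^sup>+s. ennreal (norm (A (T (t - s) (f s)) - \<sigma> i s)) \<partial>?N) \<longlonglongrightarrow> 0"
        by (rule tendsto_sandwich[OF always_eventually always_eventually tendsto_const up]) (use int in auto)
      show "(\<lambda>i. simple_integral_of ?N (\<sigma> i)) \<longlonglongrightarrow> y"
        unfolding \<sigma>(2) by (rule y)
    qed
  qed
  hence int: "strong_integral (lebesgue_on {0<..<t}) (\<lambda>s. A (T (t - s) (f s))) = y"
    if "0 < t" "(\<lambda>i. step_regularity (k i) (\<phi> i) t) \<longlonglongrightarrow> y" for t y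
    using that by (intro strong_integral_eqI) auto
  have "AE t in half_line. 0 < t" by (rule AE_I2) simp
  thus ?thesis using lim by eventually_elim (rule int[symmetric])
qed

end

theorem theorem1p3:
  fixes D :: "'h::complex_hilbert set"
    and A :: "'h \<Rightarrow> 'h"
    and S :: "complex \<Rightarrow> 'h \<Rightarrow> 'h"
    and \<delta> \<beta> :: real
  assumes "neg_generates_bounded_analytic_semigroup D A \<delta> S"
    and "\<beta> < 1"
  shows "\<exists>T. bounded_operator_L2 (weighted_half_line \<beta>) T \<and>
           (\<forall>f\<in>L2c_domain D A. AE t in half_line. T f t = max_regularity A S f t)"
proof -
  obtain K C where "regular_semigroup (\<lambda>t. S (complex_of_real t)) D A K C"
    using regular_semigroup_exists[OF assms(1)] by blast
  then interpret regular_semigroup "\<lambda>t. S (complex_of_real t)" D A K C .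
  interpret weighted_semigroup "\<lambda>t. S (complex_of_real t)" D A K C \<beta>
    by unfold_locales (rule assms(2))
  have "closed_densely_defined D A"
    using assms(1) by (simp add: neg_generates_bounded_analytic_semigroup_def)
  thus ?thesis
    using bounded_operator_extension max_regularity_eq_extension
    by (intro exI[of _ extension]) (simp add: M_eq max_regularity_def)
qed

end
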